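(* For every finite-dimensional real vector space $U$, write $\mathcal H_{\mathrm{CK}}=\mathcal H_{\mathrm{CK}}(U)$, $\mathcal P=\mathcal P(U)$. There exists a unique Hopf algebra isomorphism $\mathrm{Log}\colon\mathcal H_{\mathrm{CK}}\to\mathrm{Sh}(\mathcal P)$ with the property that $$\pi\circ\mathrm{Log}=\pi\circ\mathrm e ,$$ (on the left $\pi$ is the projection of $\mathrm{Sh}(\mathcal P)$ onto words of length one), and it is given by $$\mathrm{Log}=\sum_{n\ge0}(\pi\circ\mathrm e)^{\otimes n}\circ\widetilde\Delta_{\mathrm{CK}}^{(n-1)} .$$ Its inverse $\mathrm{Exp}\colon\mathrm{Sh}(\mathcal P)\to\mathcal H_{\mathrm{CK}}$ is given on $\mathrm{Sh}(\mathcal P)_+$ by $$\sum (-1)^k\big[(\pi\circ\mathrm e\circ\pi_{m^1_1})\otimes\cdots\otimes(\pi\circ\mathrm e\circ\pi_{m^1_{n^0}})\big]\circ\cdots\circ\big[(\pi\circ\mathrm e\circ\pi_{m^k_1})\otimes\cdots\otimes(\pi\circ\mathrm e\circ\pi_{m^k_{n^{k-1}}})\big],$$ where the sum is over all $k\ge0$, all integers $1\le n^0<n^1<\cdots<n^k$ and all integers $m^i_j\ge1$ with $m^i_1+\cdots+m^i_{n^{i-1}}=n^i$ for $i=1,\ldots,k$ (the total contribution of $k=0$ being the identity), or equivalently by the recursion $$\mathrm{Exp}^m_n=-\sum_{m\le k<n}\mathrm{Exp}^m_k\circ\mathrm{Log}^k_n\quad(1\le m<n),\qquad \mathrm{Exp}^n_n=\mathrm{id},$$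 where $\mathrm{Exp}^m_n=\pi_m\circ\mathrm{Exp}\circ\pi_n$ and $\mathrm{Log}^m_n=\pi_m\circ\mathrm{Log}\circ\pi_n$ for $1\le m\le n$. Moreover $\mathrm{Log}$ and $\mathrm{Exp}$ are natural isomorphisms (natural in $U$) between the functors $U\mapsto\mathcal H_{\mathrm{CK}}(U)$ and $U\mapsto\mathrm{Sh}(\mathcal P(U))$ from finite-dimensional real vector spaces to commutative $\mathbf B_\infty$-algebras, and they restrict to the identity on $\mathcal P$.
   Context: **Connes–Kreimer.** $\mathcal H(U)$ is spanned by non-planar rooted forests (including the empty forest $\mathbf 1$) with vertices decorated by elements of $U$, modulo multilinearity in the decorations; $|f|$ (weight) is the number of vertices and $\mathcal H_+$ the span of non-empty forests. $\mathcal H_{\mathrm{CK}}(U)$ is $\mathcal H(U)$ with the disjoint union product and $\Delta_{\mathrm{CK}}f=\sum_Af|_A\otimes f|_{A^c}$, over vertex subsets $A$ closed under passing to descendants (admissible cuts, upper part on the left). It is graded by weight, connected and commutative. A linear map $\theta\colon U\to U'$ induces a Hopf map $\mathcal H_{\mathrm{CK}}(U)\to\mathcal H_{\mathrm{CK}}(U')$ by applying $\theta$ to decorations; it restricts to primitives. $\widetilde\Delta_{\mathrm{CK}}h=\Delta_{\mathrm{CK}}h-\mathbf 1\otimes h-h\otimes\mathbf 1$ on $\mathcal H_+$, $\widetilde\Delta^{(n-1)}_{\mathrm{CK}}\colon\mathcal H_+\to\mathcal H_+^{\otimes n}$ are its iterates ($\widetilde\Delta^{(0)}=\mathrm{id}$),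 taken to be $0$ on $\mathbf 1$ for $n\ge1$; the $n=0$ term in a sum of the form $\sum_n\phi^{\otimes n}\circ\widetilde\Delta^{(n-1)}$ is the map $h\mapsto\varepsilon(h)\mathbf 1$. $\mathcal P(U)=\ker\widetilde\Delta_{\mathrm{CK}}\subset\mathcal H_+$ is the space of primitives. **Natural growth and projections.** $\top$ is the bilinear operation with $f\top\mathbf 1=f=\mathbf 1\top f$ and, for non-empty forests, $f\top g=\frac1{|g|}\sum_v(\text{graft all roots of }f\text{ onto }v)$ over vertices $v$ of $g$; iterates are bracketed from the left. By a theorem of Foissy, $p_1\otimes\cdots\otimes p_n\mapsto p_1\top\cdots\top p_n$ is a coalgebra isomorphism from $\bigotimes(\mathcal P)=\bigoplus_{n\ge 0}\mathcal P^{\otimes n}$ with deconcatenation onto $\mathcal H_{\mathrm{CK}}$. Through it the underlying spaces of $\mathcal H_{\mathrm{CK}}$ and $\bigotimes(\mathcal P)$ are identified; $\pi_m$ is the projection onto $\mathcal P^{\otimes m}$ and $\pi=\pi_1$. In the formula for $\mathrm{Exp}$, a tensor product $(\phi\circ\pi_{m_1})\otimes\cdots\otimes(\phi\circ\pi_{m_r})$ acts on $\mathcal P^{\otimes(m_1+\cdots+m_r)}$ by splitting words into consecutive blocks of lengths $m_1,\ldots,m_r$ and applying $\phi$ to each block (giving an element of $\mathcal P^{\otimes r}$), and is zero on $\mathcal P^{\otimes N}$ for other $N$. **Shuffle algebra.** $\mathrm{Sh}(\mathcal P)=(\bigotimes(\mathcal P),\text{shuffle product},\text{deconcatenation})$,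 graded by $|p_1\otimes\cdots\otimes p_n|=|p_1|+\cdots+|p_n|$; $\mathrm{Sh}(\mathcal P)_+$ is the span of non-empty words. **Eulerian idempotent.** $\mathrm e\colon\mathcal H_{\mathrm{CK}}\to\mathcal H_{\mathrm{CK}}$ is $\mathrm e=\log_*(\mathrm{id})$ for the convolution product, i.e. $\mathrm e(\mathbf 1)=0$ and $\mathrm e(h)=\sum_{n\ge1}\frac{(-1)^{n-1}}n\,h^{(1)}\cdots h^{(n)}$ for $h\in\mathcal H_+$, where $h^{(1)}\otimes\cdots\otimes h^{(n)}=\widetilde\Delta_{\mathrm{CK}}^{(n-1)}h$ (sum implied) and the product is the forest product. **Commutative $\mathbf B_\infty$-algebras.** This category is the full subcategory of graded connected Hopf algebras whose objects are commutative and cofree with a specified cofreeness projection; morphisms are graded Hopf algebra maps (not required to preserve the projections). *)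

theory Defs
  imports "HOL-Analysis.Finite_Function_Topology"
begin

section \<open>Tensor algebras\<close>

text \<open>\<^typ>\<open>'b \<Rightarrow>\<^sub>0 real\<close> is the free real vector space on the set \<open>'b\<close>.\<close>

definition lin_ext :: "('b \<Rightarrow> 'c::real_vector) \<Rightarrow> ('b \<Rightarrow>\<^sub>0 real) \<Rightarrow> 'c" where
  "lin_ext \<phi> x = (\<Sum>b\<in>Poly_Mapping.keys x. Poly_Mapping.lookup x b *\<^sub>R \<phi> b)"

abbreviation gen :: "'b \<Rightarrow> ('b \<Rightarrow>\<^sub>0 real)" where
  "gen b \<equiv> Poly_Mapping.single b 1"

lemma lookup_scaleR_real: "Poly_Mapping.lookup (c *\<^sub>R x) b = c * Poly_Mapping.lookup (x :: 'b \<Rightarrow>\<^sub>0 real) b"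
proof -
  have "finite {i. c *\<^sub>R Poly_Mapping.lookup x i \<noteq> 0}"
    by (rule finite_subset[OF _ finite_lookup[of x]]) auto
  then show ?thesis by (simp add: scaleR_poly_mapping_def Abs_poly_mapping_inverse)
qed

lemma lin_ext_superset:
  assumes "finite K" "Poly_Mapping.keys x \<subseteq> K"
  shows "lin_ext \<phi> x = (\<Sum>b\<in>K. Poly_Mapping.lookup x b *\<^sub>R \<phi> b)"
  unfolding lin_ext_def
  by (rule sum.mono_neutral_left) (use assms in \<open>auto simp: in_keys_iff\<close>)

lemma lin_ext_gen [simp]: "lin_ext \<phi> (gen b) = \<phi> b"
  by (simp add: lin_ext_def)

lemma linear_lin_ext: "linear (lin_ext \<phi>)"
proof (rule linearI)
  fix x y :: "'a \<Rightarrow>\<^sub>0 real" and c :: real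
  let ?K = "Poly_Mapping.keys x \<union> Poly_Mapping.keys y"
  have k: "Poly_Mapping.keys (x + y) \<subseteq> ?K" by (rule Poly_Mapping.keys_add)
  show "lin_ext \<phi> (x + y) = lin_ext \<phi> x + lin_ext \<phi> y"
    using k by (subst (1 2 3) lin_ext_superset[where K = ?K])
      (auto simp: lookup_add scaleR_add_left sum.distrib)
  have "Poly_Mapping.keys (c *\<^sub>R x) \<subseteq> Poly_Mapping.keys x"
    by (auto simp: in_keys_iff lookup_scaleR_real)
  then show "lin_ext \<phi> (c *\<^sub>R x) = c *\<^sub>R lin_ext \<phi> x"
    by (subst (1 2) lin_ext_superset[where K = "Poly_Mapping.keys x"])
      (auto simp: lookup_scaleR_real scaleR_sum_right)
qed

lemma span_cong:
  fixes x y z w :: "'a::real_vector"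
  shows span_cong_sym: "x - y \<in> span R \<Longrightarrow> y - x \<in> span R"
    and span_cong_trans: "x - y \<in> span R \<Longrightarrow> y - z \<in> span R \<Longrightarrow> x - z \<in> span R"
    and span_cong_add: "x - y \<in> span R \<Longrightarrow> z - w \<in> span R \<Longrightarrow> x + z - (y + w) \<in> span R"
    and span_cong_minus: "x - y \<in> span R \<Longrightarrow> z - w \<in> span R \<Longrightarrow> x - z - (y - w) \<in> span R"
    and span_cong_uminus: "x - y \<in> span R \<Longrightarrow> - x - (- y) \<in> span R"
    and span_cong_scaleR: "x - y \<in> span R \<Longrightarrow> c *\<^sub>R x - c *\<^sub>R y \<in> span R"
  using span_neg[of "x - y" R] span_add[of "x - y" R "y - z"] span_add[of "x - y" R "z - w"]
    span_diff[of "x - y" R "z - w"] span_scale[of "x - y" R c]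
  by (simp_all add: algebra_simps)

text \<open>\<open>'a tens\<close> is the tensor algebra \<open>\<Oplus>n. 'a\<^sup>\<otimes>\<^sup>n\<close>, with \<open>word [a1, \<dots>, an]\<close> standing for
  \<open>a1 \<otimes> \<dots> \<otimes> an\<close>.  In particular its span of two-letter words is \<open>'a \<otimes> 'a\<close>, and it is there
  that coproducts take their values.\<close>

definition tens_rels :: "('a::real_vector list \<Rightarrow>\<^sub>0 real) set" where
  "tens_rels =
     {gen (xs @ (a + b) # ys) - gen (xs @ a # ys) - gen (xs @ b # ys) | xs ys a b. True} \<union>
     {gen (xs @ (c *\<^sub>R a) # ys) - c *\<^sub>R gen (xs @ a # ys) | xs ys a c. True}"

definition tens_eq :: "('a::real_vector list \<Rightarrow>\<^sub>0 real) \<Rightarrow> ('a list \<Rightarrow>\<^sub>0 real) \<Rightarrow> bool" where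
  "tens_eq x y \<longleftrightarrow> x - y \<in> span tens_rels"

quotient_type (overloaded) 'a tens = "'a::real_vector list \<Rightarrow>\<^sub>0 real" / tens_eq
proof (rule equivpI)
  show "reflp (tens_eq :: ('a list \<Rightarrow>\<^sub>0 real) \<Rightarrow> _)"
    by (simp add: reflp_def tens_eq_def span_zero)
  show "symp (tens_eq :: ('a list \<Rightarrow>\<^sub>0 real) \<Rightarrow> _)"
    unfolding symp_def tens_eq_def by (blast intro: span_cong_sym)
  show "transp (tens_eq :: ('a list \<Rightarrow>\<^sub>0 real) \<Rightarrow> _)"
    unfolding transp_def tens_eq_def by (blast intro: span_cong_trans)
qed

instantiation tens :: (real_vector) real_vector
begin

lift_definition zero_tens :: "'a tens" is 0 .
lift_definition plus_tens :: "'a tens \<Rightarrow> 'a tens \<Rightarrow> 'a tens" is "(+)"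
  unfolding tens_eq_def by (rule span_cong_add)
lift_definition uminus_tens :: "'a tens \<Rightarrow> 'a tens" is uminus
  unfolding tens_eq_def by (rule span_cong_uminus)
lift_definition minus_tens :: "'a tens \<Rightarrow> 'a tens \<Rightarrow> 'a tens" is "(-)"
  unfolding tens_eq_def by (rule span_cong_minus)
lift_definition scaleR_tens :: "real \<Rightarrow> 'a tens \<Rightarrow> 'a tens" is "scaleR"
  unfolding tens_eq_def by (rule span_cong_scaleR)

instance
  by standard (transfer; simp add: tens_eq_def span_zero algebra_simps)+

end

lift_definition word :: "'a::real_vector list \<Rightarrow> 'a tens" is gen .

definition multilin :: "('a::real_vector list \<Rightarrow> 'c::real_vector) \<Rightarrow> bool" where
  "multilin \<phi> \<longleftrightarrow> (\<forall>xs ys. linear (\<lambda>a. \<phi> (xs @ a # ys)))"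

text \<open>For multilinear \<open>\<phi>\<close> this is the linear map with \<open>word xs \<mapsto> \<phi> xs\<close>, see \<open>tens_lin\<close> below.\<close>

definition tens_lin :: "('a::real_vector list \<Rightarrow> 'c::real_vector) \<Rightarrow> 'a tens \<Rightarrow> 'c" where
  "tens_lin \<phi> t = lin_ext \<phi> (rep_tens t)"

lemma linear_vanish_span:
  assumes "linear F" "\<And>r. r \<in> R \<Longrightarrow> F r = 0" "x \<in> span R"
  shows "F x = 0"
  using assms(3)
proof (induction rule: span_induct_alt)
  case base
  show ?case using assms(1) by (rule linear_0)
next
  case (step c x y)
  then show ?case using assms(1,2) by (simp add: linear_add linear_cmul)
qed

lemma tens_lin_abs:
  assumes "multilin \<phi>"
  shows "tens_lin \<phi> (abs_tens x) = lin_ext \<phi> x"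
proof -
  have "tens_eq (rep_tens (abs_tens x)) x"
    using Quotient3_rep_abs[OF Quotient3_tens] tens_equivp by (metis equivp_reflp)
  then have "rep_tens (abs_tens x) - x \<in> span tens_rels"
    by (simp add: tens_eq_def)
  moreover have "lin_ext \<phi> r = 0" if "r \<in> tens_rels" for r
  proof -
    have lin: "linear (\<lambda>a. \<phi> (xs @ a # ys))" for xs ys
      using assms by (simp add: multilin_def)
    show ?thesis
      using that linear_add[OF lin] linear_cmul[OF lin] unfolding tens_rels_def
      by (auto simp: linear_diff[OF linear_lin_ext] linear_cmul[OF linear_lin_ext])
  qed
  ultimately have "lin_ext \<phi> (rep_tens (abs_tens x) - x) = 0"
    using linear_vanish_span[OF linear_lin_ext] by blast
  then show ?thesis
    by (simp add: tens_lin_def linear_diff[OF linear_lin_ext])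
qed

lemma tens_lin:
  assumes "multilin \<phi>"
  shows linear_tens_lin: "linear (tens_lin \<phi>)"
    and tens_lin_word: "tens_lin \<phi> (word xs) = \<phi> xs"
proof -
  show "linear (tens_lin \<phi>)"
  proof (rule linearI)
    fix s t :: "'a tens" and c :: real
    obtain x y where xy: "s = abs_tens x" "t = abs_tens y"
      by (metis Quotient3_abs_rep[OF Quotient3_tens])
    show "tens_lin \<phi> (s + t) = tens_lin \<phi> s + tens_lin \<phi> t"
      using assms by (simp add: xy plus_tens.abs_eq tens_lin_abs linear_add[OF linear_lin_ext])
    show "tens_lin \<phi> (c *\<^sub>R s) = c *\<^sub>R tens_lin \<phi> s"
      using assms by (simp add: xy scaleR_tens.abs_eq tens_lin_abs linear_cmul[OF linear_lin_ext])
  qed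
  show "tens_lin \<phi> (word xs) = \<phi> xs"
    using assms by (simp add: word.abs_eq tens_lin_abs)
qed

lemma multilin_word: "multilin word"
  unfolding multilin_def
proof (intro allI linearI)
  fix xs ys :: "'a list" and a b :: 'a and c :: real
  show "word (xs @ (a + b) # ys) = word (xs @ a # ys) + word (xs @ b # ys)"
  proof (transfer, unfold tens_eq_def)
    fix xs ys :: "'a list" and a b :: 'a
    have "gen (xs @ (a + b) # ys) - gen (xs @ a # ys) - gen (xs @ b # ys) \<in> tens_rels"
      unfolding tens_rels_def by blast
    then show "gen (xs @ (a + b) # ys) - (gen (xs @ a # ys) + gen (xs @ b # ys)) \<in> span tens_rels"
      by (metis diff_diff_eq span_base)
  qed
  show "word (xs @ (c *\<^sub>R a) # ys) = c *\<^sub>R word (xs @ a # ys)"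
  proof (transfer, unfold tens_eq_def)
    fix xs ys :: "'a list" and a :: 'a and c
    show "gen (xs @ (c *\<^sub>R a) # ys) - c *\<^sub>R gen (xs @ a # ys) \<in> span tens_rels"
      by (rule span_base) (unfold tens_rels_def, blast)
  qed
qed

definition tens_conc :: "'a::real_vector tens \<Rightarrow> 'a tens \<Rightarrow> 'a tens" where
  "tens_conc s t = tens_lin (\<lambda>xs. tens_lin (\<lambda>ys. word (xs @ ys)) t) s"

definition tens_map :: "('a::real_vector \<Rightarrow> 'b::real_vector) \<Rightarrow> 'a tens \<Rightarrow> 'b tens" where
  "tens_map F = tens_lin (\<lambda>xs. word (map F xs))"

text \<open>\<open>otimes [F1, \<dots>, Fr]\<close> is \<open>F1 \<otimes> \<dots> \<otimes> Fr\<close> on \<open>'a\<^sup>\<otimes>\<^sup>r\<close>, with \<open>Fi : 'a \<rightarrow> \<Oplus>n. 'b\<^sup>\<otimes>\<^sup>n\<close>; it vanishes on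
  the other tensor powers.\<close>

definition otimes :: "('a::real_vector \<Rightarrow> 'b::real_vector tens) list \<Rightarrow> 'a tens \<Rightarrow> 'b tens" where
  "otimes Fs = tens_lin (\<lambda>xs. if length xs = length Fs
      then foldr tens_conc (map2 (\<lambda>F x. F x) Fs xs) (word []) else 0)"

abbreviation letter :: "'a::real_vector \<Rightarrow> 'a tens" where
  "letter a \<equiv> word [a]"

definition tens_proj :: "nat \<Rightarrow> 'a::real_vector tens \<Rightarrow> 'a tens" where
  "tens_proj n = tens_lin (\<lambda>xs. if length xs = n then word xs else 0)"

text \<open>The projection onto words of length one, these being identified with letters.\<close>

definition tens_pi :: "'a::real_vector tens \<Rightarrow> 'a" where
  "tens_pi = tens_lin (\<lambda>xs. if length xs = 1 then hd xs else 0)"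

definition tens_counit :: "'a::real_vector tens \<Rightarrow> real" where
  "tens_counit = tens_lin (\<lambda>xs. if xs = [] then 1 else 0)"

definition deconc :: "'a::real_vector tens \<Rightarrow> 'a tens tens" where
  "deconc = tens_lin (\<lambda>xs. \<Sum>i\<le>length xs. word [word (take i xs), word (drop i xs)])"

text \<open>All interleavings, listed with multiplicity.\<close>

fun shuffle_list :: "'a list \<Rightarrow> 'a list \<Rightarrow> 'a list list" where
  "shuffle_list [] ys = [ys]"
| "shuffle_list xs [] = [xs]"
| "shuffle_list (x # xs) (y # ys) =
     map ((#) x) (shuffle_list xs (y # ys)) @ map ((#) y) (shuffle_list (x # xs) ys)"

definition tens_shuffle :: "'a::real_vector tens \<Rightarrow> 'a tens \<Rightarrow> 'a tens" where
  "tens_shuffle s t =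
     tens_lin (\<lambda>xs. tens_lin (\<lambda>ys. sum_list (map word (shuffle_list xs ys))) t) s"

text \<open>The grading of the tensor algebra induced by a grading \<open>G\<close> of the space of letters.\<close>

definition tens_deg :: "(nat \<Rightarrow> 'a::real_vector set) \<Rightarrow> nat \<Rightarrow> 'a tens set" where
  "tens_deg G n = span {word xs | xs. \<exists>ds. list_all2 (\<lambda>x d. x \<in> G d) xs ds \<and> sum_list ds = n}"

section \<open>Graded Hopf algebras and commutative B-infinity algebras\<close>

record (overloaded) ('a::real_vector) hopf_data =
  hmul :: "'a \<Rightarrow> 'a \<Rightarrow> 'a"
  hone :: 'a
  hcop :: "'a \<Rightarrow> 'a tens"
  hcounit :: "'a \<Rightarrow> real"
  hdeg :: "nat \<Rightarrow> 'a set"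

text \<open>The vector space is the direct sum of the \<open>G n\<close>.\<close>

definition vec_grading :: "(nat \<Rightarrow> 'a::real_vector set) \<Rightarrow> bool" where
  "vec_grading G \<longleftrightarrow> (\<forall>n. subspace (G n)) \<and>
     (\<forall>x. \<exists>!c. (\<forall>n. c n \<in> G n) \<and> finite {n. c n \<noteq> 0} \<and> x = Sum_any c)"

definition tens_mult :: "('a::real_vector \<Rightarrow> 'a \<Rightarrow> 'a) \<Rightarrow> 'a \<Rightarrow> 'a tens \<Rightarrow> 'a" where
  "tens_mult m u = tens_lin (\<lambda>xs. foldr m xs u)"

text \<open>The product of the algebra \<open>'a \<otimes> 'a\<close> (and of the other tensor powers).\<close>

definition tens_componentwise ::
  "('a::real_vector \<Rightarrow> 'a \<Rightarrow> 'a) \<Rightarrow> 'a tens \<Rightarrow> 'a tens \<Rightarrow> 'a tens" where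
  "tens_componentwise m s t = tens_lin (\<lambda>xs. tens_lin (\<lambda>ys.
     if length xs = length ys then word (map2 m xs ys) else 0) t) s"

definition is_algebra :: "('a::real_vector) hopf_data \<Rightarrow> bool" where
  "is_algebra H \<longleftrightarrow>
     (\<forall>x. linear (hmul H x)) \<and> (\<forall>y. linear (\<lambda>x. hmul H x y)) \<and>
     (\<forall>x y z. hmul H (hmul H x y) z = hmul H x (hmul H y z)) \<and>
     (\<forall>x. hmul H (hone H) x = x \<and> hmul H x (hone H) = x)"

definition is_coalgebra :: "('a::real_vector) hopf_data \<Rightarrow> bool" where
  "is_coalgebra H \<longleftrightarrow>
     linear (hcop H) \<and> linear (hcounit H) \<and>
     (\<forall>x. hcop H x \<in> span {word [a, b] | a b. True}) \<and>
     (\<forall>x. otimes [hcop H, letter] (hcop H x) = otimes [letter, hcop H] (hcop H x)) \<and>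
     (\<forall>x. otimes [\<lambda>a. hcounit H a *\<^sub>R word [], letter] (hcop H x) = letter x) \<and>
     (\<forall>x. otimes [letter, \<lambda>a. hcounit H a *\<^sub>R word []] (hcop H x) = letter x)"

definition is_hopf :: "('a::real_vector) hopf_data \<Rightarrow> bool" where
  "is_hopf H \<longleftrightarrow> is_algebra H \<and> is_coalgebra H \<and>
     (\<forall>x y. hcop H (hmul H x y) = tens_componentwise (hmul H) (hcop H x) (hcop H y)) \<and>
     hcop H (hone H) = word [hone H, hone H] \<and>
     (\<forall>x y. hcounit H (hmul H x y) = hcounit H x * hcounit H y) \<and>
     hcounit H (hone H) = 1 \<and>
     (\<exists>S. linear S \<and> (\<forall>x.
        tens_mult (hmul H) (hone H) (otimes [\<lambda>a. letter (S a), letter] (hcop H x)) = hcounit H x *\<^sub>R hone H \<and>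
        tens_mult (hmul H) (hone H) (otimes [letter, \<lambda>a. letter (S a)] (hcop H x)) = hcounit H x *\<^sub>R hone H))"

definition is_graded_connected_hopf :: "('a::real_vector) hopf_data \<Rightarrow> bool" where
  "is_graded_connected_hopf H \<longleftrightarrow> is_hopf H \<and> vec_grading (hdeg H) \<and>
     (\<forall>i j. \<forall>x\<in>hdeg H i. \<forall>y\<in>hdeg H j. hmul H x y \<in> hdeg H (i + j)) \<and>
     (\<forall>n. \<forall>x\<in>hdeg H n. hcop H x \<in> tens_deg (hdeg H) n) \<and>
     (\<forall>n>0. \<forall>x\<in>hdeg H n. hcounit H x = 0) \<and>
     hdeg H 0 = span {hone H}"

text \<open>Cofreeness along \<open>\<pi>\<close>: as a graded coalgebra, \<open>H\<close> is the tensor coalgebra (with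
  deconcatenation) of the graded space \<open>'v\<close>, in such a way that \<open>\<pi>\<close> becomes the projection onto
  words of length one.\<close>

definition cofree_along :: "('a::real_vector) hopf_data \<Rightarrow> ('a \<Rightarrow> 'v::real_vector) \<Rightarrow> bool" where
  "cofree_along H \<pi> \<longleftrightarrow> linear \<pi> \<and> vec_grading (\<lambda>n. \<pi> ` hdeg H n) \<and>
     (\<exists>\<Psi> :: 'a \<Rightarrow> 'v tens. linear \<Psi> \<and> bij \<Psi> \<and>
        (\<forall>x. deconc (\<Psi> x) = tens_map \<Psi> (hcop H x)) \<and>
        (\<forall>x. tens_counit (\<Psi> x) = hcounit H x) \<and>
        (\<forall>n. \<forall>x\<in>hdeg H n. \<Psi> x \<in> tens_deg (\<lambda>n. \<pi> ` hdeg H n) n) \<and>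
        (\<forall>x. tens_pi (\<Psi> x) = \<pi> x))"

definition is_comm_Binf :: "('a::real_vector) hopf_data \<Rightarrow> ('a \<Rightarrow> 'v::real_vector) \<Rightarrow> bool" where
  "is_comm_Binf H \<pi> \<longleftrightarrow> is_graded_connected_hopf H \<and>
     (\<forall>x y. hmul H x y = hmul H y x) \<and> cofree_along H \<pi>"

definition hopf_hom ::
  "('a::real_vector) hopf_data \<Rightarrow> ('b::real_vector) hopf_data \<Rightarrow> ('a \<Rightarrow> 'b) \<Rightarrow> bool" where
  "hopf_hom H K F \<longleftrightarrow> linear F \<and>
     (\<forall>x y. F (hmul H x y) = hmul K (F x) (F y)) \<and> F (hone H) = hone K \<and>
     (\<forall>x. hcop K (F x) = tens_map F (hcop H x)) \<and> (\<forall>x. hcounit K (F x) = hcounit H x)"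

definition hopf_iso ::
  "('a::real_vector) hopf_data \<Rightarrow> ('b::real_vector) hopf_data \<Rightarrow> ('a \<Rightarrow> 'b) \<Rightarrow> bool" where
  "hopf_iso H K F \<longleftrightarrow> hopf_hom H K F \<and> bij F"

definition graded_hopf_hom ::
  "('a::real_vector) hopf_data \<Rightarrow> ('b::real_vector) hopf_data \<Rightarrow> ('a \<Rightarrow> 'b) \<Rightarrow> bool" where
  "graded_hopf_hom H K F \<longleftrightarrow> hopf_hom H K F \<and> (\<forall>n. F ` hdeg H n \<subseteq> hdeg K n)"

section \<open>Decorated forests\<close>

text \<open>A forest on a finite set of natural numbers: vertices, edges (parent, child), decorations.
  Decorations of numbers that are not vertices are irrelevant, see \<open>forest_iso\<close>.\<close>

definition is_forest :: "nat set \<times> (nat \<times> nat) set \<times> (nat \<Rightarrow> 'u) \<Rightarrow> bool" where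
  "is_forest = (\<lambda>(V, E, d). finite V \<and> E \<subseteq> V \<times> V \<and> acyclic E \<and>
     (\<forall>x y z. (x, z) \<in> E \<longrightarrow> (y, z) \<in> E \<longrightarrow> x = y))"

typedef 'u forest = "{f :: nat set \<times> (nat \<times> nat) set \<times> (nat \<Rightarrow> 'u). is_forest f}"
  by (rule exI[of _ "({}, {}, undefined)"]) (simp add: is_forest_def acyclic_def)

setup_lifting type_definition_forest

lift_definition verts :: "'u forest \<Rightarrow> nat set" is "\<lambda>(V, E, d). V" .
lift_definition edges :: "'u forest \<Rightarrow> (nat \<times> nat) set" is "\<lambda>(V, E, d). E" .
lift_definition dec :: "'u forest \<Rightarrow> nat \<Rightarrow> 'u" is "\<lambda>(V, E, d). d" .

lemma finite_verts [simp]: "finite (verts f)"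
  by transfer (auto simp: is_forest_def)

lemma edges_verts: "edges f \<subseteq> verts f \<times> verts f"
  by transfer (auto simp: is_forest_def)

lift_definition empty_forest :: "'u forest" is "({}, {}, undefined)"
  by (simp add: is_forest_def acyclic_def)

lift_definition dec_upd :: "'u forest \<Rightarrow> nat \<Rightarrow> 'u \<Rightarrow> 'u forest" is
  "\<lambda>(V, E, d) v a. (V, E, d(v := a))"
  by (auto simp: is_forest_def)

lift_definition map_dec :: "('u \<Rightarrow> 'v) \<Rightarrow> 'u forest \<Rightarrow> 'v forest" is
  "\<lambda>\<theta> (V, E, d). (V, E, \<theta> \<circ> d)"
  by (auto simp: is_forest_def)

lift_definition forest_restrict :: "'u forest \<Rightarrow> nat set \<Rightarrow> 'u forest" is
  "\<lambda>(V, E, d) A. (V \<inter> A, E \<inter> A \<times> A, d)"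
  by (auto simp: is_forest_def intro: acyclic_subset)

text \<open>The disjoint union of the first forest (on even numbers) and the second one (on odd numbers),
  with all roots of the first one grafted onto the vertices in \<open>W\<close> of the second one.\<close>

definition graft_data ::
  "nat set \<times> (nat \<times> nat) set \<times> (nat \<Rightarrow> 'u) \<Rightarrow> nat set \<times> (nat \<times> nat) set \<times> (nat \<Rightarrow> 'u) \<Rightarrow> nat set
    \<Rightarrow> nat set \<times> (nat \<times> nat) set \<times> (nat \<Rightarrow> 'u)" where
  "graft_data = (\<lambda>(V, E, d) (V', E', d') W.
     ((\<lambda>n. 2 * n) ` V \<union> (\<lambda>n. 2 * n + 1) ` V',
      (\<lambda>(x, y). (2 * x, 2 * y)) ` E \<union> (\<lambda>(x, y). (2 * x + 1, 2 * y + 1)) ` E' \<union>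
        {(2 * w + 1, 2 * r) | w r. w \<in> W \<and> w \<in> V' \<and> r \<in> V \<and> (\<forall>p. (p, r) \<notin> E)},
      \<lambda>n. if even n then d (n div 2) else d' (n div 2)))"

lemma acyclic_disjoint_levels:
  assumes "acyclic A" "acyclic B" "finite A" "finite B"
  shows "acyclic ((\<lambda>(x, y). (2 * x, 2 * y)) ` A \<union> (\<lambda>(x, y). (2 * x + 1, 2 * y + 1)) ` B
          \<union> {(2 * w + 1, 2 * r) | w r :: nat. P w r})" (is "acyclic ?E")
proof -
  have wfA: "wf (A\<inverse>)" and wfB: "wf (B\<inverse>)"
    using assms by (simp_all add: finite_acyclic_wf_converse)
  have ind: "wf (?E\<inverse>)"
  proof (rule wfUNIVI)
    fix Q :: "nat \<Rightarrow> bool" and x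
    assume step: "\<forall>x. (\<forall>y. (y, x) \<in> ?E\<inverse> \<longrightarrow> Q y) \<longrightarrow> Q x"
    have ev: "Q (2 * n)" for n
      using wfA
    proof (induction n rule: wf_induct_rule)
      case (less n)
      show ?case
      proof (rule step[rule_format])
        fix y assume "(y, 2 * n) \<in> ?E\<inverse>"
        then have "(2 * n, y) \<in> ?E" by simp
        then obtain m where "y = 2 * m" "(n, m) \<in> A"
          by (auto simp: double_not_eq_Suc_double Suc_double_not_eq_double)
        then show "Q y" using less by simp
      qed
    qed
    have od: "Q (2 * n + 1)" for n
      using wfB
    proof (induction n rule: wf_induct_rule)
      case (less n)
      show ?case
      proof (rule step[rule_format])
        fix y assume "(y, 2 * n + 1) \<in> ?E\<inverse>"
        then have "(2 * n + 1, y) \<in> ?E" by simp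
        then have "(\<exists>m. y = 2 * m + 1 \<and> (n, m) \<in> B) \<or> (\<exists>m. y = 2 * m)"
          by (auto simp: double_not_eq_Suc_double Suc_double_not_eq_double)
        then show "Q y" using less ev by auto
      qed
    qed
    show "Q x"
      using ev[of "x div 2"] od[of "x div 2"] by (cases "even x") auto
  qed
  then show ?thesis
    using wf_acyclic acyclic_converse by blast
qed

lemma is_forest_graft_data:
  assumes "is_forest f" "is_forest g" "\<And>x y. x \<in> W \<Longrightarrow> y \<in> W \<Longrightarrow> x = y"
  shows "is_forest (graft_data f g W)"
proof -
  obtain V E d where f: "f = (V, E, d)" by (cases f) auto
  obtain V' E' d' where g: "g = (V', E', d')" by (cases g) auto
  have fin: "finite V" "finite V'" and sub: "E \<subseteq> V \<times> V" "E' \<subseteq> V' \<times> V'"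
    and ac: "acyclic E" "acyclic E'"
    and un: "\<And>x y z. (x, z) \<in> E \<Longrightarrow> (y, z) \<in> E \<Longrightarrow> x = y"
      "\<And>x y z. (x, z) \<in> E' \<Longrightarrow> (y, z) \<in> E' \<Longrightarrow> x = y"
    using assms(1,2) by (auto simp: is_forest_def f g)
  have finE: "finite E" "finite E'"
    using fin sub by (meson finite_SigmaI finite_subset)+
  let ?E = "(\<lambda>(x, y). (2 * x, 2 * y)) ` E \<union> (\<lambda>(x, y). (2 * x + 1, 2 * y + 1)) ` E' \<union>
        {(2 * w + 1, 2 * r) | w r. w \<in> W \<and> w \<in> V' \<and> r \<in> V \<and> (\<forall>p. (p, r) \<notin> E)}"
  have a: "acyclic ?E"
    by (rule acyclic_disjoint_levels[OF ac finE])
  have s: "?E \<subseteq> ((\<lambda>n. 2 * n) ` V \<union> (\<lambda>n. 2 * n + 1) ` V') \<times> ((\<lambda>n. 2 * n) ` V \<union> (\<lambda>n. 2 * n + 1) ` V')"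
    using sub by auto
  have u: "x = y" if "(x, z) \<in> ?E" "(y, z) \<in> ?E" for x y z
    using that un assms(3) by (auto simp: double_not_eq_Suc_double Suc_double_not_eq_double)
  show ?thesis
    unfolding is_forest_def graft_data_def f g prod.case
    using fin a s u by blast
qed

lift_definition disj_union :: "'u forest \<Rightarrow> 'u forest \<Rightarrow> 'u forest" is
  "\<lambda>f g. graft_data f g {}"
  by (rule is_forest_graft_data) auto

text \<open>\<open>graft f g v\<close> grafts all roots of \<open>f\<close> onto the vertex \<open>v\<close> of \<open>g\<close>.\<close>

lift_definition graft :: "'u forest \<Rightarrow> 'u forest \<Rightarrow> nat \<Rightarrow> 'u forest" is
  "\<lambda>f g v. graft_data f g {v}"
  by (rule is_forest_graft_data) auto

definition forest_iso :: "'u forest \<Rightarrow> 'u forest \<Rightarrow> bool" where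
  "forest_iso f g \<longleftrightarrow> (\<exists>\<sigma>. bij_betw \<sigma> (verts f) (verts g) \<and>
     (\<forall>x\<in>verts f. \<forall>y\<in>verts f. (x, y) \<in> edges f \<longleftrightarrow> (\<sigma> x, \<sigma> y) \<in> edges g) \<and>
     (\<forall>x\<in>verts f. dec g (\<sigma> x) = dec f x))"

definition cuts :: "'u forest \<Rightarrow> nat set set" where
  "cuts f = {A. A \<subseteq> verts f \<and> (\<forall>x y. x \<in> A \<longrightarrow> (x, y) \<in> edges f \<longrightarrow> y \<in> A)}"

section \<open>The Connes-Kreimer Hopf algebra\<close>

text \<open>The free vector space on decorated forests, modulo isomorphism (so that forests are
  non-planar and unlabelled) and modulo multilinearity in the decorations.\<close>

definition ck_rels :: "('u::real_vector forest \<Rightarrow>\<^sub>0 real) set" where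
  "ck_rels =
     {gen f - gen g | f g. forest_iso f g} \<union>
     {gen (dec_upd f v (a + b)) - gen (dec_upd f v a) - gen (dec_upd f v b) | f v a b. v \<in> verts f} \<union>
     {gen (dec_upd f v (c *\<^sub>R a)) - c *\<^sub>R gen (dec_upd f v a) | f v a c. v \<in> verts f}"

definition ck_eq :: "('u::real_vector forest \<Rightarrow>\<^sub>0 real) \<Rightarrow> ('u forest \<Rightarrow>\<^sub>0 real) \<Rightarrow> bool" where
  "ck_eq x y \<longleftrightarrow> x - y \<in> span ck_rels"

quotient_type (overloaded) 'u ck = "'u::real_vector forest \<Rightarrow>\<^sub>0 real" / ck_eq
proof (rule equivpI)
  show "reflp (ck_eq :: ('u forest \<Rightarrow>\<^sub>0 real) \<Rightarrow> _)"
    by (simp add: reflp_def ck_eq_def span_zero)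
  show "symp (ck_eq :: ('u forest \<Rightarrow>\<^sub>0 real) \<Rightarrow> _)"
    unfolding symp_def ck_eq_def by (blast intro: span_cong_sym)
  show "transp (ck_eq :: ('u forest \<Rightarrow>\<^sub>0 real) \<Rightarrow> _)"
    unfolding transp_def ck_eq_def by (blast intro: span_cong_trans)
qed

instantiation ck :: (real_vector) real_vector
begin

lift_definition zero_ck :: "'a ck" is 0 .
lift_definition plus_ck :: "'a ck \<Rightarrow> 'a ck \<Rightarrow> 'a ck" is "(+)"
  unfolding ck_eq_def by (rule span_cong_add)
lift_definition uminus_ck :: "'a ck \<Rightarrow> 'a ck" is uminus
  unfolding ck_eq_def by (rule span_cong_uminus)
lift_definition minus_ck :: "'a ck \<Rightarrow> 'a ck \<Rightarrow> 'a ck" is "(-)"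
  unfolding ck_eq_def by (rule span_cong_minus)
lift_definition scaleR_ck :: "real \<Rightarrow> 'a ck \<Rightarrow> 'a ck" is "scaleR"
  unfolding ck_eq_def by (rule span_cong_scaleR)

instance
  by standard (transfer; simp add: ck_eq_def span_zero algebra_simps)+

end

definition ck :: "'u::real_vector forest \<Rightarrow> 'u ck" where
  "ck f = abs_ck (gen f)"

definition ck_compat :: "('u::real_vector forest \<Rightarrow> 'c::real_vector) \<Rightarrow> bool" where
  "ck_compat \<phi> \<longleftrightarrow> (\<forall>f g. forest_iso f g \<longrightarrow> \<phi> f = \<phi> g) \<and>
     (\<forall>f. \<forall>v\<in>verts f. linear (\<lambda>a. \<phi> (dec_upd f v a)))"

text \<open>For compatible \<open>\<phi>\<close> this is the linear map with \<open>ck f \<mapsto> \<phi> f\<close>, see \<open>ck_lin\<close> below.\<close>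

definition ck_lin :: "('u::real_vector forest \<Rightarrow> 'c::real_vector) \<Rightarrow> 'u ck \<Rightarrow> 'c" where
  "ck_lin \<phi> h = lin_ext \<phi> (rep_ck h)"

lemma ck_lin_abs:
  assumes "ck_compat \<phi>"
  shows "ck_lin \<phi> (abs_ck x) = lin_ext \<phi> x"
proof -
  have "ck_eq (rep_ck (abs_ck x)) x"
    using Quotient3_rep_abs[OF Quotient3_ck] ck_equivp by (metis equivp_reflp)
  then have "rep_ck (abs_ck x) - x \<in> span ck_rels"
    by (simp add: ck_eq_def)
  moreover have "lin_ext \<phi> r = 0" if "r \<in> ck_rels" for r
  proof -
    have lin: "linear (\<lambda>a. \<phi> (dec_upd f v a))" if "v \<in> verts f" for f v
      using assms that by (simp add: ck_compat_def)
    show ?thesis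
      using that assms linear_add[OF lin] linear_cmul[OF lin] unfolding ck_rels_def ck_compat_def
      by (auto simp: linear_diff[OF linear_lin_ext] linear_cmul[OF linear_lin_ext])
  qed
  ultimately have "lin_ext \<phi> (rep_ck (abs_ck x) - x) = 0"
    using linear_vanish_span[OF linear_lin_ext] by blast
  then show ?thesis
    by (simp add: ck_lin_def linear_diff[OF linear_lin_ext])
qed

lemma ck_lin:
  assumes "ck_compat \<phi>"
  shows linear_ck_lin: "linear (ck_lin \<phi>)"
    and ck_lin_ck: "ck_lin \<phi> (ck f) = \<phi> f"
proof -
  show "linear (ck_lin \<phi>)"
  proof (rule linearI)
    fix s t :: "'a ck" and c :: real
    obtain x y where xy: "s = abs_ck x" "t = abs_ck y"
      by (metis Quotient3_abs_rep[OF Quotient3_ck])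
    show "ck_lin \<phi> (s + t) = ck_lin \<phi> s + ck_lin \<phi> t"
      using assms by (simp add: xy plus_ck.abs_eq ck_lin_abs linear_add[OF linear_lin_ext])
    show "ck_lin \<phi> (c *\<^sub>R s) = c *\<^sub>R ck_lin \<phi> s"
      using assms by (simp add: xy scaleR_ck.abs_eq ck_lin_abs linear_cmul[OF linear_lin_ext])
  qed
  show "ck_lin \<phi> (ck f) = \<phi> f"
    using assms by (simp add: ck_def ck_lin_abs)
qed

lemma ck_iso: "forest_iso f g \<Longrightarrow> ck f = ck g"
  unfolding ck_def ck.abs_eq_iff ck_eq_def
  by (rule span_base) (auto simp: ck_rels_def)

lemma linear_ck_dec:
  assumes "v \<in> verts f"
  shows "linear (\<lambda>a. ck (dec_upd f v a))"
proof (rule linearI)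
  fix a b c
  have "gen (dec_upd f v (a + b)) - gen (dec_upd f v a) - gen (dec_upd f v b) \<in> ck_rels"
    unfolding ck_rels_def using assms by blast
  then show "ck (dec_upd f v (a + b)) = ck (dec_upd f v a) + ck (dec_upd f v b)"
    unfolding ck_def plus_ck.abs_eq ck.abs_eq_iff ck_eq_def by (metis diff_diff_eq span_base)
  have "gen (dec_upd f v (c *\<^sub>R a)) - c *\<^sub>R gen (dec_upd f v a) \<in> ck_rels"
    unfolding ck_rels_def using assms by blast
  then show "ck (dec_upd f v (c *\<^sub>R a)) = c *\<^sub>R ck (dec_upd f v a)"
    unfolding ck_def scaleR_ck.abs_eq ck.abs_eq_iff ck_eq_def by (rule span_base)
qed

definition ck_one :: "'u::real_vector ck" where
  "ck_one = ck empty_forest"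

definition ck_mult :: "'u::real_vector ck \<Rightarrow> 'u ck \<Rightarrow> 'u ck" where
  "ck_mult h k = ck_lin (\<lambda>f. ck_lin (\<lambda>g. ck (disj_union f g)) k) h"

definition ck_counit :: "'u::real_vector ck \<Rightarrow> real" where
  "ck_counit = ck_lin (\<lambda>f. if verts f = {} then 1 else 0)"

definition forest_cop :: "'u::real_vector forest \<Rightarrow> 'u ck tens" where
  "forest_cop f = (\<Sum>A\<in>cuts f. word [ck (forest_restrict f A), ck (forest_restrict f (verts f - A))])"

definition ck_cop :: "'u::real_vector ck \<Rightarrow> 'u ck tens" where
  "ck_cop = ck_lin forest_cop"

definition ck_deg :: "nat \<Rightarrow> 'u::real_vector ck set" where
  "ck_deg n = span {ck f | f. card (verts f) = n}"

definition ck_plus :: "'u::real_vector ck set" where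
  "ck_plus = span {ck f | f. verts f \<noteq> {}}"

definition ck_hopf :: "('u::real_vector ck) hopf_data" where
  "ck_hopf = \<lparr>hmul = ck_mult, hone = ck_one, hcop = ck_cop, hcounit = ck_counit, hdeg = ck_deg\<rparr>"

definition ck_map :: "('u::real_vector \<Rightarrow> 'v::real_vector) \<Rightarrow> 'u ck \<Rightarrow> 'v ck" where
  "ck_map \<theta> = ck_lin (\<lambda>f. ck (map_dec \<theta> f))"

text \<open>The reduced coproduct, extended from \<open>ck_plus\<close> to the whole space by \<open>0\<close> on \<open>ck_one\<close>.\<close>

definition ck_red :: "'u::real_vector ck \<Rightarrow> 'u ck" where
  "ck_red h = h - ck_counit h *\<^sub>R ck_one"

definition ck_red_cop :: "'u::real_vector ck \<Rightarrow> 'u ck tens" where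
  "ck_red_cop h =
     ck_cop (ck_red h) - word [ck_one, ck_red h] - word [ck_red h, ck_one]"

text \<open>\<open>ck_red_cop_iter n\<close> takes values in the \<open>n\<close>-th tensor power: it is the \<open>(n - 1)\<close>-fold iterate of
  the reduced coproduct, and for \<open>n = 0\<close> it is the counit.\<close>

fun ck_red_cop_iter :: "nat \<Rightarrow> 'u::real_vector ck \<Rightarrow> 'u ck tens" where
  "ck_red_cop_iter 0 h = ck_counit h *\<^sub>R word []"
| "ck_red_cop_iter (Suc 0) h = word [ck_red h]"
| "ck_red_cop_iter (Suc (Suc n)) h =
     otimes (ck_red_cop # replicate n letter) (ck_red_cop_iter (Suc n) h)"

subsection \<open>Well-definedness of the coproduct\<close>

lemma forest_sel_simps [simp]:
  "verts (forest_restrict f A) = verts f \<inter> A"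
  "edges (forest_restrict f A) = edges f \<inter> A \<times> A"
  "dec (forest_restrict f A) = dec f"
  "verts (dec_upd f v a) = verts f"
  "edges (dec_upd f v a) = edges f"
  "dec (dec_upd f v a) = (dec f)(v := a)"
  by (transfer; auto)+

lemma forest_eqI: "verts f = verts g \<Longrightarrow> edges f = edges g \<Longrightarrow> dec f = dec g \<Longrightarrow> f = g"
  by transfer auto

lemma forest_iso_restrict:
  assumes "bij_betw \<sigma> (verts f) (verts g)"
    and "\<forall>x\<in>verts f. \<forall>y\<in>verts f. (x, y) \<in> edges f \<longleftrightarrow> (\<sigma> x, \<sigma> y) \<in> edges g"
    and "\<forall>x\<in>verts f. dec g (\<sigma> x) = dec f x"
    and A: "A \<subseteq> verts f"
  shows "forest_iso (forest_restrict f A) (forest_restrict g (\<sigma> ` A))"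
proof -
  have sub: "verts f \<inter> A = A" "verts g \<inter> \<sigma> ` A = \<sigma> ` A"
    using assms(1) A by (auto simp: bij_betw_def)
  have "bij_betw \<sigma> A (\<sigma> ` A)"
    using assms(1) A by (auto simp: bij_betw_def inj_on_subset)
  then show ?thesis
    unfolding forest_iso_def using assms(2,3) A
    by (intro exI[of _ \<sigma>]) (auto simp: sub)
qed

lemma cuts_image:
  assumes bij: "bij_betw \<sigma> (verts f) (verts g)"
    and e: "\<forall>x\<in>verts f. \<forall>y\<in>verts f. (x, y) \<in> edges f \<longleftrightarrow> (\<sigma> x, \<sigma> y) \<in> edges g"
  shows "bij_betw ((`) \<sigma>) (cuts f) (cuts g)"
proof -
  have inj: "inj_on \<sigma> (verts f)" and im: "\<sigma> ` verts f = verts g"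
    using bij unfolding bij_betw_def by blast+
  have "inj_on ((`) \<sigma>) (cuts f)"
    by (rule inj_on_subset[OF inj_on_image_Pow[OF inj]]) (unfold cuts_def, blast)
  moreover have "(`) \<sigma> ` cuts f = cuts g"
  proof (intro equalityI subsetI)
    fix B assume "B \<in> (`) \<sigma> ` cuts f"
    then obtain A where A: "A \<in> cuts f" "B = \<sigma> ` A" by blast
    then have AV: "A \<subseteq> verts f" unfolding cuts_def by blast
    have cl: "y \<in> \<sigma> ` A" if xy: "x \<in> A" "(\<sigma> x, y) \<in> edges g" for x y
    proof -
      have "y \<in> verts g" using edges_verts[of g] xy(2) by blast
      then obtain z where z: "z \<in> verts f" "y = \<sigma> z" using im by blast
      then have "(x, z) \<in> edges f" using e xy AV by blast
      then have "z \<in> A" using A(1) xy(1) unfolding cuts_def by blast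
      then show ?thesis unfolding z(2) by (rule imageI)
    qed
    have "\<sigma> ` A \<subseteq> verts g" using AV im by blast
    then show "B \<in> cuts g" unfolding A(2) cuts_def using cl by auto
  next
    fix B assume B: "B \<in> cuts g"
    then have Bsub: "B \<subseteq> verts g" by (simp only: cuts_def mem_Collect_eq)
    have Bcl: "\<forall>x y. x \<in> B \<longrightarrow> (x, y) \<in> edges g \<longrightarrow> y \<in> B"
      using B unfolding cuts_def mem_Collect_eq by (rule conjunct2)
    let ?A = "{x \<in> verts f. \<sigma> x \<in> B}"
    have 1: "\<sigma> ` ?A = B"
    proof (intro equalityI subsetI)
      fix y assume y: "y \<in> B"
      then have "y \<in> \<sigma> ` verts f" using Bsub im by (metis subsetD)
      then show "y \<in> \<sigma> ` ?A" using y by (auto simp: image_iff)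
    qed auto
    have "y \<in> ?A" if "x \<in> ?A" "(x, y) \<in> edges f" for x y
    proof -
      have y: "y \<in> verts f" using edges_verts[of f] that(2) by blast
      then have "(\<sigma> x, \<sigma> y) \<in> edges g" using that e by blast
      then show ?thesis using y that(1) Bcl by blast
    qed
    then have "?A \<in> cuts f" unfolding cuts_def by blast
    then have "\<sigma> ` ?A \<in> (`) \<sigma> ` cuts f" by (rule imageI)
    then show "B \<in> (`) \<sigma> ` cuts f" unfolding 1 .
  qed
  ultimately show ?thesis unfolding bij_betw_def by blast
qed

lemma multilin_slot:
  "linear (\<lambda>a. word [a, y])" "linear (\<lambda>a. word [x, a])"
  using multilin_word[unfolded multilin_def, rule_format, of "[]" "[y]"]
    multilin_word[unfolded multilin_def, rule_format, of "[x]" "[]"] by simp_all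

lemma ck_compat_cop: "ck_compat forest_cop"
  unfolding ck_compat_def
proof (intro conjI allI impI ballI)
  fix f g :: "'a forest"
  assume "forest_iso f g"
  then obtain \<sigma> where bij: "bij_betw \<sigma> (verts f) (verts g)"
    and e: "\<forall>x\<in>verts f. \<forall>y\<in>verts f. (x, y) \<in> edges f \<longleftrightarrow> (\<sigma> x, \<sigma> y) \<in> edges g"
    and d: "\<forall>x\<in>verts f. dec g (\<sigma> x) = dec f x"
    by (auto simp: forest_iso_def)
  have "word [ck (forest_restrict f A), ck (forest_restrict f (verts f - A))] =
      word [ck (forest_restrict g (\<sigma> ` A)), ck (forest_restrict g (verts g - \<sigma> ` A))]" if "A \<in> cuts f" for A
  proof -
    have A: "A \<subseteq> verts f" using that by (auto simp: cuts_def)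
    have "\<sigma> ` (verts f - A) = verts g - \<sigma> ` A"
      using bij A by (simp add: bij_betw_def inj_on_image_set_diff[of \<sigma> "verts f"])
    then show ?thesis
      using ck_iso[OF forest_iso_restrict[OF bij e d A]]
        ck_iso[OF forest_iso_restrict[OF bij e d, of "verts f - A"]] by auto
  qed
  then show "forest_cop f = forest_cop g"
    unfolding forest_cop_def by (subst sum.reindex_bij_betw[OF cuts_image[OF bij e], symmetric]) simp
next
  fix f :: "'a forest" and v
  assume v: "v \<in> verts f"
  have same: "ck (forest_restrict (dec_upd f v a) A) = ck (forest_restrict f A)" if "v \<notin> A" for a A
    by (rule ck_iso) (use that in \<open>auto simp: forest_iso_def intro!: exI[of _ id]\<close>)
  have diff: "forest_restrict (dec_upd f v a) A = dec_upd (forest_restrict f A) v a" for a A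
    by (rule forest_eqI) auto
  have "linear (\<lambda>a. word [ck (forest_restrict (dec_upd f v a) A), ck (forest_restrict (dec_upd f v a) (verts f - A))])"
    for A
  proof (cases "v \<in> A")
    case True
    then have "linear (\<lambda>a. ck (forest_restrict (dec_upd f v a) A))"
      unfolding diff using v by (intro linear_ck_dec) simp
    from linear_compose[OF this multilin_slot(1)[of "ck (forest_restrict f (verts f - A))"]]
    show ?thesis using True same by (simp add: o_def)
  next
    case False
    then have "linear (\<lambda>a. ck (forest_restrict (dec_upd f v a) (verts f - A)))"
      unfolding diff using v by (intro linear_ck_dec) simp
    from linear_compose[OF this multilin_slot(2)[of "ck (forest_restrict f A)"]]
    show ?thesis using False same by (simp add: o_def)
  qed
  moreover have "cuts (dec_upd f v a) = cuts f" for a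
    by (simp add: cuts_def)
  ultimately show "linear (\<lambda>a. forest_cop (dec_upd f v a))"
    unfolding forest_cop_def by (auto intro!: linear_compose_sum)
qed

lemma ck_compat_counit: "ck_compat (\<lambda>f. if verts f = {} then 1 else 0 :: real)"
  unfolding ck_compat_def
  by (auto simp: forest_iso_def bij_betw_def linear_zero)

lemma linear_ck_red_cop: "linear ck_red_cop"
proof -
  have c: "linear ck_counit" "linear ck_cop"
    unfolding ck_counit_def ck_cop_def
    by (intro linear_ck_lin ck_compat_counit ck_compat_cop)+
  have "linear (\<lambda>h. ck_counit h *\<^sub>R ck_one)"
    by (rule linearI) (simp_all only: linear_add[OF c(1)] linear_cmul[OF c(1)] scaleR_add_left
        scaleR_scaleR real_scaleR_def)
  then have r: "linear ck_red"
    unfolding ck_red_def by (intro linear_compose_sub linear_ident)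
  have "linear (\<lambda>h. ck_cop (ck_red h))" "linear (\<lambda>h. word [ck_one, ck_red h])"
    "linear (\<lambda>h. word [ck_red h, ck_one])"
    using linear_compose[OF r c(2)] linear_compose[OF r multilin_slot(2)[of ck_one]]
      linear_compose[OF r multilin_slot(1)[of ck_one]] by (simp_all add: o_def)
  then show ?thesis
    unfolding ck_red_cop_def by (intro linear_compose_sub)
qed

section \<open>Primitives\<close>

definition ck_prim :: "'u::real_vector ck set" where
  "ck_prim = {h \<in> ck_plus. ck_red_cop h = 0}"

lemma subspace_ck_prim: "subspace ck_prim"
  unfolding subspace_def ck_prim_def ck_plus_def
  by (auto simp: linear_0[OF linear_ck_red_cop] linear_add[OF linear_ck_red_cop]
      linear_cmul[OF linear_ck_red_cop] span_zero span_add span_scale)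

typedef (overloaded) 'u prim = "ck_prim :: 'u::real_vector ck set"
  using subspace_0[OF subspace_ck_prim] by blast

setup_lifting type_definition_prim

instantiation prim :: (real_vector) real_vector
begin

lift_definition zero_prim :: "'a prim" is 0
  by (rule subspace_0[OF subspace_ck_prim])
lift_definition plus_prim :: "'a prim \<Rightarrow> 'a prim \<Rightarrow> 'a prim" is "(+)"
  by (rule subspace_add[OF subspace_ck_prim])
lift_definition uminus_prim :: "'a prim \<Rightarrow> 'a prim" is uminus
  by (rule subspace_neg[OF subspace_ck_prim])
lift_definition minus_prim :: "'a prim \<Rightarrow> 'a prim \<Rightarrow> 'a prim" is "(-)"
  by (rule subspace_diff[OF subspace_ck_prim])
lift_definition scaleR_prim :: "real \<Rightarrow> 'a prim \<Rightarrow> 'a prim" is "scaleR"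
  by (rule subspace_scale[OF subspace_ck_prim])

instance
  by standard (transfer; simp add: algebra_simps)+

end

definition prim_deg :: "nat \<Rightarrow> 'u::real_vector prim set" where
  "prim_deg n = {p. Rep_prim p \<in> ck_deg n}"

definition prim_map :: "('u::real_vector \<Rightarrow> 'v::real_vector) \<Rightarrow> 'u prim \<Rightarrow> 'v prim" where
  "prim_map \<theta> p = Abs_prim (ck_map \<theta> (Rep_prim p))"

definition sh_hopf :: "('u::real_vector prim tens) hopf_data" where
  "sh_hopf = \<lparr>hmul = tens_shuffle, hone = word [], hcop = deconc, hcounit = tens_counit,
     hdeg = tens_deg prim_deg\<rparr>"

definition sh_plus :: "'u::real_vector prim tens set" where
  "sh_plus = span {word ps | ps. ps \<noteq> []}"

definition sh_map :: "('u::real_vector \<Rightarrow> 'v::real_vector) \<Rightarrow> 'u prim tens \<Rightarrow> 'v prim tens" where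
  "sh_map \<theta> = tens_map (prim_map \<theta>)"

section \<open>Natural growth\<close>

definition ck_top :: "'u::real_vector ck \<Rightarrow> 'u ck \<Rightarrow> 'u ck" where
  "ck_top h k = ck_lin (\<lambda>f. ck_lin (\<lambda>g. if verts g = {} then ck f
      else (1 / real (card (verts g))) *\<^sub>R (\<Sum>v\<in>verts g. ck (graft f g v))) k) h"

text \<open>Foissy's isomorphism \<open>p1 \<otimes> \<dots> \<otimes> pn \<mapsto> (\<dots> (p1 \<top> p2) \<top> \<dots>) \<top> pn\<close>.\<close>

definition growth :: "'u::real_vector prim tens \<Rightarrow> 'u ck" where
  "growth = tens_lin (\<lambda>ps. foldl ck_top ck_one (map Rep_prim ps))"

definition ck_pi :: "'u::real_vector ck \<Rightarrow> 'u prim" where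
  "ck_pi h = tens_pi (inv growth h)"

section \<open>Eulerian idempotent, logarithm and exponential\<close>

text \<open>Here and below, \<^const>\<open>Sum_any\<close> sums families that are pointwise of finite support.\<close>

definition eulerian :: "'u::real_vector ck \<Rightarrow> 'u ck" where
  "eulerian h = Sum_any (\<lambda>n. if n = 0 then 0
      else ((-1) ^ (n - 1) / real n) *\<^sub>R tens_mult ck_mult ck_one (ck_red_cop_iter n h))"

definition ck_Log :: "'u::real_vector ck \<Rightarrow> 'u prim tens" where
  "ck_Log = (THE L. hopf_iso ck_hopf sh_hopf L \<and> (\<forall>h. tens_pi (L h) = ck_pi (eulerian h)))"

definition ck_Exp :: "'u::real_vector prim tens \<Rightarrow> 'u ck" where
  "ck_Exp = inv ck_Log"

text \<open>The components of the logarithm and exponential, as maps of the tensor algebra of primitives,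
  with which the Connes-Kreimer algebra is identified through \<^const>\<open>growth\<close>.\<close>

definition Log_comp :: "nat \<Rightarrow> nat \<Rightarrow> 'u::real_vector prim tens \<Rightarrow> 'u prim tens" where
  "Log_comp m n t = tens_proj m (ck_Log (growth (tens_proj n t)))"

definition Exp_comp :: "nat \<Rightarrow> nat \<Rightarrow> 'u::real_vector prim tens \<Rightarrow> 'u prim tens" where
  "Exp_comp m n t = tens_proj m (inv growth (ck_Exp (tens_proj n t)))"

fun blocks :: "nat list \<Rightarrow> 'a list \<Rightarrow> 'a list list" where
  "blocks [] xs = []"
| "blocks (m # ms) xs = take m xs # blocks ms (drop m xs)"

text \<open>\<open>block_op [m1, \<dots>, mr]\<close> is \<open>(\<pi> \<circ> e \<circ> \<pi>_m1) \<otimes> \<dots> \<otimes> (\<pi> \<circ> e \<circ> \<pi>_mr)\<close>.\<close>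

definition block_op :: "nat list \<Rightarrow> 'u::real_vector prim tens \<Rightarrow> 'u prim tens" where
  "block_op ms = tens_lin (\<lambda>ps. if length ps = sum_list ms
      then word (map (\<lambda>b. ck_pi (eulerian (growth (word b)))) (blocks ms ps)) else 0)"

text \<open>Pairs \<open>([n^0, \<dots>, n^k], [m^1, \<dots>, m^k])\<close>, where each \<open>m^i\<close> is itself a list.\<close>

definition exp_index :: "(nat list \<times> nat list list) set" where
  "exp_index = {(ns, mss). length ns = length mss + 1 \<and> 1 \<le> hd ns \<and> sorted_wrt (<) ns \<and>
     (\<forall>i<length mss. length (mss ! i) = ns ! i \<and> (\<forall>m\<in>set (mss ! i). 1 \<le> m) \<and>
        sum_list (mss ! i) = ns ! Suc i)}"

text \<open>The projection onto words of length \<open>n^k\<close> makes no difference for \<open>k > 0\<close>, as the innermost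
  factor already vanishes on words of other lengths; the terms with \<open>k = 0\<close> are just these
  projections, for \<open>n^0 \<ge> 1\<close>, and add up to the identity.\<close>

definition exp_term :: "nat list \<times> nat list list \<Rightarrow> 'u::real_vector prim tens \<Rightarrow> 'u prim tens" where
  "exp_term = (\<lambda>(ns, mss) t.
     (-1) ^ length mss *\<^sub>R foldr block_op mss (tens_proj (last ns) t))"

end

theory Submission
  imports Defs "HOL-Analysis.Linear_Algebra" "HOL-Computational_Algebra.Polynomial"
begin

text \<open>The whole proof rests on one property of the Connes-Kreimer coalgebra: a linear map \<open>\<phi> : H \<rightarrow> V\<close>
  with \<open>\<phi>(1) = 0\<close> is the one-letter part of exactly one map of coalgebras \<open>L : H \<rightarrow> T(V)\<close> into the tensor
  coalgebra.  In Sweedler's notation it is the solution of \<open>L(h) = \<epsilon>(h) 1 + \<Sum> L(h') \<cdot> \<phi>(h'')\<close>, where the dot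
  appends a letter; the recursion stops because \<open>\<phi>\<close> kills the term with \<open>h'' = 1\<close>.  Unrolling it gives
  \<open>L = \<Sum>n. \<phi>\<^sup>\<otimes>\<^sup>n \<circ> \<Delta>\<^bsup>(n - 1)\<^esup>\<close> with the iterated reduced coproduct.  See \<open>lift_rec\<close>, \<open>lift_unique\<close>,
  \<open>deconc_lift\<close>, \<open>coalgebra_map_rec\<close> and \<open>iter_lift\<close>.

  Foissy's isomorphism is obtained in this way.  For primitive \<open>p\<close> one has
  \<open>\<Delta>(h \<top> p) = \<Sum> h' \<otimes> (h'' \<top> p) + (h \<top> p) \<otimes> 1\<close> (\<open>cosum_top_prim\<close>).  Hence the equation
  \<open>\<Sum> h' \<top> E(h'') = h\<close> on elements of positive weight defines by recursion a projection \<open>E\<close> onto the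
  primitive elements which kills all \<open>h \<top> p\<close> with \<open>h\<close> of positive weight (\<open>primize_prim\<close>,
  \<open>primize_top_prim\<close>).  The same equation says that natural growth inverts the lift of \<open>E\<close>, so that
  \<open>E\<close> is the projection \<open>\<pi>\<close> (\<open>growth_lift\<close>, \<open>lift_growth\<close>).

  The logarithm is the lift of \<open>\<pi> \<circ> e\<close>, which settles its uniqueness and the formula for it.  It turns
  products into shuffles because \<open>e\<close> vanishes on products of two elements of positive weight: the last
  letter of \<open>Log(x y)\<close> then comes either from \<open>x\<close> or from \<open>y\<close>, and this is the recursion of the shuffle
  product (\<open>log_mult\<close>).  The vanishing is \<open>eulerian_mult\<close>: the convolution powers \<open>id\<^sup>*\<^sup>k\<close> are
  multiplicative, by commutativity, and polynomial in \<open>k\<close> with linear coefficient \<open>e\<close>.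

  Written in the coordinates provided by natural growth, the logarithm sums over all ways of splitting a
  word into consecutive blocks and replaces each block by one letter, which for a block of length one is
  the letter itself.  It is therefore the identity plus a part that shortens words, which yields
  bijectivity, the recursion for the inverse, and, by unrolling the recursion, the sum over chains
  (\<open>proj_tens_log\<close>, \<open>bij_tens_log\<close>, \<open>tens_exp_rec\<close>, \<open>sum_exp_term\<close>).

  As the logarithm is bijective and respects all structure maps, the Hopf algebra axioms pass from the
  Connes-Kreimer algebra to the shuffle algebra (\<open>graded_transport\<close>), and the functoriality of the
  latter follows from the naturality of the logarithm.\<close>

section \<open>Linear and multilinear maps\<close>

text \<open>Rules proving that an expression is linear in one of its variables, by descending along its syntax.
  Composition with an arbitrary linear map, \<open>lin_comp\<close> below, stays outside of this collection and is
  used with a given map only, since its conclusion matches every goal of this kind.\<close>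

named_theorems lin

lemma lin_sum [lin]: "(\<And>a. a \<in> S \<Longrightarrow> linear (f a)) \<Longrightarrow> linear (\<lambda>x. \<Sum>a\<in>S. f a x)"
  by (rule linear_compose_sum) blast

lemma lin_scaleR_left [lin]: "linear f \<Longrightarrow> linear (\<lambda>x. f x *\<^sub>R c)"
  by (rule linearI) (simp_all add: linear_add linear_cmul scaleR_add_left)

lemma lin_times [lin]:
  fixes f :: "'a::real_vector \<Rightarrow> real"
  shows "linear f \<Longrightarrow> linear (\<lambda>x. f x * c)" "linear f \<Longrightarrow> linear (\<lambda>x. c * f x)"
  by (rule linearI; simp add: linear_add linear_cmul algebra_simps)+

lemma lin_if [lin]: "linear f \<Longrightarrow> linear g \<Longrightarrow> linear (\<lambda>x. if P then f x else g x)"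
  by (cases P) simp_all

lemmas [lin] = linear_ident linear_zero linear_compose_add linear_compose_sub linear_compose_neg
  linear_compose_scale_right

lemma lin_comp: "linear F \<Longrightarrow> linear g \<Longrightarrow> linear (\<lambda>x. F (g x))"
  using linear_compose[of g F] by (simp add: o_def)

lemma bilinearI: "(\<And>x. linear (B x)) \<Longrightarrow> (\<And>y. linear (\<lambda>x. B x y)) \<Longrightarrow> bilinear B"
  by (simp add: bilinear_def)

lemma lin_bil1: "bilinear B \<Longrightarrow> linear g \<Longrightarrow> linear (\<lambda>x. B (g x) c)"
  using lin_comp[of "\<lambda>x. B x c" g] by (simp add: bilinear_def)

lemma lin_bil2: "bilinear B \<Longrightarrow> linear g \<Longrightarrow> linear (\<lambda>x. B c (g x))"
  using lin_comp[of "B c" g] by (simp add: bilinear_def)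

lemma lin_ext_comp: "linear F \<Longrightarrow> F (lin_ext \<phi> x) = lin_ext (\<lambda>b. F (\<phi> b)) x"
  by (simp add: lin_ext_def linear_sum linear_cmul)

lemma lin_ext_param: "(\<And>b. linear (\<lambda>x. \<phi> x b)) \<Longrightarrow> linear (\<lambda>x. lin_ext (\<phi> x) y)"
  unfolding lin_ext_def by (intro lin)

lemma lin_ext_gen_id: "lin_ext gen x = x"
proof (rule poly_mapping_eqI)
  fix k
  have "Poly_Mapping.lookup (lin_ext gen x) k = (\<Sum>b\<in>Poly_Mapping.keys x. Poly_Mapping.lookup x b * (if b = k then 1 else 0))"
    unfolding lin_ext_def by (simp add: lookup_sum lookup_scaleR_real lookup_single when_def)
  also have "\<dots> = Poly_Mapping.lookup x k"
    by (simp add: if_distrib[of "\<lambda>z. _ * z"] in_keys_iff cong: if_cong)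
  finally show "Poly_Mapping.lookup (lin_ext gen x) k = Poly_Mapping.lookup x k" .
qed

lemma lin_ext_unique: "linear F \<Longrightarrow> F x = lin_ext (\<lambda>b. F (gen b)) x"
  using lin_ext_comp[of F gen x] by (simp add: lin_ext_gen_id)

subsection \<open>The tensor algebra\<close>

text \<open>\<^const>\<open>tens_lin\<close> evaluates its function at a fixed representative, and is therefore linear in the
  function as well, for arbitrary functions.\<close>

lemma tens_lin_param [lin]: "(\<And>xs. linear (\<lambda>x. \<phi> x xs)) \<Longrightarrow> linear (\<lambda>x. tens_lin (\<phi> x) t)"
  unfolding tens_lin_def by (rule lin_ext_param)

lemma linear_abs_tens: "linear abs_tens"
  by (rule linearI) (simp_all add: plus_tens.abs_eq scaleR_tens.abs_eq)

lemma tens_eqI: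
  assumes "linear F" "linear G" "\<And>xs. F (word xs) = G (word xs)"
  shows "F t = G t"
proof -
  obtain x where t: "t = abs_tens x"
    by (metis Quotient3_abs_rep[OF Quotient3_tens])
  have l: "linear (\<lambda>x. F (abs_tens x))" "linear (\<lambda>x. G (abs_tens x))"
    by (intro lin_comp[OF assms(1)] lin_comp[OF assms(2)] linear_abs_tens)+
  show ?thesis
    unfolding t using lin_ext_unique[OF l(1), of x] lin_ext_unique[OF l(2), of x] assms(3)
    by (simp add: word.abs_eq)
qed

lemma tens_lin_unique: "linear F \<Longrightarrow> F = tens_lin (\<lambda>xs. F (word xs))"
proof
  fix t assume F: "linear F"
  have m: "multilin (\<lambda>xs. F (word xs))"
    unfolding multilin_def
    by (intro allI lin_comp[OF F]) (rule multilin_word[unfolded multilin_def, rule_format])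
  show "F t = tens_lin (\<lambda>xs. F (word xs)) t"
    by (rule tens_eqI[OF F linear_tens_lin[OF m]]) (simp add: tens_lin_word[OF m])
qed

lemma span_words: "t \<in> span (range word)"
proof -
  have "t = tens_lin word t"
    using tens_lin_unique[OF linear_ident] by metis
  also have "\<dots> \<in> span (range word)"
    unfolding tens_lin_def lin_ext_def by (intro span_sum span_scale span_base) simp
  finally show ?thesis .
qed

lemma multilinI: "(\<And>xs ys. linear (\<lambda>a. \<phi> (xs @ a # ys))) \<Longrightarrow> multilin \<phi>"
  by (simp add: multilin_def)

lemma multilinD: "multilin \<phi> \<Longrightarrow> linear g \<Longrightarrow> linear (\<lambda>x. \<phi> (xs @ g x # ys))"
  using lin_comp[of "\<lambda>a. \<phi> (xs @ a # ys)" g] by (simp add: multilin_def)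

lemma lin_word [lin]: "linear g \<Longrightarrow> linear (\<lambda>x. word (xs @ g x # ys))"
  by (rule multilinD[OF multilin_word])

lemma lin_word_simps [lin]:
  "linear g \<Longrightarrow> linear (\<lambda>x. word (g x # ys))"
  "linear g \<Longrightarrow> linear (\<lambda>x. word [u, g x])"
  "linear g \<Longrightarrow> linear (\<lambda>x. word [u, v, g x])"
  "linear g \<Longrightarrow> linear (\<lambda>x. word [u, g x, v])"
  using lin_word[of g "[]" ys] lin_word[of g "[u]" "[]"] lin_word[of g "[u, v]" "[]"]
    lin_word[of g "[u]" "[v]"] by simp_all

lemma word_zero: "word (xs @ 0 # ys) = 0"
  using linear_0[OF lin_word[OF linear_ident]] by blast

lemma tens_lin2:
  assumes "\<And>ys. multilin (\<lambda>xs. \<phi> xs ys)" "\<And>xs. multilin (\<phi> xs)"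
  shows bilinear_tens_lin2: "bilinear (\<lambda>s t. tens_lin (\<lambda>xs. tens_lin (\<phi> xs) t) s)"
    and tens_lin2_word: "tens_lin (\<lambda>xs. tens_lin (\<phi> xs) (word ys)) (word xs) = \<phi> xs ys"
proof -
  have m: "multilin (\<lambda>xs. tens_lin (\<phi> xs) t)" for t
    by (rule multilinI) (intro tens_lin_param multilinD[OF assms(1)] lin)
  show "bilinear (\<lambda>s t. tens_lin (\<lambda>xs. tens_lin (\<phi> xs) t) s)"
    by (intro bilinearI tens_lin_param linear_tens_lin m assms)
  show "tens_lin (\<lambda>xs. tens_lin (\<phi> xs) (word ys)) (word xs) = \<phi> xs ys"
    using m assms by (simp add: tens_lin_word)
qed

lemma
  shows bilinear_conc: "bilinear (tens_conc :: 'a::real_vector tens \<Rightarrow> _)"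
    and conc_word [simp]: "tens_conc (word xs) (word ys) = word (xs @ ys :: 'a::real_vector list)"
proof -
  have 1: "multilin (\<lambda>xs. word (xs @ ys))" for ys :: "'a list"
    by (rule multilinI) (simp, intro lin)
  have 2: "multilin (\<lambda>ys. word (xs @ ys))" for xs :: "'a list"
    by (rule multilinI) (simp add: append_assoc[symmetric] del: append_assoc, intro lin)
  show "bilinear (tens_conc :: 'a tens \<Rightarrow> _)"
    unfolding tens_conc_def[abs_def]
    by (rule bilinear_tens_lin2[of "\<lambda>xs ys. word (xs @ ys)", OF 1 2])
  show "tens_conc (word xs) (word ys) = word (xs @ ys)"
    unfolding tens_conc_def by (rule tens_lin2_word[of "\<lambda>xs ys. word (xs @ ys)", OF 1 2])
qed

lemmas lin_conc [lin] = lin_bil1[OF bilinear_conc] lin_bil2[OF bilinear_conc]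

lemma conc_Nil [simp]: "tens_conc t (word []) = t" "tens_conc (word []) t = t"
  by (rule tens_eqI[where t = t], intro lin, intro lin, simp)+

lemma conc_assoc: "tens_conc (tens_conc s t) u = tens_conc s (tens_conc t u)"
proof -
  have 1: "tens_conc (tens_conc (word xs) (word ys)) u = tens_conc (word xs) (tens_conc (word ys) u)"
    for xs ys by (rule tens_eqI[where t = u], intro lin, intro lin, simp)
  have 2: "tens_conc (tens_conc (word xs) t) u = tens_conc (word xs) (tens_conc t u)" for xs
    by (rule tens_eqI[where t = t], intro lin, intro lin, rule 1)
  show ?thesis
    by (rule tens_eqI[where t = s], intro lin, intro lin, rule 2)
qed

lemma tens_map:
  assumes "linear F"
  shows linear_tens_map: "linear (tens_map F)"
    and tens_map_word [simp]: "tens_map F (word xs) = word (map F xs)"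
proof -
  have m: "multilin (\<lambda>xs. word (map F xs))"
    by (rule multilinI) (simp, intro lin assms)
  show "linear (tens_map F)" "tens_map F (word xs) = word (map F xs)"
    unfolding tens_map_def using tens_lin[OF m] by auto
qed

lemma tens_map_conc:
  assumes "linear F"
  shows "tens_map F (tens_conc s t) = tens_conc (tens_map F s) (tens_map F t)"
proof -
  note l = lin_comp[OF linear_tens_map[OF assms]]
  have 1: "tens_map F (tens_conc (word xs) t) = tens_conc (tens_map F (word xs)) (tens_map F t)" for xs
    by (rule tens_eqI[where t = t], intro lin l, intro lin l, simp add: assms)
  show ?thesis
    by (rule tens_eqI[where t = s], intro lin l, intro lin l, rule 1)
qed

lemma multilin_otimes:
  assumes "\<And>F. F \<in> set Fs \<Longrightarrow> linear F"
  shows "multilin (\<lambda>xs. if length xs = length Fs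
      then foldr tens_conc (map2 (\<lambda>F x. F x) Fs xs) (word []) else 0)"
proof (rule multilinI)
  fix xs ys
  have "linear (\<lambda>a. foldr tens_conc (map2 (\<lambda>F x. F x) Fs (xs @ a # ys)) (word []))"
    if "length Fs = Suc (length xs + length ys)" using assms that
  proof (induction xs arbitrary: Fs)
    case Nil
    then obtain F Gs where "Fs = F # Gs" by (cases Fs) auto
    moreover have "linear F" using Nil(1) calculation by simp
    ultimately show ?case using Nil(2) by (simp, intro lin lin_comp[OF \<open>linear F\<close>])
  next
    case (Cons x xs)
    then obtain F Gs where F: "Fs = F # Gs" by (cases Fs) auto
    then have "linear (\<lambda>a. foldr tens_conc (map2 (\<lambda>F x. F x) Gs (xs @ a # ys)) (word []))"
      using Cons by auto
    then show ?case unfolding F by (simp, intro lin)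
  qed
  then show "linear (\<lambda>a. if length (xs @ a # ys) = length Fs
      then foldr tens_conc (map2 (\<lambda>F x. F x) Fs (xs @ a # ys)) (word []) else 0)"
    by (cases "length Fs = Suc (length xs + length ys)") (simp_all add: linear_zero)
qed

lemma linear_otimes: "(\<And>F. F \<in> set Fs \<Longrightarrow> linear F) \<Longrightarrow> linear (otimes Fs)"
  unfolding otimes_def by (intro linear_tens_lin multilin_otimes)

lemma otimes_word:
  assumes "\<And>F. F \<in> set Fs \<Longrightarrow> linear F"
  shows "otimes Fs (word xs) = (if length xs = length Fs
      then foldr tens_conc (map2 (\<lambda>F x. F x) Fs xs) (word []) else 0)"
  unfolding otimes_def by (rule tens_lin_word[OF multilin_otimes[OF assms]])

lemma foldr_conc_append:
  "foldr tens_conc (ss @ ts) u = tens_conc (foldr tens_conc ss (word [])) (foldr tens_conc ts u)"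
  by (induction ss) (simp_all add: conc_assoc)

lemma otimes_conc_letter:
  assumes "\<And>F. F \<in> set Fs \<Longrightarrow> linear F" "linear G"
  shows "otimes (Fs @ [G]) (tens_conc s (letter v)) = tens_conc (otimes Fs s) (G v)"
proof -
  have *: "\<And>F. F \<in> set (Fs @ [G]) \<Longrightarrow> linear F" using assms by auto
  note l = lin_comp[OF linear_otimes[OF *]] lin_comp[OF linear_otimes[OF assms(1)]]
  show ?thesis
  proof (rule tens_eqI[where t = s])
    show "linear (\<lambda>s. otimes (Fs @ [G]) (tens_conc s (letter v)))" by (intro l lin)
    show "linear (\<lambda>s. tens_conc (otimes Fs s) (G v))" by (intro lin l)
    fix xs
    show "otimes (Fs @ [G]) (tens_conc (word xs) (letter v)) = tens_conc (otimes Fs (word xs)) (G v)"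
      using otimes_word[of "Fs @ [G]" "xs @ [v]", OF *] otimes_word[of Fs xs, OF assms(1)]
        foldr_conc_append[of "map2 (\<lambda>F x. F x) Fs xs" "[]" "G v"]
      by (auto simp: linear_0[OF lin_conc(1)[OF linear_ident]])
  qed
qed

lemma otimes_pair:
  assumes "linear F" "linear G"
  shows "otimes [F, G] (word [a, b]) = tens_conc (F a) (G b)"
  using assms by (subst otimes_word) auto

text \<open>The linear map \<open>A \<otimes> A \<rightarrow> C\<close> induced by a bilinear map, with \<open>A \<otimes> A\<close> embedded in the tensor algebra.\<close>

definition pair_lin :: "('a::real_vector \<Rightarrow> 'a \<Rightarrow> 'c::real_vector) \<Rightarrow> 'a tens \<Rightarrow> 'c" where
  "pair_lin B = tens_lin (\<lambda>xs. if length xs = 2 then B (xs ! 0) (xs ! 1) else 0)"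

lemma pair_lin:
  assumes "bilinear B"
  shows linear_pair_lin: "linear (pair_lin B)"
    and pair_lin_word [simp]: "pair_lin B (word [a, b]) = B a b"
proof -
  have m: "multilin (\<lambda>xs. if length xs = 2 then B (xs ! 0) (xs ! 1) else 0)"
  proof (rule multilinI)
    fix xs ys :: "'a list"
    consider "length xs + length ys \<noteq> 1" | x where "xs = [x]" "ys = []" | y where "xs = []" "ys = [y]"
    proof (cases "length xs + length ys = 1")
      case True
      then have "(\<exists>x. xs = [x]) \<and> ys = [] \<or> xs = [] \<and> (\<exists>y. ys = [y])"
        by (cases xs; cases ys) auto
      then show ?thesis using that by blast
    qed (use that in blast)
    then show "linear (\<lambda>a. if length (xs @ a # ys) = 2 then B ((xs @ a # ys) ! 0) ((xs @ a # ys) ! 1) else 0)"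
      using assms by cases (auto simp: bilinear_def linear_zero)
  qed
  show "linear (pair_lin B)" "pair_lin B (word [a, b]) = B a b"
    unfolding pair_lin_def using tens_lin[OF m] by auto
qed

lemma multilin_deconc: "multilin (\<lambda>xs. \<Sum>i\<le>length xs. word [word (take i xs), word (drop i xs)])"
proof (rule multilinI)
  fix xs ys :: "'a list"
  have "linear (\<lambda>a. word [word (take i (xs @ a # ys)), word (drop i (xs @ a # ys))])" for i
  proof (cases "i \<le> length xs")
    case True
    then show ?thesis by (simp, intro lin)
  next
    case False
    then obtain j where "i - length xs = Suc j" by (metis Suc_diff_Suc not_le)
    then show ?thesis using False by (simp, intro lin)
  qed
  then show "linear (\<lambda>a. \<Sum>i\<le>length (xs @ a # ys).
      word [word (take i (xs @ a # ys)), word (drop i (xs @ a # ys))])"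
    by (simp only: length_append length_Cons) (intro lin)
qed

lemma
  shows linear_deconc: "linear (deconc :: 'a::real_vector tens \<Rightarrow> 'a tens tens)"
    and deconc_word: "deconc (word (xs :: 'a list)) = (\<Sum>i\<le>length xs. word [word (take i xs), word (drop i xs)])"
  unfolding deconc_def using tens_lin[OF multilin_deconc] by auto

lemma
  shows linear_counit: "linear (tens_counit :: 'a::real_vector tens \<Rightarrow> real)"
    and counit_word [simp]: "tens_counit (word (xs :: 'a list)) = (if xs = [] then 1 else 0)"
proof -
  have m: "multilin (\<lambda>xs :: 'a list. if xs = [] then 1 else 0 :: real)"
    by (rule multilinI) (simp add: linear_zero)
  show "linear (tens_counit :: 'a tens \<Rightarrow> real)" "tens_counit (word xs) = (if xs = [] then 1 else 0)"
    unfolding tens_counit_def using tens_lin[OF m] by auto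
qed

lemma
  shows linear_tens_pi: "linear (tens_pi :: 'a::real_vector tens \<Rightarrow> 'a)"
    and tens_pi_word [simp]: "tens_pi (word (xs :: 'a list)) = (if length xs = 1 then hd xs else 0)"
proof -
  have m: "multilin (\<lambda>xs :: 'a list. if length xs = 1 then hd xs else 0)"
  proof (rule multilinI)
    fix xs ys :: "'a list"
    show "linear (\<lambda>a. if length (xs @ a # ys) = 1 then hd (xs @ a # ys) else 0)"
      by (cases "xs = [] \<and> ys = []") (auto simp: linear_zero linear_ident)
  qed
  show "linear (tens_pi :: 'a tens \<Rightarrow> 'a)" "tens_pi (word xs) = (if length xs = 1 then hd xs else 0)"
    unfolding tens_pi_def using tens_lin[OF m] by auto
qed

lemma
  shows linear_tens_proj: "linear (tens_proj n :: 'a::real_vector tens \<Rightarrow> 'a tens)"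
    and tens_proj_word [simp]: "tens_proj n (word (xs :: 'a list)) = (if length xs = n then word xs else 0)"
proof -
  have m: "multilin (\<lambda>xs :: 'a list. if length xs = n then word xs else 0)"
    by (rule multilinI) (simp only: length_append length_Cons, intro lin)
  show "linear (tens_proj n :: 'a tens \<Rightarrow> 'a tens)" "tens_proj n (word xs) = (if length xs = n then word xs else 0)"
    unfolding tens_proj_def using tens_lin[OF m] by auto
qed

lemmas lin_tens [lin] = lin_comp[OF linear_deconc] lin_comp[OF linear_counit]
  lin_comp[OF linear_tens_pi] lin_comp[OF linear_tens_proj]

lemma tens_mult:
  assumes "bilinear m"
  shows linear_tens_mult: "linear (tens_mult m u)"
    and tens_mult_word [simp]: "tens_mult m u (word xs) = foldr m xs u"
proof -
  have m: "multilin (\<lambda>xs. foldr m xs u)"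
  proof (rule multilinI)
    fix xs ys
    show "linear (\<lambda>a. foldr m (xs @ a # ys) u)"
      by (induction xs) (simp_all, (intro lin_bil1[OF assms] lin_bil2[OF assms] lin; assumption?)+)
  qed
  show "linear (tens_mult m u)" "tens_mult m u (word xs) = foldr m xs u"
    unfolding tens_mult_def using tens_lin[OF m] by auto
qed

lemma tens_componentwise:
  fixes m :: "'a::real_vector \<Rightarrow> 'a \<Rightarrow> 'a"
  assumes "bilinear m"
  shows bilinear_componentwise: "bilinear (tens_componentwise m)"
    and componentwise_word: "tens_componentwise m (word xs) (word ys) =
      (if length xs = length ys then word (map2 m xs ys) else 0)"
proof -
  have split: "\<exists>ys1 b ys2. ys = ys1 @ b # ys2 \<and> length ys1 = length xs \<and> length ys2 = length us"
    if "Suc (length xs + length us) = length ys" for xs us ys :: "'a list"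
    using that by (intro exI[of _ "take (length xs) ys"] exI[of _ "ys ! length xs"]
        exI[of _ "drop (Suc (length xs)) ys"]) (auto simp: id_take_nth_drop[symmetric])
  have 1: "multilin (\<lambda>xs. if length xs = length ys then word (map2 m xs ys) else 0)" for ys
  proof (rule multilinI)
    fix xs us
    show "linear (\<lambda>a. if length (xs @ a # us) = length ys then word (map2 m (xs @ a # us) ys) else 0)"
    proof (cases "Suc (length xs + length us) = length ys")
      case True
      with split obtain ys1 b ys2 where "ys = ys1 @ b # ys2" "length ys1 = length xs" "length ys2 = length us"
        by blast
      then show ?thesis by (simp, intro lin lin_bil1[OF assms])
    qed (simp add: linear_zero)
  qed
  have 2: "multilin (\<lambda>ys. if length xs = length ys then word (map2 m xs ys) else 0)" for xs
  proof (rule multilinI)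
    fix ys us
    show "linear (\<lambda>a. if length xs = length (ys @ a # us) then word (map2 m xs (ys @ a # us)) else 0)"
    proof (cases "Suc (length ys + length us) = length xs")
      case True
      with split obtain ys1 b ys2 where "xs = ys1 @ b # ys2" "length ys1 = length ys" "length ys2 = length us"
        by blast
      then show ?thesis by (simp, intro lin lin_bil2[OF assms])
    qed (auto simp: linear_zero)
  qed
  show "bilinear (tens_componentwise m)"
    unfolding tens_componentwise_def[abs_def]
    by (rule bilinear_tens_lin2[of "\<lambda>xs ys. if length xs = length ys then word (map2 m xs ys) else 0", OF 1 2])
  show "tens_componentwise m (word xs) (word ys) =
      (if length xs = length ys then word (map2 m xs ys) else 0)"
    unfolding tens_componentwise_def
    by (rule tens_lin2_word[of "\<lambda>xs ys. if length xs = length ys then word (map2 m xs ys) else 0", OF 1 2])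
qed

subsection \<open>Shuffles\<close>

abbreviation shuffle_sum :: "'a::real_vector list \<Rightarrow> 'a list \<Rightarrow> 'a tens" where
  "shuffle_sum xs ys \<equiv> sum_list (map word (shuffle_list xs ys))"

lemma shuffle_list_Nil2 [simp]: "shuffle_list xs [] = [xs]"
  by (cases xs) simp_all

lemma sum_list_word_Cons:
  "sum_list (map word (map ((#) x) L)) = tens_conc (letter x) (sum_list (map word L))"
  by (induction L) (simp_all add: linear_0[OF lin_conc(2)[OF linear_ident]]
      linear_add[OF lin_conc(2)[OF linear_ident]])

lemma shuffle_sum_Cons:
  "shuffle_sum (x # xs) (y # ys) =
     tens_conc (letter x) (shuffle_sum xs (y # ys)) + tens_conc (letter y) (shuffle_sum (x # xs) ys)"
  by (simp only: shuffle_list.simps map_append sum_list_append sum_list_word_Cons)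

lemma shuffle_sum_commute: "shuffle_sum xs ys = shuffle_sum ys xs"
proof (induction xs ys rule: shuffle_list.induct)
  case (3 x xs y ys)
  then show ?case by (simp only: shuffle_sum_Cons add.commute)
qed simp_all

text \<open>Shuffles are defined by removing first letters, whereas the logarithm is built by appending letters.\<close>

lemma shuffle_sum_snoc:
  "shuffle_sum (xs @ [x]) (ys @ [y]) =
     tens_conc (shuffle_sum xs (ys @ [y])) (letter x) + tens_conc (shuffle_sum (xs @ [x]) ys) (letter y)"
proof (induction xs ys rule: shuffle_list.induct)
  case (1 ys)
  show ?case
  proof (induction ys)
    case Nil
    show ?case by (simp add: add.commute)
  next
    case (Cons z zs)
    have "shuffle_sum ([] @ [x]) ((z # zs) @ [y]) =
        word (x # z # zs @ [y]) + tens_conc (letter z) (shuffle_sum [x] (zs @ [y]))"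
      using shuffle_sum_Cons[of x "[]" z "zs @ [y]"] by simp
    also have "\<dots> = word (x # z # zs @ [y]) + (word (z # zs @ [y, x]) +
        tens_conc (letter z) (tens_conc (shuffle_sum [x] zs) (letter y)))"
      using Cons by (simp add: linear_add[OF lin_conc(2)[OF linear_ident]])
    also have "\<dots> = word (z # zs @ [y, x]) + tens_conc (shuffle_sum [x] (z # zs)) (letter y)"
      using shuffle_sum_Cons[of x "[]" z zs]
      by (simp add: linear_add[OF lin_conc(1)[OF linear_ident]] conc_assoc)
    finally show ?case by simp
  qed
next
  case (2 z zs)
  show ?case
  proof (induction zs arbitrary: z)
    case Nil
    have "shuffle_sum [z, x] [y] = tens_conc (letter z) (shuffle_sum [x] [y]) + word [y, z, x]"
      using shuffle_sum_Cons[of z "[x]" y "[]"] by simp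
    then show ?case
      by (simp add: linear_add[OF lin_conc(2)[OF linear_ident]] linear_add[OF lin_conc(1)[OF linear_ident]])
  next
    case (Cons w ws)
    have "shuffle_sum ((z # w # ws) @ [x]) ([] @ [y]) =
        tens_conc (letter z) (shuffle_sum ((w # ws) @ [x]) ([] @ [y])) + word (y # z # w # ws @ [x])"
      using shuffle_sum_Cons[of z "w # ws @ [x]" y "[]"] by simp
    also have "\<dots> = tens_conc (letter z) (tens_conc (shuffle_sum (w # ws) [y]) (letter x)) +
        word (z # w # ws @ [x, y]) + word (y # z # w # ws @ [x])"
      unfolding Cons by (simp add: linear_add[OF lin_conc(2)[OF linear_ident]])
    also have "\<dots> = tens_conc (shuffle_sum (z # w # ws) [y]) (letter x) + word (z # w # ws @ [x, y])"
      by (simp only: shuffle_sum_Cons linear_add[OF lin_conc(1)[OF linear_ident]]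
          linear_add[OF lin_conc(2)[OF linear_ident]] conc_assoc) simp
    finally show ?case by simp
  qed
next
  case (3 z zs w ws)
  have "shuffle_sum ((z # zs) @ [x]) ((w # ws) @ [y]) =
      tens_conc (letter z) (shuffle_sum (zs @ [x]) ((w # ws) @ [y])) +
      tens_conc (letter w) (shuffle_sum ((z # zs) @ [x]) (ws @ [y]))"
    by (simp only: append_Cons shuffle_sum_Cons)
  also have "\<dots> = tens_conc (tens_conc (letter z) (shuffle_sum zs (w # ws @ [y])) +
         tens_conc (letter w) (shuffle_sum (z # zs) (ws @ [y]))) (letter x) +
      tens_conc (tens_conc (letter z) (shuffle_sum (zs @ [x]) (w # ws)) +
         tens_conc (letter w) (shuffle_sum (z # zs @ [x]) ws)) (letter y)"
    unfolding 3 by (simp add: linear_add[OF lin_conc(2)[OF linear_ident]]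
        linear_add[OF lin_conc(1)[OF linear_ident]] conc_assoc)
  also have "\<dots> = tens_conc (shuffle_sum (z # zs) ((w # ws) @ [y])) (letter x) +
      tens_conc (shuffle_sum ((z # zs) @ [x]) (w # ws)) (letter y)"
    by (simp only: shuffle_sum_Cons append_Cons)
  finally show ?case .
qed

lemma multilin_shuffle1: "multilin (\<lambda>xs. shuffle_sum xs ys)"
proof (rule multilinI)
  fix xs us :: "'a list"
  show "linear (\<lambda>a. shuffle_sum (xs @ a # us) ys)"
  proof (induction ys arbitrary: xs)
    case Nil
    show ?case by (simp, intro lin)
  next
    case (Cons y ys)
    note IH = Cons
    show ?case
    proof (induction xs)
      case Nil
      show ?case
        by (simp only: append_Nil shuffle_sum_Cons) (intro lin IH[of "[]", unfolded append_Nil])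
    next
      case (Cons x xs)
      show ?case
        by (simp only: append_Cons shuffle_sum_Cons)
          (intro lin Cons[unfolded append_Cons] IH[of "x # xs", unfolded append_Cons])
    qed
  qed
qed

lemma multilin_shuffle2: "multilin (shuffle_sum xs)"
  using multilin_shuffle1[of xs] by (simp add: shuffle_sum_commute[of xs])

lemma
  shows bilinear_shuffle: "bilinear (tens_shuffle :: 'a::real_vector tens \<Rightarrow> _)"
    and shuffle_word: "tens_shuffle (word xs) (word (ys :: 'a list)) = shuffle_sum xs ys"
  unfolding tens_shuffle_def[abs_def]
  using bilinear_tens_lin2[of "\<lambda>xs ys. shuffle_sum xs ys", OF multilin_shuffle1 multilin_shuffle2]
    tens_lin2_word[of "\<lambda>xs ys. shuffle_sum xs ys", OF multilin_shuffle1 multilin_shuffle2] by auto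

lemmas lin_shuffle [lin] = lin_bil1[OF bilinear_shuffle] lin_bil2[OF bilinear_shuffle]

lemma shuffle_Nil [simp]: "tens_shuffle (word []) t = t" "tens_shuffle t (word []) = t"
  by (rule tens_eqI[where t = t], intro lin, intro lin, simp add: shuffle_word)+

text \<open>The last letter of a shuffle comes from one of the two factors.\<close>

lemma shuffle_conc_letter:
  "tens_shuffle (tens_conc s (letter x)) (tens_conc t (letter y)) =
     tens_conc (tens_shuffle s (tens_conc t (letter y))) (letter x) +
     tens_conc (tens_shuffle (tens_conc s (letter x)) t) (letter y)"
proof -
  have 1: "tens_shuffle (tens_conc (word xs) (letter x)) (tens_conc t (letter y)) =
     tens_conc (tens_shuffle (word xs) (tens_conc t (letter y))) (letter x) +
     tens_conc (tens_shuffle (tens_conc (word xs) (letter x)) t) (letter y)" for xs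
    by (rule tens_eqI[where t = t], intro lin, intro lin)
      (simp add: shuffle_word shuffle_sum_snoc)
  show ?thesis
    by (rule tens_eqI[where t = s], intro lin, intro lin, rule 1)
qed

section \<open>Forests\<close>

lemma empty_forest_simps [simp]: "verts empty_forest = {}" "edges empty_forest = {}"
  by (transfer; simp)+

lemma map_dec_simps [simp]:
  "verts (map_dec \<theta> f) = verts f" "edges (map_dec \<theta> f) = edges f"
  "dec (map_dec \<theta> f) = \<theta> \<circ> dec f"
  by (transfer; auto)+

lemma acyclic_edges: "acyclic (edges f)"
  by transfer (auto simp: is_forest_def)

lemma wf_edges: "wf (edges f)"
  by (rule finite_acyclic_wf[OF finite_subset[OF edges_verts] acyclic_edges]) simp

lemma edge_verts: "(x, y) \<in> edges f \<Longrightarrow> x \<in> verts f \<and> y \<in> verts f"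
  using edges_verts[of f] by blast

text \<open>Each vertex has a root above it, as the edges form a finite acyclic relation.\<close>

lemma cut_with_roots:
  assumes "A \<in> cuts f" "\<And>r. r \<in> verts f \<Longrightarrow> \<forall>p. (p, r) \<notin> edges f \<Longrightarrow> r \<in> A"
  shows "A = verts f"
proof -
  have "x \<in> verts f \<longrightarrow> x \<in> A" for x
    using wf_edges[of f]
  proof (induction x rule: wf_induct_rule)
    case (less x)
    show ?case
    proof (cases "\<exists>p. (p, x) \<in> edges f")
      case True
      then obtain p where p: "(p, x) \<in> edges f" by blast
      then have "p \<in> A" using less edge_verts by blast
      then show ?thesis using assms(1) p by (auto simp: cuts_def)
    qed (use assms(2) in blast)
  qed
  then show ?thesis using assms(1) by (auto simp: cuts_def)
qed

lemma finite_cuts [simp]: "finite (cuts f)"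
  by (rule finite_subset[of _ "Pow (verts f)"]) (auto simp: cuts_def)

lemma cuts_trivial [simp]: "{} \<in> cuts f" "verts f \<in> cuts f"
  using edges_verts[of f] by (auto simp: cuts_def)

lemma cut_subset: "A \<in> cuts f \<Longrightarrow> A \<subseteq> verts f"
  by (auto simp: cuts_def)

subsection \<open>Disjoint unions and graftings\<close>

text \<open>Sets of vertices of disjoint unions and graftings have this form, since there the first forest occupies
  the even numbers and the second one the odd numbers.\<close>

definition par :: "nat set \<Rightarrow> nat set \<Rightarrow> nat set" where
  "par A B = (\<lambda>n. 2 * n) ` A \<union> (\<lambda>n. Suc (2 * n)) ` B"

lemma double_Suc [simp]: "2 * x \<noteq> Suc (2 * y)" "Suc (2 * x) \<noteq> 2 * y"
  by presburger+

lemma par_simps [simp]: "2 * x \<in> par A B \<longleftrightarrow> x \<in> A" "Suc (2 * x) \<in> par A B \<longleftrightarrow> x \<in> B"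
  by (auto simp: par_def)

lemma all_parity: "(\<forall>n::nat. P n) \<longleftrightarrow> (\<forall>x. P (2 * x)) \<and> (\<forall>x. P (Suc (2 * x)))"
  by (metis evenE oddE Suc_eq_plus1)

lemma parity_cases: obtains (even) x where "n = 2 * x" | (odd) x where "n = Suc (2 * x)"
  by (metis evenE oddE Suc_eq_plus1)

lemma set_eq_parity: "A = B \<longleftrightarrow> (\<forall>x. 2 * x \<in> A \<longleftrightarrow> 2 * x \<in> B) \<and> (\<forall>x. Suc (2 * x) \<in> A \<longleftrightarrow> Suc (2 * x) \<in> B)"
  unfolding set_eq_iff by (rule all_parity)

lemma par_surj: "S = par {x. 2 * x \<in> S} {x. Suc (2 * x) \<in> S}"
  by (simp add: set_eq_parity)

lemma par_eq_iff: "par A B = par A' B' \<longleftrightarrow> A = A' \<and> B = B'"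
  by (auto simp: set_eq_parity[of "par A B"])

lemma card_par: "finite A \<Longrightarrow> finite B \<Longrightarrow> card (par A B) = card A + card B"
  unfolding par_def by (subst card_Un_disjoint) (auto simp: card_image inj_on_def)

lemma par_empty_iff [simp]: "par A B = {} \<longleftrightarrow> A = {} \<and> B = {}"
  by (auto simp: par_def)

lemma verts_disj_union [simp]: "verts (disj_union f g) = par (verts f) (verts g)"
  and verts_graft [simp]: "verts (graft f g v) = par (verts f) (verts g)"
  unfolding par_def by (transfer; auto simp: graft_data_def)+

lemma disj_union_edges [simp]:
  "(2 * x, 2 * y) \<in> edges (disj_union f g) \<longleftrightarrow> (x, y) \<in> edges f"
  "(Suc (2 * x), Suc (2 * y)) \<in> edges (disj_union f g) \<longleftrightarrow> (x, y) \<in> edges g"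
  "(2 * x, Suc (2 * y)) \<notin> edges (disj_union f g)"
  "(Suc (2 * x), 2 * y) \<notin> edges (disj_union f g)"
  by (transfer; auto simp: graft_data_def)+

lemma graft_edges [simp]:
  "(2 * x, 2 * y) \<in> edges (graft f g v) \<longleftrightarrow> (x, y) \<in> edges f"
  "(Suc (2 * x), Suc (2 * y)) \<in> edges (graft f g v) \<longleftrightarrow> (x, y) \<in> edges g"
  "(2 * x, Suc (2 * y)) \<notin> edges (graft f g v)"
  "(Suc (2 * x), 2 * y) \<in> edges (graft f g v) \<longleftrightarrow>
     x = v \<and> v \<in> verts g \<and> y \<in> verts f \<and> (\<forall>p. (p, y) \<notin> edges f)"
  by (transfer; auto simp: graft_data_def)+

lemma dec_disj_union [simp]:
  "dec (disj_union f g) (2 * x) = dec f x" "dec (disj_union f g) (Suc (2 * x)) = dec g x"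
  and dec_graft [simp]:
  "dec (graft f g v) (2 * x) = dec f x" "dec (graft f g v) (Suc (2 * x)) = dec g x"
  by (transfer; auto simp: graft_data_def)+

lemma forest_eq_parity:
  assumes "\<And>x. 2 * x \<in> verts F \<longleftrightarrow> 2 * x \<in> verts G"
    "\<And>x. Suc (2 * x) \<in> verts F \<longleftrightarrow> Suc (2 * x) \<in> verts G"
    "\<And>x y. (2 * x, 2 * y) \<in> edges F \<longleftrightarrow> (2 * x, 2 * y) \<in> edges G"
    "\<And>x y. (2 * x, Suc (2 * y)) \<in> edges F \<longleftrightarrow> (2 * x, Suc (2 * y)) \<in> edges G"
    "\<And>x y. (Suc (2 * x), 2 * y) \<in> edges F \<longleftrightarrow> (Suc (2 * x), 2 * y) \<in> edges G"
    "\<And>x y. (Suc (2 * x), Suc (2 * y)) \<in> edges F \<longleftrightarrow> (Suc (2 * x), Suc (2 * y)) \<in> edges G"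
    "\<And>x. dec F (2 * x) = dec G (2 * x)" "\<And>x. dec F (Suc (2 * x)) = dec G (Suc (2 * x))"
  shows "F = G"
proof (rule forest_eqI)
  show "verts F = verts G" using assms(1,2) by (simp add: set_eq_parity)
  have "(x, y) \<in> edges F \<longleftrightarrow> (x, y) \<in> edges G" for x y
    by (cases x rule: parity_cases; cases y rule: parity_cases) (simp_all add: assms(3-6))
  then show "edges F = edges G" by auto
  have "dec F x = dec G x" for x
    by (cases x rule: parity_cases) (simp_all add: assms(7,8))
  then show "dec F = dec G" by auto
qed

lemma dec_upd_disj_union:
  "dec_upd (disj_union f g) (2 * v) a = disj_union (dec_upd f v a) g"
  "dec_upd (disj_union f g) (Suc (2 * v)) a = disj_union f (dec_upd g v a)"
  by (rule forest_eq_parity; simp)+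

lemma dec_upd_graft:
  "dec_upd (graft f g w) (2 * v) a = graft (dec_upd f v a) g w"
  "dec_upd (graft f g w) (Suc (2 * v)) a = graft f (dec_upd g v a) w"
  by (rule forest_eq_parity; simp)+

lemma map_dec_disj_union: "map_dec \<theta> (disj_union f g) = disj_union (map_dec \<theta> f) (map_dec \<theta> g)"
  by (rule forest_eq_parity) auto

lemma map_dec_graft: "map_dec \<theta> (graft f g v) = graft (map_dec \<theta> f) (map_dec \<theta> g) v"
  by (rule forest_eq_parity) auto

lemma map_dec_restrict: "map_dec \<theta> (forest_restrict f A) = forest_restrict (map_dec \<theta> f) A"
  by (rule forest_eqI) auto

lemma map_dec_dec_upd: "map_dec \<theta> (dec_upd f v a) = dec_upd (map_dec \<theta> f) v (\<theta> a)"
  by (rule forest_eqI) auto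

lemma restrict_restrict: "forest_restrict (forest_restrict f A) B = forest_restrict f (A \<inter> B)"
  by (rule forest_eqI) auto

lemma restrict_verts [simp]: "forest_restrict f (verts f) = f"
  by (rule forest_eqI) (use edges_verts[of f] in auto)

lemma restrict_disj_union:
  "forest_restrict (disj_union f g) (par A B) = disj_union (forest_restrict f A) (forest_restrict g B)"
  by (rule forest_eq_parity) auto

text \<open>The second condition holds for complements of cuts.  It ensures that the roots of the restricted forest
  are roots of \<open>f\<close>, so that no new edges to \<open>v\<close> arise.\<close>

lemma restrict_graft_in:
  assumes "v \<in> B" "\<And>x y. (x, y) \<in> edges f \<Longrightarrow> y \<in> A \<Longrightarrow> x \<in> A"
  shows "forest_restrict (graft f g v) (par A B) = graft (forest_restrict f A) (forest_restrict g B) v"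
  by (rule forest_eq_parity) (use assms in auto)

lemma restrict_graft_out:
  assumes "v \<notin> B"
  shows "forest_restrict (graft f g v) (par A B) = disj_union (forest_restrict f A) (forest_restrict g B)"
  by (rule forest_eq_parity) (use assms in auto)

lemma par_subset_iff [simp]: "par A B \<subseteq> par A' B' \<longleftrightarrow> A \<subseteq> A' \<and> B \<subseteq> B'"
  by (auto simp: par_def)

lemma cuts_parity:
  "A \<in> cuts k \<longleftrightarrow> A \<subseteq> verts k \<and>
     (\<forall>x y. 2 * x \<in> A \<longrightarrow> (2 * x, 2 * y) \<in> edges k \<longrightarrow> 2 * y \<in> A) \<and>
     (\<forall>x y. 2 * x \<in> A \<longrightarrow> (2 * x, Suc (2 * y)) \<in> edges k \<longrightarrow> Suc (2 * y) \<in> A) \<and>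
     (\<forall>x y. Suc (2 * x) \<in> A \<longrightarrow> (Suc (2 * x), 2 * y) \<in> edges k \<longrightarrow> 2 * y \<in> A) \<and>
     (\<forall>x y. Suc (2 * x) \<in> A \<longrightarrow> (Suc (2 * x), Suc (2 * y)) \<in> edges k \<longrightarrow> Suc (2 * y) \<in> A)"
  (is "_ \<longleftrightarrow> ?R")
proof
  assume R: ?R
  have "y \<in> A" if "x \<in> A" "(x, y) \<in> edges k" for x y
    using that R by (cases x rule: parity_cases; cases y rule: parity_cases) blast+
  then show "A \<in> cuts k" using R by (auto simp: cuts_def)
qed (auto simp: cuts_def)

lemma cuts_disj_union: "par A B \<in> cuts (disj_union f g) \<longleftrightarrow> A \<in> cuts f \<and> B \<in> cuts g"
  unfolding cuts_parity[of "par A B"] by (auto simp: cuts_def)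

text \<open>A cut that contains the vertex \<open>v\<close> also contains the roots of \<open>f\<close>, which lie below \<open>v\<close> in the grafting,
  and with them all of \<open>f\<close>.\<close>

lemma cuts_graft:
  assumes v: "v \<in> verts g"
  shows "par A B \<in> cuts (graft f g v) \<longleftrightarrow> A \<in> cuts f \<and> B \<in> cuts g \<and> (v \<in> B \<longrightarrow> A = verts f)"
proof -
  have "par A B \<in> cuts (graft f g v) \<longleftrightarrow> A \<in> cuts f \<and> B \<in> cuts g \<and>
      (v \<in> B \<longrightarrow> (\<forall>r\<in>verts f. (\<forall>p. (p, r) \<notin> edges f) \<longrightarrow> r \<in> A))"
    unfolding cuts_parity[of "par A B"] using v by (auto simp: cuts_def)
  also have "\<dots> \<longleftrightarrow> A \<in> cuts f \<and> B \<in> cuts g \<and> (v \<in> B \<longrightarrow> A = verts f)"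
    using cut_with_roots[of A f] by blast
  finally show ?thesis .
qed

lemma sum_cuts_disj_union:
  "(\<Sum>S\<in>cuts (disj_union f g). Q S) = (\<Sum>A\<in>cuts f. \<Sum>B\<in>cuts g. Q (par A B))"
proof -
  have "bij_betw (\<lambda>(A, B). par A B) (cuts f \<times> cuts g) (cuts (disj_union f g))"
  proof (rule bij_betwI')
    fix S assume S: "S \<in> cuts (disj_union f g)"
    show "\<exists>x\<in>cuts f \<times> cuts g. S = (case x of (A, B) \<Rightarrow> par A B)"
      using S par_surj[of S] cuts_disj_union[of "{x. 2 * x \<in> S}" "{x. Suc (2 * x) \<in> S}" f g]
      by (intro bexI[of _ "({x. 2 * x \<in> S}, {x. Suc (2 * x) \<in> S})"]) simp_all
  qed (auto simp: par_eq_iff cuts_disj_union)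
  then show ?thesis
    by (simp add: sum.reindex_bij_betw[symmetric] sum.cartesian_product case_prod_unfold)
qed

lemma sum_cuts_graft:
  assumes v: "v \<in> verts g"
  shows "(\<Sum>S\<in>cuts (graft f g v). Q S) =
    (\<Sum>B\<in>cuts g. if v \<in> B then Q (par (verts f) B) else \<Sum>A\<in>cuts f. Q (par A B))"
proof -
  let ?I = "SIGMA B:cuts g. if v \<in> B then {verts f} else cuts f"
  have "bij_betw (\<lambda>(B, A). par A B) ?I (cuts (graft f g v))"
  proof (rule bij_betwI')
    fix S assume S: "S \<in> cuts (graft f g v)"
    show "\<exists>x\<in>?I. S = (case x of (B, A) \<Rightarrow> par A B)"
      using S par_surj[of S] cuts_graft[OF v, of "{x. 2 * x \<in> S}" "{x. Suc (2 * x) \<in> S}" f]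
      by (intro bexI[of _ "({x. Suc (2 * x) \<in> S}, {x. 2 * x \<in> S})"]) simp_all
  qed (auto simp: par_eq_iff cuts_graft[OF v] split: if_splits)
  then have "(\<Sum>S\<in>cuts (graft f g v). Q S) = (\<Sum>(B, A)\<in>?I. Q (par A B))"
    by (simp add: sum.reindex_bij_betw[symmetric] case_prod_unfold)
  also have "\<dots> = (\<Sum>B\<in>cuts g. \<Sum>A\<in>(if v \<in> B then {verts f} else cuts f). Q (par A B))"
    by (rule sum.Sigma[symmetric]) auto
  also have "\<dots> = (\<Sum>B\<in>cuts g. if v \<in> B then Q (par (verts f) B) else \<Sum>A\<in>cuts f. Q (par A B))"
    by (rule sum.cong) auto
  finally show ?thesis .
qed

subsection \<open>Isomorphisms\<close>

definition join :: "(nat \<Rightarrow> 'b) \<Rightarrow> (nat \<Rightarrow> 'b) \<Rightarrow> nat \<Rightarrow> 'b" where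
  "join a b n = (if even n then a (n div 2) else b (n div 2))"

lemma join_simps [simp]: "join a b (2 * x) = a x" "join a b (Suc (2 * x)) = b x"
  by (simp_all add: join_def)

lemma par_ball: "(\<forall>x\<in>par A B. P x) \<longleftrightarrow> (\<forall>x\<in>A. P (2 * x)) \<and> (\<forall>x\<in>B. P (Suc (2 * x)))"
  by (auto simp: par_def)

lemma graft_isoI:
  assumes "inj_on a (verts f)" "inj_on b (verts g)" "a ` verts f \<inter> b ` verts g = {}"
    "verts k = a ` verts f \<union> b ` verts g"
    "\<And>x y. x \<in> verts f \<Longrightarrow> y \<in> verts f \<Longrightarrow> (a x, a y) \<in> edges k \<longleftrightarrow> (x, y) \<in> edges f"
    "\<And>x y. x \<in> verts g \<Longrightarrow> y \<in> verts g \<Longrightarrow> (b x, b y) \<in> edges k \<longleftrightarrow> (x, y) \<in> edges g"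
    "\<And>x y. x \<in> verts f \<Longrightarrow> y \<in> verts g \<Longrightarrow> (a x, b y) \<notin> edges k"
    "\<And>x y. x \<in> verts f \<Longrightarrow> y \<in> verts g \<Longrightarrow>
       (b y, a x) \<in> edges k \<longleftrightarrow> y = v \<and> (\<forall>p. (p, x) \<notin> edges f)"
    "\<And>x. x \<in> verts f \<Longrightarrow> dec k (a x) = dec f x" "\<And>x. x \<in> verts g \<Longrightarrow> dec k (b x) = dec g x"
  shows "forest_iso (graft f g v) k"
  unfolding forest_iso_def
proof (intro exI[of _ "join a b"] conjI)
  have "inj_on (join a b) (par (verts f) (verts g))"
    unfolding inj_on_def par_ball using assms(1-3) by (auto simp: inj_on_def)
  moreover have "join a b ` par (verts f) (verts g) = verts k"
    unfolding assms(4) par_def image_Un image_image by simp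
  ultimately show "bij_betw (join a b) (verts (graft f g v)) (verts k)"
    by (simp add: bij_betw_def)
  show "\<forall>x\<in>verts (graft f g v). \<forall>y\<in>verts (graft f g v).
      (x, y) \<in> edges (graft f g v) \<longleftrightarrow> (join a b x, join a b y) \<in> edges k"
    unfolding verts_graft par_ball using assms(5-8) by auto
  show "\<forall>x\<in>verts (graft f g v). dec k (join a b x) = dec (graft f g v) x"
    unfolding verts_graft par_ball using assms(9,10) by auto
qed

lemma disj_union_isoI:
  assumes "inj_on a (verts f)" "inj_on b (verts g)" "a ` verts f \<inter> b ` verts g = {}"
    "verts k = a ` verts f \<union> b ` verts g"
    "\<And>x y. x \<in> verts f \<Longrightarrow> y \<in> verts f \<Longrightarrow> (a x, a y) \<in> edges k \<longleftrightarrow> (x, y) \<in> edges f"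
    "\<And>x y. x \<in> verts g \<Longrightarrow> y \<in> verts g \<Longrightarrow> (b x, b y) \<in> edges k \<longleftrightarrow> (x, y) \<in> edges g"
    "\<And>x y. x \<in> verts f \<Longrightarrow> y \<in> verts g \<Longrightarrow> (a x, b y) \<notin> edges k"
    "\<And>x y. x \<in> verts f \<Longrightarrow> y \<in> verts g \<Longrightarrow> (b y, a x) \<notin> edges k"
    "\<And>x. x \<in> verts f \<Longrightarrow> dec k (a x) = dec f x" "\<And>x. x \<in> verts g \<Longrightarrow> dec k (b x) = dec g x"
  shows "forest_iso (disj_union f g) k"
proof -
  \<comment> \<open>grafting onto a number that is not a vertex adds no edges\<close>
  obtain v where v: "v \<notin> verts g"
    using ex_new_if_finite[of "verts g"] by auto
  have "graft f g v = disj_union f g"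
    by (rule forest_eq_parity) (use v in auto)
  then show ?thesis
    using graft_isoI[of a f b g k v] assms v by auto
qed

lemma ck_disj_union_cong1: "forest_iso f f' \<Longrightarrow> ck (disj_union f g) = ck (disj_union f' g)"
proof (rule ck_iso)
  assume "forest_iso f f'"
  then obtain \<sigma> where s: "bij_betw \<sigma> (verts f) (verts f')"
    "\<forall>x\<in>verts f. \<forall>y\<in>verts f. (x, y) \<in> edges f \<longleftrightarrow> (\<sigma> x, \<sigma> y) \<in> edges f'"
    "\<forall>x\<in>verts f. dec f' (\<sigma> x) = dec f x" unfolding forest_iso_def by blast
  have im: "verts f' = \<sigma> ` verts f" "inj_on \<sigma> (verts f)" using s(1) by (auto simp: bij_betw_def)
  show "forest_iso (disj_union f g) (disj_union f' g)"
    by (rule disj_union_isoI[where a = "\<lambda>x. 2 * \<sigma> x" and b = "\<lambda>x. Suc (2 * x)"])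
      (use s(2,3) im in \<open>auto simp: inj_on_def par_def\<close>)
qed

lemma ck_disj_union_commute: "ck (disj_union f g) = ck (disj_union g f)"
  by (rule ck_iso, rule disj_union_isoI[where a = "\<lambda>x. Suc (2 * x)" and b = "\<lambda>x. 2 * x"])
    (auto simp: inj_on_def par_def)

lemma ck_disj_union_cong2: "forest_iso g g' \<Longrightarrow> ck (disj_union f g) = ck (disj_union f g')"
  using ck_disj_union_cong1[of g g' f] by (simp add: ck_disj_union_commute)

lemma ck_disj_union_assoc: "ck (disj_union (disj_union f g) h) = ck (disj_union f (disj_union g h))"
proof -
  define e d where "e = (\<lambda>x :: nat. 2 * x)" and "d = (\<lambda>x. Suc (2 * x))"
  have inj: "e x = e y \<longleftrightarrow> x = y" "d x = d y \<longleftrightarrow> x = y" "e x \<noteq> d y" "d x \<noteq> e y" for x y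
    by (auto simp: e_def d_def)
  have V: "verts (disj_union F G) = e ` verts F \<union> d ` verts G" for F G :: "'a forest"
    by (simp add: par_def e_def d_def)
  have E: "(e x, e y) \<in> edges (disj_union F G) \<longleftrightarrow> (x, y) \<in> edges F"
    "(d x, d y) \<in> edges (disj_union F G) \<longleftrightarrow> (x, y) \<in> edges G"
    "(e x, d y) \<notin> edges (disj_union F G)" "(d x, e y) \<notin> edges (disj_union F G)"
    "dec (disj_union F G) (e x) = dec F x" "dec (disj_union F G) (d x) = dec G x"
    for F G :: "'a forest" and x y by (simp_all add: e_def d_def)
  have J: "join a b (e x) = a x" "join a b (d x) = b x" for a b :: "nat \<Rightarrow> nat" and x
    by (simp_all add: e_def d_def)
  show ?thesis
    by (rule ck_iso, rule disj_union_isoI[where a = "join e (\<lambda>x. d (e x))" and b = "\<lambda>x. d (d x)"])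
      (auto simp: inj V E J inj_on_def image_Un image_image simp del: verts_disj_union)
qed

lemma ck_disj_union_empty: "ck (disj_union empty_forest g) = ck g"
  by (rule ck_iso, rule disj_union_isoI[where a = "\<lambda>x. x" and b = "\<lambda>x. x"]) auto

lemma ck_graft_empty: "v \<in> verts g \<Longrightarrow> ck (graft empty_forest g v) = ck g"
  by (rule ck_iso, rule graft_isoI[where a = "\<lambda>x. x" and b = "\<lambda>x. x"]) auto

lemma ck_graft_cong1: "forest_iso f f' \<Longrightarrow> v \<in> verts g \<Longrightarrow> ck (graft f g v) = ck (graft f' g v)"
proof (rule ck_iso)
  assume v: "v \<in> verts g" and "forest_iso f f'"
  then obtain \<sigma> where s: "bij_betw \<sigma> (verts f) (verts f')"
    "\<forall>x\<in>verts f. \<forall>y\<in>verts f. (x, y) \<in> edges f \<longleftrightarrow> (\<sigma> x, \<sigma> y) \<in> edges f'"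
    "\<forall>x\<in>verts f. dec f' (\<sigma> x) = dec f x" unfolding forest_iso_def by blast
  have root: "(\<forall>p. (p, \<sigma> x) \<notin> edges f') \<longleftrightarrow> (\<forall>p. (p, x) \<notin> edges f)" if "x \<in> verts f" for x
    using s(1,2) that edge_verts[of _ _ f] edge_verts[of _ _ f'] unfolding bij_betw_def
    by (metis image_iff)
  have im: "verts f' = \<sigma> ` verts f" "inj_on \<sigma> (verts f)" using s(1) by (auto simp: bij_betw_def)
  show "forest_iso (graft f g v) (graft f' g v)"
    by (rule graft_isoI[where a = "\<lambda>x. 2 * \<sigma> x" and b = "\<lambda>x. Suc (2 * x)"])
      (use s(2,3) im v root in \<open>auto simp: inj_on_def par_def\<close>)
qed

lemma ck_graft_cong2:
  assumes s: "bij_betw \<sigma> (verts g) (verts g')"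
    "\<forall>x\<in>verts g. \<forall>y\<in>verts g. (x, y) \<in> edges g \<longleftrightarrow> (\<sigma> x, \<sigma> y) \<in> edges g'"
    "\<forall>x\<in>verts g. dec g' (\<sigma> x) = dec g x" and v: "v \<in> verts g"
  shows "ck (graft f g v) = ck (graft f g' (\<sigma> v))"
proof (rule ck_iso)
  have v': "\<sigma> v \<in> verts g'" using s(1) v by (auto simp: bij_betw_def)
  have inj: "\<sigma> y = \<sigma> v \<longleftrightarrow> y = v" if "y \<in> verts g" for y
    using s(1) v that by (auto simp: bij_betw_def inj_on_def)
  have im: "verts g' = \<sigma> ` verts g" "inj_on \<sigma> (verts g)" using s(1) by (auto simp: bij_betw_def)
  show "forest_iso (graft f g v) (graft f g' (\<sigma> v))"
    by (rule graft_isoI[where a = "\<lambda>x. 2 * x" and b = "\<lambda>x. Suc (2 * \<sigma> x)"])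
      (use s(2,3) im v inj in \<open>auto simp: inj_on_def par_def\<close>)
qed

section \<open>The Connes-Kreimer bialgebra\<close>

lemma ck_lin_comp: "linear F \<Longrightarrow> F (ck_lin \<phi> h) = ck_lin (\<lambda>f. F (\<phi> f)) h"
  unfolding ck_lin_def by (rule lin_ext_comp)

lemma ck_lin_param [lin]: "(\<And>f. linear (\<lambda>x. \<phi> x f)) \<Longrightarrow> linear (\<lambda>x. ck_lin (\<phi> x) h)"
  unfolding ck_lin_def by (rule lin_ext_param)

lemma linear_abs_ck: "linear abs_ck"
  by (rule linearI) (simp_all add: plus_ck.abs_eq scaleR_ck.abs_eq)

lemma ck_eqI:
  assumes "linear F" "linear G" "\<And>f. F (ck f) = G (ck f)"
  shows "F h = G h"
proof -
  obtain x where h: "h = abs_ck x"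
    by (metis Quotient3_abs_rep[OF Quotient3_ck])
  have l: "linear (\<lambda>x. F (abs_ck x))" "linear (\<lambda>x. G (abs_ck x))"
    by (intro lin_comp[OF assms(1)] lin_comp[OF assms(2)] linear_abs_ck)+
  show ?thesis
    unfolding h using lin_ext_unique[OF l(1), of x] lin_ext_unique[OF l(2), of x] assms(3)
    by (simp add: ck_def)
qed

lemma ck_eqI2:
  assumes "bilinear F" "bilinear G" "\<And>f g. F (ck f) (ck g) = G (ck f) (ck g)"
  shows "F h k = G h k"
proof -
  have "F (ck f) k = G (ck f) k" for f
    by (rule ck_eqI[where h = k]) (use assms in \<open>auto simp: bilinear_def\<close>)
  then show ?thesis
    by (intro ck_eqI[where h = h and F = "\<lambda>h. F h k" and G = "\<lambda>h. G h k"])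
      (use assms in \<open>auto simp: bilinear_def\<close>)
qed

text \<open>Induction on the weight cannot be applied to elements directly, which need not be homogeneous; this is
  the form in which it serves to compare linear maps.\<close>

lemma ck_weight_induct:
  assumes "linear F" "linear G"
    and step: "\<And>f. (\<And>g. card (verts g) < card (verts f) \<Longrightarrow> F (ck g) = G (ck g)) \<Longrightarrow> F (ck f) = G (ck f)"
  shows "F h = G h"
proof (rule ck_eqI[OF assms(1,2)])
  fix f show "F (ck f) = G (ck f)"
    by (induction f rule: measure_induct_rule[where f = "\<lambda>f. card (verts f)"]) (rule step)
qed

lemma ck_span: "h \<in> span (range ck)"
proof -
  obtain x where h: "h = abs_ck x"
    by (metis Quotient3_abs_rep[OF Quotient3_ck])
  have "h = lin_ext ck x"
    unfolding h using lin_ext_unique[OF linear_abs_ck, of x] by (simp add: ck_def[abs_def])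
  also have "\<dots> \<in> span (range ck)"
    unfolding lin_ext_def by (intro span_sum span_scale span_base) simp
  finally show ?thesis .
qed

lemma ck_induct [case_names zero add]:
  assumes "P 0" "\<And>c f h. P h \<Longrightarrow> P (c *\<^sub>R ck f + h)"
  shows "P h"
  using ck_span[of h] by (induction rule: span_induct_alt) (use assms in auto)

lemma ck_compatI:
  assumes "\<And>f g. forest_iso f g \<Longrightarrow> \<phi> f = \<phi> g" "\<And>f v. v \<in> verts f \<Longrightarrow> linear (\<lambda>a. \<phi> (dec_upd f v a))"
  shows "ck_compat \<phi>"
  using assms by (auto simp: ck_compat_def)

lemma ck_compat_comp: "linear F \<Longrightarrow> ck_compat \<phi> \<Longrightarrow> ck_compat (\<lambda>f. F (\<phi> f))"
  unfolding ck_compat_def by (intro conjI allI impI ballI) (metis, rule lin_comp[of F], auto)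

lemma ck_compat_ck: "ck_compat ck"
  by (rule ck_compatI) (auto intro: ck_iso linear_ck_dec)

lemma forest_iso_card: "forest_iso f g \<Longrightarrow> card (verts f) = card (verts g)"
  by (auto simp: forest_iso_def bij_betw_same_card)

lemma ck_compat_weight:
  fixes c :: "nat \<Rightarrow> real"
  shows "ck_compat (\<lambda>f. c (card (verts f)) *\<^sub>R ck f)"
  by (rule ck_compatI) (simp_all add: forest_iso_card ck_iso linear_compose_scale_right linear_ck_dec)

lemma ck_lin2:
  fixes \<phi> :: "'u::real_vector forest \<Rightarrow> 'v::real_vector forest \<Rightarrow> 'c::real_vector"
  assumes "\<And>g. ck_compat (\<lambda>f. \<phi> f g)" "\<And>f. ck_compat (\<phi> f)"
  shows bilinear_ck_lin2: "bilinear (\<lambda>h k. ck_lin (\<lambda>f. ck_lin (\<phi> f) k) h)"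
    and ck_lin2_ck: "ck_lin (\<lambda>f. ck_lin (\<phi> f) (ck g)) (ck f) = \<phi> f g"
proof -
  have c: "ck_compat (\<lambda>f. ck_lin (\<phi> f) k)" for k
  proof (rule ck_compatI)
    fix f :: "'u forest" and v assume "v \<in> verts f"
    then show "linear (\<lambda>a. ck_lin (\<phi> (dec_upd f v a)) k)"
      using assms(1) unfolding ck_compat_def by (intro lin) blast
  next
    fix f g :: "'u forest" assume "forest_iso f g"
    then have "\<phi> f x = \<phi> g x" for x
      using assms(1)[of x] unfolding ck_compat_def by blast
    then have "\<phi> f = \<phi> g" by blast
    then show "ck_lin (\<phi> f) k = ck_lin (\<phi> g) k" by simp
  qed
  show "bilinear (\<lambda>h k. ck_lin (\<lambda>f. ck_lin (\<phi> f) k) h)"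
    by (intro bilinearI ck_lin_param linear_ck_lin c assms)
  show "ck_lin (\<lambda>f. ck_lin (\<phi> f) (ck g)) (ck f) = \<phi> f g"
    using c assms by (simp add: ck_lin_ck)
qed

subsection \<open>Product and counit\<close>

lemma bilinear_mult: "bilinear (ck_mult :: 'u::real_vector ck \<Rightarrow> _)"
  and mult_ck: "ck_mult (ck f) (ck g :: 'u ck) = ck (disj_union f g)"
proof -
  have 1: "ck_compat (\<lambda>f. ck (disj_union f g))" for g :: "'u forest"
    by (rule ck_compatI, erule ck_disj_union_cong1)
      (simp add: dec_upd_disj_union(1)[symmetric] linear_ck_dec)
  have 2: "ck_compat (\<lambda>g. ck (disj_union f g))" for f :: "'u forest"
    by (rule ck_compatI, erule ck_disj_union_cong2)
      (simp add: dec_upd_disj_union(2)[symmetric] linear_ck_dec)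
  show "bilinear (ck_mult :: 'u ck \<Rightarrow> _)" "ck_mult (ck f) (ck g :: 'u ck) = ck (disj_union f g)"
    unfolding ck_mult_def[abs_def]
    using bilinear_ck_lin2[of "\<lambda>f g. ck (disj_union f g)", OF 1 2]
      ck_lin2_ck[of "\<lambda>f g. ck (disj_union f g)", OF 1 2] by auto
qed

lemmas lin_mult [lin] = lin_bil1[OF bilinear_mult] lin_bil2[OF bilinear_mult]

lemma ck_empty: "verts f = {} \<Longrightarrow> ck f = ck_one"
  unfolding ck_one_def by (rule ck_iso) (auto simp: forest_iso_def intro!: exI[of _ id])

lemma mult_commute: "ck_mult h k = ck_mult k h"
  by (rule ck_eqI2[where F = ck_mult and G = "\<lambda>h k. ck_mult k h"])
    (intro bilinear_mult bilinearI lin | simp add: mult_ck ck_disj_union_commute)+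

lemma mult_one [simp]: "ck_mult ck_one h = h" "ck_mult h ck_one = h"
proof -
  show "ck_mult ck_one h = h"
    by (rule ck_eqI[where h = h], intro lin, intro lin)
      (simp add: ck_one_def mult_ck ck_disj_union_empty)
  then show "ck_mult h ck_one = h" by (simp add: mult_commute)
qed

lemma mult_assoc: "ck_mult (ck_mult x y) z = ck_mult x (ck_mult y z)"
proof (rule ck_eqI[where h = z])
  fix h
  show "ck_mult (ck_mult x y) (ck h) = ck_mult x (ck_mult y (ck h))"
    by (rule ck_eqI2[where h = x and k = y]) 
     ((intro bilinearI lin)+, simp add: mult_ck ck_disj_union_assoc)
qed (intro lin)+

lemma linear_ck_counit: "linear ck_counit"
  and ck_counit_ck [simp]: "ck_counit (ck f) = (if verts f = {} then 1 else 0)"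
  unfolding ck_counit_def by (rule linear_ck_lin ck_lin_ck, rule ck_compat_counit)+

lemmas lin_ck_counit [lin] = lin_comp[OF linear_ck_counit]

lemma ck_counit_one [simp]: "ck_counit ck_one = 1"
  by (simp add: ck_one_def)

lemma ck_counit_mult: "ck_counit (ck_mult x y) = ck_counit x * ck_counit y"
  by (rule ck_eqI2[where h = x and k = y])
    ((intro bilinearI lin)+, simp add: mult_ck)

lemma linear_red: "linear ck_red"
  unfolding ck_red_def[abs_def] by (intro lin)

lemma red_ck: "ck_red (ck f) = (if verts f = {} then 0 else ck f)"
  by (simp add: ck_red_def ck_empty)

lemma red_one [simp]: "ck_red ck_one = 0"
  by (simp add: ck_red_def)

subsection \<open>Sums over the coproduct\<close>

text \<open>The two factors of the coproduct that belong to a cut.\<close>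

abbreviation pruned :: "'u::real_vector forest \<Rightarrow> nat set \<Rightarrow> 'u ck" where
  "pruned f A \<equiv> ck (forest_restrict f A)"

abbreviation trunk :: "'u::real_vector forest \<Rightarrow> nat set \<Rightarrow> 'u ck" where
  "trunk f A \<equiv> ck (forest_restrict f (verts f - A))"

text \<open>Sweedler's \<open>\<Sum> B h' h''\<close>.  The sum is taken over a fixed representative of \<open>h\<close>, which makes it linear
  in \<open>B\<close> without any assumption; bilinearity of \<open>B\<close> is what makes it independent of the representative
  and thus computable on forests.\<close>

definition cosum :: "('u ck \<Rightarrow> 'u ck \<Rightarrow> 'c::real_vector) \<Rightarrow> 'u::real_vector ck \<Rightarrow> 'c" where
  "cosum B = ck_lin (\<lambda>f. \<Sum>A\<in>cuts f. B (pruned f A) (trunk f A))"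

lemma ck_cop_cosum: "ck_cop = cosum (\<lambda>a b. word [a, b])"
  by (simp add: ck_cop_def cosum_def forest_cop_def[abs_def])

lemma cosum:
  assumes "bilinear B"
  shows linear_cosum: "linear (cosum B)"
    and cosum_ck: "cosum B (ck f) =
      (\<Sum>A\<in>cuts f. B (pruned f A) (trunk f A))"
proof -
  have "ck_compat (\<lambda>f. pair_lin B (forest_cop f))"
    by (rule ck_compat_comp[OF linear_pair_lin[OF assms] ck_compat_cop])
  then have c: "ck_compat (\<lambda>f. \<Sum>A\<in>cuts f. B (pruned f A) (trunk f A))"
    by (simp add: forest_cop_def linear_sum[OF linear_pair_lin[OF assms]] assms)
  show "linear (cosum B)"
    "cosum B (ck f) = (\<Sum>A\<in>cuts f. B (pruned f A) (trunk f A))"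
    unfolding cosum_def using ck_lin[OF c] by auto
qed

lemma lin_cosum: "bilinear B \<Longrightarrow> linear g \<Longrightarrow> linear (\<lambda>x. cosum B (g x))"
  by (rule lin_comp[OF linear_cosum])

lemma cosum_param [lin]: "(\<And>a b. linear (\<lambda>x. B x a b)) \<Longrightarrow> linear (\<lambda>x. cosum (B x) h)"
  unfolding cosum_def by (intro lin)

lemma cosum_comp: "linear F \<Longrightarrow> F (cosum B h) = cosum (\<lambda>a b. F (B a b)) h"
  unfolding cosum_def by (simp add: ck_lin_comp linear_sum)

lemma cosum_add: "cosum (\<lambda>a b. B a b + C a b) h = cosum B h + cosum C h"
  and cosum_diff: "cosum (\<lambda>a b. B a b - C a b) h = cosum B h - cosum C h"
  and cosum_scaleR: "cosum (\<lambda>a b. r *\<^sub>R B a b) h = r *\<^sub>R cosum B h"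
  and cosum_zero: "cosum (\<lambda>a b. 0) h = 0"
  unfolding cosum_def ck_lin_def lin_ext_def
  by (simp_all add: sum.distrib scaleR_add_right sum_subtractf scaleR_diff_right scaleR_sum_right
      algebra_simps)

lemma cosum_sum: "cosum (\<lambda>a b. \<Sum>i\<in>I. B i a b) h = (\<Sum>i\<in>I. cosum (B i) h)"
  by (induction I rule: infinite_finite_induct) (simp_all add: cosum_add cosum_zero)

lemma bilinear_word: "bilinear (\<lambda>a b. word [a, b])"
  by (intro bilinearI lin)

lemma linear_ck_cop: "linear ck_cop"
  unfolding ck_cop_cosum by (rule linear_cosum[OF bilinear_word])

lemmas lin_ck_cop [lin] = lin_comp[OF linear_ck_cop]

lemma cosum_pair_lin: "bilinear B \<Longrightarrow> cosum B h = pair_lin B (ck_cop h)"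
  unfolding ck_cop_cosum by (simp add: cosum_comp[OF linear_pair_lin])

lemma cosum_one:
  assumes "bilinear B"
  shows "cosum B ck_one = B ck_one ck_one"
proof -
  have "cuts (empty_forest :: 'a forest) = {{}}" by (auto simp: cuts_def)
  then show ?thesis using cosum_ck[OF assms, of empty_forest] by (simp add: ck_empty)
qed

definition proper_cuts :: "'u forest \<Rightarrow> nat set set" where
  "proper_cuts f = cuts f - {{}, verts f}"

lemma cosum_proper:
  assumes "bilinear B" "verts f \<noteq> {}"
  shows "cosum B (ck f) = B ck_one (ck f) + B (ck f) ck_one +
    (\<Sum>A\<in>proper_cuts f. B (pruned f A) (trunk f A))"
proof -
  have "cuts f = insert {} (insert (verts f) (proper_cuts f))"
    unfolding proper_cuts_def using cuts_trivial[of f] by blast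
  moreover have "finite (proper_cuts f)" "{} \<notin> insert (verts f) (proper_cuts f)"
    "verts f \<notin> proper_cuts f" using assms(2) by (auto simp: proper_cuts_def)
  ultimately show ?thesis
    unfolding cosum_ck[OF assms(1)] by (simp add: ck_empty add.assoc)
qed

lemma proper_cut_card:
  assumes "A \<in> proper_cuts f"
  shows "card (verts (forest_restrict f A)) < card (verts f)"
    "card (verts (forest_restrict f (verts f - A))) < card (verts f)"
    "verts (forest_restrict f A) \<noteq> {}" "verts (forest_restrict f (verts f - A)) \<noteq> {}"
proof -
  have A: "A \<subseteq> verts f" "A \<noteq> {}" "A \<noteq> verts f"
    using assms cut_subset[of A f] by (auto simp: proper_cuts_def)
  then show "card (verts (forest_restrict f A)) < card (verts f)"
    "card (verts (forest_restrict f (verts f - A))) < card (verts f)"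
    by (auto intro!: psubset_card_mono)
  show "verts (forest_restrict f A) \<noteq> {}" "verts (forest_restrict f (verts f - A)) \<noteq> {}"
    using A by auto
qed

lemma cosum_counit:
  assumes "linear F"
  shows "cosum (\<lambda>a b. ck_counit a *\<^sub>R F b) h = F h" "cosum (\<lambda>a b. ck_counit b *\<^sub>R F a) h = F h"
proof -
  have b: "bilinear (\<lambda>a b. ck_counit a *\<^sub>R F b)" "bilinear (\<lambda>a b. ck_counit b *\<^sub>R F a)"
    by (intro bilinearI lin lin_comp[OF assms])+
  show "cosum (\<lambda>a b. ck_counit a *\<^sub>R F b) h = F h"
  proof (rule ck_eqI[OF linear_cosum[OF b(1)] assms])
    fix f
    show "cosum (\<lambda>a b. ck_counit a *\<^sub>R F b) (ck f) = F (ck f)"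
    proof (cases "verts f = {}")
      case True
      then show ?thesis using cosum_one[OF b(1)] by (simp add: ck_empty)
    next
      case False
      then show ?thesis unfolding cosum_proper[OF b(1) False]
        using proper_cut_card[of _ f] by (simp add: linear_0[OF assms])
    qed
  qed
  show "cosum (\<lambda>a b. ck_counit b *\<^sub>R F a) h = F h"
  proof (rule ck_eqI[OF linear_cosum[OF b(2)] assms])
    fix f
    show "cosum (\<lambda>a b. ck_counit b *\<^sub>R F a) (ck f) = F (ck f)"
    proof (cases "verts f = {}")
      case True
      then show ?thesis using cosum_one[OF b(2)] by (simp add: ck_empty)
    next
      case False
      then show ?thesis unfolding cosum_proper[OF b(2) False]
        using proper_cut_card[of _ f] by (simp add: linear_0[OF assms])
    qed
  qed
qed

lemma cuts_restrict:
  assumes "A \<in> cuts f"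
  shows "cuts (forest_restrict f A) = {A' \<in> cuts f. A' \<subseteq> A}"
    "cuts (forest_restrict f (verts f - A)) = {B. B \<subseteq> verts f - A \<and> A \<union> B \<in> cuts f}"
proof -
  have A: "A \<subseteq> verts f" "\<And>x y. x \<in> A \<Longrightarrow> (x, y) \<in> edges f \<Longrightarrow> y \<in> A"
    using assms unfolding cuts_def by blast+
  have e: "\<And>x y. (x, y) \<in> edges f \<Longrightarrow> x \<in> verts f \<and> y \<in> verts f"
    by (rule edge_verts)
  show "cuts (forest_restrict f A) = {A' \<in> cuts f. A' \<subseteq> A}"
    unfolding cuts_def forest_sel_simps set_eq_iff mem_Collect_eq using A by blast
  show "cuts (forest_restrict f (verts f - A)) = {B. B \<subseteq> verts f - A \<and> A \<union> B \<in> cuts f}"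
    unfolding cuts_def forest_sel_simps set_eq_iff mem_Collect_eq using A e by blast
qed

text \<open>On a forest, both sides run over the pairs of nested cuts \<open>A' \<subseteq> A\<close>.  On the left such a pair is given by
  \<open>A\<close> and then \<open>A'\<close>, and on the right by \<open>A'\<close> and then the cut \<open>A - A'\<close> of the trunk.\<close>

lemma cosum_coassoc:
  assumes T: "\<And>y z. linear (\<lambda>x. T x y z)" "\<And>x z. linear (\<lambda>y. T x y z)" "\<And>x y. linear (T x y)"
  shows "cosum (\<lambda>a c. cosum (\<lambda>x y. T x y c) a) h = cosum (\<lambda>a c. cosum (\<lambda>y z. T a y z) c) h"
proof -
  have b: "bilinear (\<lambda>x y. T x y c)" "bilinear (\<lambda>y z. T c y z)" for c
    by (intro bilinearI T)+
  have B: "bilinear (\<lambda>a c. cosum (\<lambda>x y. T x y c) a)" "bilinear (\<lambda>a c. cosum (\<lambda>y z. T a y z) c)"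
    by (intro bilinearI linear_cosum b cosum_param T)+
  show ?thesis
  proof (rule ck_eqI[OF linear_cosum[OF B(1)] linear_cosum[OF B(2)]])
    fix f :: "'a forest"
    define r where "r A = ck (forest_restrict f A)" for A
    let ?V = "verts f"
    have "cosum (\<lambda>a c. cosum (\<lambda>x y. T x y c) a) (ck f) =
        (\<Sum>A\<in>cuts f. \<Sum>A'\<in>{A'\<in>cuts f. A' \<subseteq> A}. T (r A') (r (A - A')) (r (?V - A)))"
      unfolding cosum_ck[OF B(1)] cosum_ck[OF b(1)]
    proof (intro sum.cong cuts_restrict(1) refl)
      fix A A' assume "A \<in> cuts f" "A' \<in> {A' \<in> cuts f. A' \<subseteq> A}"
      then have "A \<inter> A' = A'" "A \<inter> (?V \<inter> A - A') = A - A'" using cut_subset[of A f] by auto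
      then show "T (ck (forest_restrict (forest_restrict f A) A'))
          (ck (forest_restrict (forest_restrict f A) (verts (forest_restrict f A) - A')))
          (ck (forest_restrict f (?V - A))) = T (r A') (r (A - A')) (r (?V - A))"
        by (simp add: r_def restrict_restrict)
    qed
    also have "\<dots> = (\<Sum>(A, A')\<in>(SIGMA A:cuts f. {A'\<in>cuts f. A' \<subseteq> A}). T (r A') (r (A - A')) (r (?V - A)))"
      by (rule sum.Sigma) auto
    also have "\<dots> = (\<Sum>(A, B)\<in>(SIGMA A:cuts f. {B. B \<subseteq> ?V - A \<and> A \<union> B \<in> cuts f}).
        T (r A) (r B) (r (?V - A - B)))"
    proof (rule sum.reindex_bij_witness[where i = "\<lambda>(A, B). (A \<union> B, A)" and j = "\<lambda>(A, A'). (A', A - A')"])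
      fix x assume x: "x \<in> (SIGMA A:cuts f. {A'\<in>cuts f. A' \<subseteq> A})"
      obtain A A' where xA: "x = (A, A')" by (cases x)
      have A: "A \<in> cuts f" "A' \<in> cuts f" "A' \<subseteq> A" using x xA by auto
      then have e: "A' \<union> A = A" "?V - A' - (A - A') = ?V - A" "A \<subseteq> ?V"
        using cut_subset[of A f] by auto
      show "(case case x of (A, A') \<Rightarrow> (A', A - A') of (A, B) \<Rightarrow> (A \<union> B, A)) = x"
        "(case x of (A, A') \<Rightarrow> (A', A - A')) \<in> (SIGMA A:cuts f. {B. B \<subseteq> ?V - A \<and> A \<union> B \<in> cuts f})"
        "(case case x of (A, A') \<Rightarrow> (A', A - A') of (A, B) \<Rightarrow> T (r A) (r B) (r (?V - A - B))) =
          (case x of (A, A') \<Rightarrow> T (r A') (r (A - A')) (r (?V - A)))"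
        using A e by (auto simp: xA)
    next
      fix x assume x: "x \<in> (SIGMA A:cuts f. {B. B \<subseteq> ?V - A \<and> A \<union> B \<in> cuts f})"
      then show "(case case x of (A, B) \<Rightarrow> (A \<union> B, A) of (A, A') \<Rightarrow> (A', A - A')) = x"
        "(case x of (A, B) \<Rightarrow> (A \<union> B, A)) \<in> (SIGMA A:cuts f. {A'\<in>cuts f. A' \<subseteq> A})" by auto
    qed
    also have "\<dots> = (\<Sum>A\<in>cuts f. \<Sum>B\<in>{B. B \<subseteq> ?V - A \<and> A \<union> B \<in> cuts f}. T (r A) (r B) (r (?V - A - B)))"
      by (rule sum.Sigma[symmetric]) (auto intro: finite_subset[of _ "Pow ?V"])
    also have "\<dots> = cosum (\<lambda>a c. cosum (\<lambda>y z. T a y z) c) (ck f)"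
      unfolding cosum_ck[OF B(2)] cosum_ck[OF b(2)]
    proof (intro sum.cong cuts_restrict(2)[symmetric] refl)
      fix A B assume "A \<in> cuts f" "B \<in> cuts (forest_restrict f (?V - A))"
      then have "(?V - A) \<inter> B = B" "(?V - A) \<inter> (?V \<inter> (?V - A) - B) = ?V - A - B"
        by (auto simp: cuts_restrict(2))
      then show "T (r A) (r B) (r (?V - A - B)) = T (pruned f A)
          (ck (forest_restrict (forest_restrict f (?V - A)) B))
          (ck (forest_restrict (forest_restrict f (?V - A)) (verts (forest_restrict f (?V - A)) - B)))"
        by (simp add: r_def restrict_restrict)
    qed
    finally show "cosum (\<lambda>a c. cosum (\<lambda>x y. T x y c) a) (ck f) = cosum (\<lambda>a c. cosum (\<lambda>y z. T a y z) c) (ck f)" .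
  qed
qed

lemma par_diff: "par A B - par A' B' = par (A - A') (B - B')"
  by (auto simp: par_def)

lemma cosum_mult:
  assumes B: "bilinear B"
  shows "cosum B (ck_mult h k) = cosum (\<lambda>a b. cosum (\<lambda>c d. B (ck_mult a c) (ck_mult b d)) k) h"
proof (rule ck_eqI2[where h = h and k = k])
  note l = lin lin_bil1[OF B] lin_bil2[OF B]
  have b: "bilinear (\<lambda>c d. B (ck_mult a c) (ck_mult b d))" for a b
    by (intro bilinearI l)
  have b': "bilinear (\<lambda>a b. cosum (\<lambda>c d. B (ck_mult a c) (ck_mult b d)) k)" for k
    by (intro bilinearI l)
  show "bilinear (\<lambda>h k. cosum B (ck_mult h k))" by (intro bilinearI l lin_cosum B)
  show "bilinear (\<lambda>h k. cosum (\<lambda>a b. cosum (\<lambda>c d. B (ck_mult a c) (ck_mult b d)) k) h)"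
    by (intro bilinearI cosum_param linear_cosum b b')
  fix f g
  show "cosum B (ck_mult (ck f) (ck g)) = cosum (\<lambda>a b. cosum (\<lambda>c d. B (ck_mult a c) (ck_mult b d)) (ck g)) (ck f)"
    by (simp only: mult_ck cosum_ck[OF B] cosum_ck[OF b'])
      (simp add: mult_ck cosum_ck[OF b] sum_cuts_disj_union
        restrict_disj_union par_diff)
qed

subsection \<open>Change of decorations\<close>

lemma ck_compat_map:
  assumes "linear \<theta>"
  shows "ck_compat (\<lambda>f. ck (map_dec \<theta> f))"
proof (rule ck_compatI)
  fix f g :: "'a forest" assume "forest_iso f g"
  then show "ck (map_dec \<theta> f) = ck (map_dec \<theta> g)"
    by (intro ck_iso) (auto simp: forest_iso_def)
next
  fix f :: "'a forest" and v assume "v \<in> verts f"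
  then show "linear (\<lambda>a. ck (map_dec \<theta> (dec_upd f v a)))"
    unfolding map_dec_dec_upd by (intro lin_comp[OF linear_ck_dec] assms) auto
qed

lemma linear_ck_map: "linear \<theta> \<Longrightarrow> linear (ck_map \<theta>)"
  and ck_map_ck: "linear \<theta> \<Longrightarrow> ck_map \<theta> (ck f) = ck (map_dec \<theta> f)"
  unfolding ck_map_def by (rule linear_ck_lin ck_lin_ck, erule ck_compat_map)+

lemma ck_map_one: "linear \<theta> \<Longrightarrow> ck_map \<theta> ck_one = ck_one"
  by (simp add: ck_one_def ck_map_ck) (simp add: ck_empty ck_one_def[symmetric])

lemma ck_counit_map: "linear \<theta> \<Longrightarrow> ck_counit (ck_map \<theta> h) = ck_counit h"
  by (rule ck_eqI[where h = h])
    (simp_all add: ck_map_ck linear_ck_counit lin_comp[OF linear_ck_counit linear_ck_map])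

lemma ck_map_mult:
  assumes "linear \<theta>"
  shows "ck_map \<theta> (ck_mult h k) = ck_mult (ck_map \<theta> h) (ck_map \<theta> k)"
  by (rule ck_eqI2[where h = h and k = k])
    ((intro bilinearI lin lin_comp[OF linear_ck_map[OF assms]])+,
      simp add: mult_ck ck_map_ck assms map_dec_disj_union)

lemma cuts_map_dec [simp]: "cuts (map_dec \<theta> f) = cuts f"
  by (simp add: cuts_def)

lemma cosum_map:
  assumes "linear \<theta>" "bilinear B"
  shows "cosum B (ck_map \<theta> h) = cosum (\<lambda>a b. B (ck_map \<theta> a) (ck_map \<theta> b)) h"
proof -
  have b: "bilinear (\<lambda>a b. B (ck_map \<theta> a) (ck_map \<theta> b))"
    by (intro bilinearI lin_bil1[OF assms(2)] lin_bil2[OF assms(2)] linear_ck_map assms)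
  show ?thesis
    by (rule ck_eqI[where h = h], intro lin_cosum assms linear_ck_map, intro linear_cosum b)
      (simp add: ck_map_ck assms cosum_ck[OF assms(2)] cosum_ck[OF b] map_dec_restrict)
qed

subsection \<open>The grading by weight\<close>

text \<open>Homogeneous components are unique as soon as there are linear projections that read them off.\<close>

lemma vec_gradingI:
  fixes G :: "nat \<Rightarrow> 'a::real_vector set"
  assumes G: "\<And>n. subspace (G n)" and p: "\<And>n. linear (p n)" "\<And>n x. p n x \<in> G n"
    and p_id: "\<And>n x. x \<in> G n \<Longrightarrow> p n x = x" and p_0: "\<And>m n x. x \<in> G n \<Longrightarrow> m \<noteq> n \<Longrightarrow> p m x = 0"
    and sum: "\<And>x. \<exists>M. x = (\<Sum>n\<le>M. p n x) \<and> (\<forall>n>M. p n x = 0)"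
  shows "vec_grading G"
  unfolding vec_grading_def
proof (intro conjI allI G)
  fix x
  obtain M where M: "x = (\<Sum>n\<le>M. p n x)" "\<And>n. n > M \<Longrightarrow> p n x = 0" using sum by blast
  have sub: "{n. p n x \<noteq> 0} \<subseteq> {..M}" using M(2) by (auto simp: not_less[symmetric])
  show "\<exists>!c. (\<forall>n. c n \<in> G n) \<and> finite {n. c n \<noteq> 0} \<and> x = Sum_any c"
  proof (rule ex1I[of _ "\<lambda>n. p n x"])
    show "(\<forall>n. p n x \<in> G n) \<and> finite {n. p n x \<noteq> 0} \<and> x = Sum_any (\<lambda>n. p n x)"
      using p(2) M finite_subset[OF sub] Sum_any.expand_superset[OF _ sub] by auto
    fix c assume c: "(\<forall>n. c n \<in> G n) \<and> finite {n. c n \<noteq> 0} \<and> x = Sum_any c"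
    have "p n x = c n" for n
    proof -
      have "p n x = (\<Sum>m\<in>insert n {m. c m \<noteq> 0}. p n (c m))"
        using c Sum_any.expand_superset[of "insert n {m. c m \<noteq> 0}" c]
        by (simp add: linear_sum[OF p(1)] subset_insertI del: sum.insert)
      also have "\<dots> = (\<Sum>m\<in>insert n {m. c m \<noteq> 0}. if m = n then c n else 0)"
      proof (rule sum.cong[OF refl])
        fix m
        show "p n (c m) = (if m = n then c n else 0)"
          using c p_id[of "c m" m] p_0[of "c m" m n] by auto
      qed
      also have "\<dots> = c n" using c by simp
      finally show ?thesis .
    qed
    then show "c = (\<lambda>n. p n x)" by auto
  qed
qed

text \<open>Besides the projections onto the homogeneous parts, this includes the division by the weight that occurs
  in natural growth.\<close>

definition ck_scale :: "(nat \<Rightarrow> real) \<Rightarrow> 'u::real_vector ck \<Rightarrow> 'u ck" where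
  "ck_scale c = ck_lin (\<lambda>f. c (card (verts f)) *\<^sub>R ck f)"

abbreviation ck_proj :: "nat \<Rightarrow> 'u::real_vector ck \<Rightarrow> 'u ck" where
  "ck_proj n \<equiv> ck_scale (\<lambda>m. if m = n then 1 else 0)"

lemma linear_ck_scale: "linear (ck_scale c)"
  and ck_scale_ck: "ck_scale c (ck f) = c (card (verts f)) *\<^sub>R ck f"
  unfolding ck_scale_def by (rule linear_ck_lin ck_lin_ck, rule ck_compat_weight)+

lemmas lin_ck_scale [lin] = lin_comp[OF linear_ck_scale]

lemma ck_proj_deg: "ck_proj n h \<in> ck_deg n"
proof (induction h rule: ck_induct)
  case zero
  show ?case by (simp add: linear_0[OF linear_ck_scale] ck_deg_def span_zero)
next
  case (add c f h)
  have "ck_proj n (ck f) \<in> ck_deg n"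
    unfolding ck_scale_ck ck_deg_def by (auto intro: span_base span_zero)
  then show ?case
    using add by (simp add: linear_add[OF linear_ck_scale] linear_cmul[OF linear_ck_scale]
        ck_deg_def span_add span_scale)
qed

lemma ck_deg_induct [consumes 1, case_names zero add]:
  assumes "h \<in> ck_deg n" "P 0"
    "\<And>c f h. card (verts f) = n \<Longrightarrow> h \<in> ck_deg n \<Longrightarrow> P h \<Longrightarrow> P (c *\<^sub>R ck f + h)"
  shows "P h"
proof -
  have "h \<in> ck_deg n \<and> P h"
    using assms(1)[unfolded ck_deg_def]
  proof (induction rule: span_induct_alt)
    case base
    show ?case using assms(2) by (simp add: ck_deg_def span_zero)
  next
    case (step c x y)
    then obtain f where f: "x = ck f" "card (verts f) = n" by blast
    then have "ck f \<in> ck_deg n" unfolding ck_deg_def by (intro span_base) blast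
    then show ?case using step f assms(3)[of f y c] unfolding ck_deg_def
      by (simp add: span_add span_scale)
  qed
  then show ?thesis ..
qed

lemma ck_proj_on_deg: "h \<in> ck_deg n \<Longrightarrow> ck_proj m h = (if m = n then h else 0)"
  by (induction rule: ck_deg_induct)
    (simp_all add: linear_0[OF linear_ck_scale] linear_add[OF linear_ck_scale]
      linear_cmul[OF linear_ck_scale] ck_scale_ck)

lemma ck_scale_expand:
  "\<exists>M. (\<forall>c. ck_scale c h = (\<Sum>n\<le>M. c n *\<^sub>R ck_proj n h)) \<and> (\<forall>n>M. ck_proj n h = 0)"
proof -
  have "\<exists>M. \<forall>N\<ge>M. (\<forall>c. ck_scale c h = (\<Sum>n\<le>N. c n *\<^sub>R ck_proj n h)) \<and> (\<forall>n>N. ck_proj n h = 0)"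
  proof (induction h rule: ck_induct)
    case zero
    show ?case by (simp add: linear_0[OF linear_ck_scale])
  next
    case (add r f h)
    then obtain M where M: "\<And>N c. N \<ge> M \<Longrightarrow> ck_scale c h = (\<Sum>n\<le>N. c n *\<^sub>R ck_proj n h)"
      "\<And>N n. N \<ge> M \<Longrightarrow> n > N \<Longrightarrow> ck_proj n h = 0" by blast
    have f: "ck_scale c (ck f) = (\<Sum>n\<le>N. c n *\<^sub>R ck_proj n (ck f))" if "N \<ge> card (verts f)" for N c
      using that by (simp add: ck_scale_ck if_distrib[of "\<lambda>z. z *\<^sub>R _"]
          if_distrib[of "\<lambda>z. _ *\<^sub>R z"] cong: if_cong)
    have f0: "ck_proj n (ck f) = 0" if "n > card (verts f)" for n
      using that by (simp add: ck_scale_ck)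
    show ?case
    proof (intro exI[of _ "max M (card (verts f))"] allI impI conjI)
      fix N c assume N: "max M (card (verts f)) \<le> N"
      have "ck_scale c (r *\<^sub>R ck f + h) =
          r *\<^sub>R (\<Sum>n\<le>N. c n *\<^sub>R ck_proj n (ck f)) + (\<Sum>n\<le>N. c n *\<^sub>R ck_proj n h)"
        using N M(1)[of N c] f[of N c]
        by (simp add: linear_add[OF linear_ck_scale] linear_cmul[OF linear_ck_scale])
      also have "\<dots> = (\<Sum>n\<le>N. c n *\<^sub>R ck_proj n (r *\<^sub>R ck f + h))"
        by (simp add: linear_add[OF linear_ck_scale] linear_cmul[OF linear_ck_scale]
            scaleR_sum_right scaleR_add_right sum.distrib mult.commute)
      finally show "ck_scale c (r *\<^sub>R ck f + h) = (\<Sum>n\<le>N. c n *\<^sub>R ck_proj n (r *\<^sub>R ck f + h))" .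
    next
      fix N n assume "max M (card (verts f)) \<le> N" "N < n"
      then show "ck_proj n (r *\<^sub>R ck f + h) = 0"
        using M(2)[of N n] f0[of n] by (simp add: linear_add[OF linear_ck_scale] linear_cmul[OF linear_ck_scale])
    qed
  qed
  then show ?thesis by blast
qed

lemma ck_scale_one: "ck_scale (\<lambda>_. 1) h = h"
  by (rule ck_eqI[where h = h], intro lin, intro lin) (simp add: ck_scale_ck)

lemma ck_proj_sum: "\<exists>M. h = (\<Sum>n\<le>M. ck_proj n h) \<and> (\<forall>n>M. ck_proj n h = 0)"
  using ck_scale_expand[of h] ck_scale_one[of h] by (metis (no_types, lifting) scaleR_one sum.cong)

lemma vec_grading_ck: "vec_grading ck_deg"
  by (rule vec_gradingI[of _ ck_proj])
    (auto simp: ck_deg_def[symmetric] linear_ck_scale ck_proj_deg ck_proj_on_deg ck_proj_sum,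
      simp add: ck_deg_def)

lemma cosum_proj:
  assumes B: "bilinear B"
  shows "cosum B (ck_proj n h) = (\<Sum>i\<le>n. cosum (\<lambda>a b. B (ck_proj i a) (ck_proj (n - i) b)) h)"
proof -
  note l = lin lin_bil1[OF B] lin_bil2[OF B]
  have b: "bilinear (\<lambda>a b. B (ck_proj i a) (ck_proj j b))" for i j
    by (intro bilinearI l)
  show ?thesis
  proof (rule ck_eqI[where h = h])
    fix f :: "'a forest"
    have key: "(\<Sum>i\<le>n. B (ck_proj i (pruned f A))
          (ck_proj (n - i) (trunk f A))) =
        (if card (verts f) = n then B (pruned f A) (trunk f A) else 0)"
      if A: "A \<in> cuts f" for A
    proof -
      have A': "A \<subseteq> verts f" "verts f \<inter> A = A" "verts f \<inter> (verts f - A) = verts f - A"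
        using cut_subset[OF A] by auto
      have c: "card A \<le> card (verts f)" "card (verts f - A) = card (verts f) - card A"
        using A' finite_subset[OF A'(1)] by (simp_all add: card_mono card_Diff_subset)
      have "(\<Sum>i\<le>n. B (ck_proj i (pruned f A))
          (ck_proj (n - i) (trunk f A))) =
        (\<Sum>i\<le>n. if i = card A \<and> card (verts f) = n
          then B (pruned f A) (trunk f A) else 0)"
      proof (rule sum.cong[OF refl])
        fix i assume "i \<in> {..n}"
        then show "B (ck_proj i (pruned f A))
            (ck_proj (n - i) (trunk f A)) =
            (if i = card A \<and> card (verts f) = n
              then B (pruned f A) (trunk f A) else 0)"
          using c bilinear_lzero[OF B] bilinear_rzero[OF B] A' by (auto simp: ck_scale_ck)
      qed
      also have "\<dots> = (if card (verts f) = n then B (pruned f A) (trunk f A) else 0)"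
        using c by auto
      finally show ?thesis .
    qed
    have "(\<Sum>i\<le>n. cosum (\<lambda>a b. B (ck_proj i a) (ck_proj (n - i) b)) (ck f)) =
        (\<Sum>A\<in>cuts f. \<Sum>i\<le>n. B (ck_proj i (pruned f A))
          (ck_proj (n - i) (trunk f A)))"
      by (subst sum.swap) (simp only: cosum_ck[OF b])
    also have "\<dots> = (\<Sum>A\<in>cuts f. if card (verts f) = n
        then B (pruned f A) (trunk f A) else 0)"
      by (rule sum.cong[OF refl key])
    finally show "cosum B (ck_proj n (ck f)) = (\<Sum>i\<le>n. cosum (\<lambda>a b. B (ck_proj i a) (ck_proj (n - i) b)) (ck f))"
      by (simp add: ck_scale_ck cosum_ck[OF B] linear_0[OF linear_cosum[OF B]])
  qed (intro l lin_cosum B linear_cosum b)+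
qed

subsection \<open>Locally finite sums\<close>

text \<open>Series of linear maps of which only the terms up to the weight matter on each forest.  Their pointwise
  sum is again a linear map.\<close>

definition locfin :: "(nat \<Rightarrow> 'u::real_vector ck \<Rightarrow> 'c::real_vector) \<Rightarrow> bool" where
  "locfin X \<longleftrightarrow> (\<forall>n. linear (X n)) \<and> (\<forall>f n. card (verts f) < n \<longrightarrow> X n (ck f) = 0)"

definition total :: "(nat \<Rightarrow> 'u::real_vector ck \<Rightarrow> 'c::real_vector) \<Rightarrow> 'u ck \<Rightarrow> 'c" where
  "total X h = Sum_any (\<lambda>n. X n h)"

lemma locfin_finite:
  assumes "locfin X"
  shows "finite {n. X n h \<noteq> 0}"
proof (induction h rule: ck_induct)
  case zero
  show ?case using assms by (simp add: locfin_def linear_0)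
next
  case (add c f h)
  have "{n. X n (c *\<^sub>R ck f + h) \<noteq> 0} \<subseteq> {..card (verts f)} \<union> {n. X n h \<noteq> 0}"
    using assms by (auto simp: locfin_def linear_add linear_cmul not_less[symmetric])
  then show ?case using add by (meson finite_UnI finite_atMost finite_subset)
qed

lemma total_superset:
  assumes "finite K" "\<And>n. n \<notin> K \<Longrightarrow> X n h = 0"
  shows "total X h = (\<Sum>n\<in>K. X n h)"
  unfolding total_def using assms by (intro Sum_any.expand_superset) auto

lemma total_ck: "locfin X \<Longrightarrow> card (verts f) \<le> N \<Longrightarrow> total X (ck f) = (\<Sum>n\<le>N. X n (ck f))"
  by (rule total_superset) (auto simp: locfin_def)

lemma linear_total:
  assumes "locfin X"
  shows "linear (total X)"
proof (rule linearI)
  have lin: "linear (X n)" for n using assms by (simp add: locfin_def)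
  fix h k c
  let ?K = "{n. X n h \<noteq> 0} \<union> {n. X n k \<noteq> 0}"
  have f: "finite ?K" using locfin_finite[OF assms] by simp
  have "total X (h + k) = (\<Sum>n\<in>?K. X n (h + k))" "total X h = (\<Sum>n\<in>?K. X n h)"
    "total X k = (\<Sum>n\<in>?K. X n k)" "total X (c *\<^sub>R h) = (\<Sum>n\<in>?K. X n (c *\<^sub>R h))"
    by (rule total_superset[OF f]; simp add: linear_add[OF lin] linear_cmul[OF lin])+
  then show "total X (h + k) = total X h + total X k" "total X (c *\<^sub>R h) = c *\<^sub>R total X h"
    by (simp_all add: linear_add[OF lin] linear_cmul[OF lin] sum.distrib scaleR_sum_right)
qed

lemma card_restrict_le: "card (verts (forest_restrict f A)) \<le> card (verts f)"
  by (simp add: card_mono)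

text \<open>In Sweedler's notation \<open>h \<mapsto> \<Sum> m (\<dots> (m u (\<psi> h\<^sub>1)) \<dots>) (\<psi> h\<^sub>n)\<close>.  The iterated reduced coproducts, the
  convolution powers of the identity with or without its unit part, the lifts to the tensor coalgebra
  and the antipode are all made of such maps.\<close>

primrec coiter :: "('c \<Rightarrow> 'd \<Rightarrow> 'c) \<Rightarrow> 'c \<Rightarrow> ('u ck \<Rightarrow> 'd) \<Rightarrow> nat \<Rightarrow> 'u::real_vector ck \<Rightarrow> 'c::real_vector" where
  "coiter m u \<psi> 0 = (\<lambda>h. ck_counit h *\<^sub>R u)"
| "coiter m u \<psi> (Suc n) = cosum (\<lambda>a b. m (coiter m u \<psi> n a) (\<psi> b))"

context
  fixes m :: "'c::real_vector \<Rightarrow> 'd::real_vector \<Rightarrow> 'c" and u :: 'c and \<psi> :: "'u::real_vector ck \<Rightarrow> 'd"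
  assumes m: "bilinear m" and \<psi>: "linear \<psi>"
begin

lemma linear_coiter: "linear (coiter m u \<psi> n)"
  and bilinear_coiter: "bilinear (\<lambda>a b. m (coiter m u \<psi> n a) (\<psi> b))"
proof -
  have b: "bilinear (\<lambda>a b. m (coiter m u \<psi> n a) (\<psi> b))" if "linear (coiter m u \<psi> n)" for n
    by (intro bilinearI lin_bil1[OF m that] lin_bil2[OF m \<psi>])
  show *: "linear (coiter m u \<psi> n)"
    by (induction n) (simp_all add: lin linear_ck_counit linear_cosum[OF b])
  show "bilinear (\<lambda>a b. m (coiter m u \<psi> n a) (\<psi> b))"
    by (rule b[OF *])
qed

text \<open>As \<open>\<psi>\<close> kills the unit, only chains of \<open>n\<close> nested cuts with non-empty layers contribute, and a forest with
  fewer than \<open>n\<close> vertices has none.\<close>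

lemma locfin_coiter:
  assumes "\<psi> ck_one = 0"
  shows "locfin (coiter m u \<psi>)"
proof -
  have "coiter m u \<psi> n (ck f) = 0" if "card (verts f) < n" for n and f :: "'u forest"
    using that
  proof (induction n arbitrary: f)
    case (Suc n)
    have "m (coiter m u \<psi> n (pruned f A)) (\<psi> (trunk f A)) = 0"
      if A: "A \<in> cuts f" for A
    proof (cases "A = verts f")
      case True
      then show ?thesis by (simp add: ck_empty assms bilinear_rzero[OF m])
    next
      case False
      then have "A \<subset> verts f" using cut_subset[OF A] by blast
      then have "card A < card (verts f)" "verts f \<inter> A = A" by (auto intro: psubset_card_mono)
      then show ?thesis using Suc by (simp add: bilinear_lzero[OF m])
    qed
    then show ?case by (simp add: cosum_ck[OF bilinear_coiter])
  qed simp
  then show ?thesis by (simp add: locfin_def linear_coiter)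
qed

lemma total_coiter:
  assumes "\<psi> ck_one = 0"
  shows "total (coiter m u \<psi>) h = ck_counit h *\<^sub>R u + cosum (\<lambda>a b. m (total (coiter m u \<psi>) a) (\<psi> b)) h"
proof -
  note locfin_coiter = locfin_coiter[OF assms]
  note lt = linear_total[OF locfin_coiter]
  have b: "bilinear (\<lambda>a b. m (total (coiter m u \<psi>) a) (\<psi> b))"
    by (intro bilinearI lin_bil1[OF m lt] lin_bil2[OF m \<psi>])
  show ?thesis
  proof (rule ck_eqI[where h = h, OF lt], intro lin linear_ck_counit linear_cosum[OF b])
    fix f :: "'u forest"
    let ?N = "card (verts f)" and ?R = "coiter m u \<psi>"
    have "cosum (\<lambda>a b. m (total ?R a) (\<psi> b)) (ck f) =
        (\<Sum>A\<in>cuts f. \<Sum>n\<le>?N. m (?R n (pruned f A)) (\<psi> (trunk f A)))"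
      using m by (simp add: cosum_ck[OF b] total_ck[OF locfin_coiter card_restrict_le]
          linear_sum[of "\<lambda>x. m x _"] bilinear_def)
    also have "\<dots> = (\<Sum>n\<le>?N. ?R (Suc n) (ck f))"
      by (subst sum.swap) (simp add: cosum_ck[OF bilinear_coiter])
    finally have c: "cosum (\<lambda>a b. m (total ?R a) (\<psi> b)) (ck f) = (\<Sum>n\<le>?N. ?R (Suc n) (ck f))" .
    have "total ?R (ck f) = (\<Sum>n\<le>Suc ?N. ?R n (ck f))"
      by (rule total_ck[OF locfin_coiter]) simp
    also have "\<dots> = ?R 0 (ck f) + (\<Sum>n\<le>?N. ?R (Suc n) (ck f))"
      by (rule sum.atMost_Suc_shift)
    finally show "total ?R (ck f) = ck_counit (ck f) *\<^sub>R u + cosum (\<lambda>a b. m (total ?R a) (\<psi> b)) (ck f)"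
      unfolding c by simp
  qed
qed

end

section \<open>Natural growth\<close>

text \<open>The sum over all vertices without the division by their number.  Its coproduct can be computed vertex by
  vertex; \<open>top_graft\<close> brings the division back.\<close>

definition ck_graft :: "'u::real_vector ck \<Rightarrow> 'u ck \<Rightarrow> 'u ck" where
  "ck_graft h k = ck_lin (\<lambda>f. ck_lin (\<lambda>g. \<Sum>v\<in>verts g. ck (graft f g v)) k) h"

lemma bilinear_graft: "bilinear (ck_graft :: 'u::real_vector ck \<Rightarrow> _)"
  and graft_ck: "ck_graft (ck f) (ck g :: 'u ck) = (\<Sum>v\<in>verts g. ck (graft f g v))"
proof -
  have 1: "ck_compat (\<lambda>f. \<Sum>v\<in>verts g. ck (graft f g v))" for g :: "'u forest"
  proof (rule ck_compatI)
    fix f :: "'u forest" and v assume "v \<in> verts f"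
    then show "linear (\<lambda>a. \<Sum>w\<in>verts g. ck (graft (dec_upd f v a) g w))"
      by (intro lin) (simp add: dec_upd_graft(1)[symmetric] linear_ck_dec)
  qed (simp add: ck_graft_cong1)
  have 2: "ck_compat (\<lambda>g. \<Sum>v\<in>verts g. ck (graft f g v))" for f :: "'u forest"
  proof (rule ck_compatI)
    fix g g' :: "'u forest" assume "forest_iso g g'"
    then obtain \<sigma> where s: "bij_betw \<sigma> (verts g) (verts g')"
      "\<forall>x\<in>verts g. \<forall>y\<in>verts g. (x, y) \<in> edges g \<longleftrightarrow> (\<sigma> x, \<sigma> y) \<in> edges g'"
      "\<forall>x\<in>verts g. dec g' (\<sigma> x) = dec g x" unfolding forest_iso_def by blast
    show "(\<Sum>v\<in>verts g. ck (graft f g v)) = (\<Sum>v\<in>verts g'. ck (graft f g' v))"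
      by (subst sum.reindex_bij_betw[OF s(1), symmetric], rule sum.cong[OF refl], rule ck_graft_cong2[OF s])
  next
    fix g :: "'u forest" and v assume "v \<in> verts g"
    then have "linear (\<lambda>a. \<Sum>w\<in>verts g. ck (graft f (dec_upd g v a) w))"
      by (intro lin) (simp add: dec_upd_graft(2)[symmetric] linear_ck_dec)
    then show "linear (\<lambda>a. \<Sum>w\<in>verts (dec_upd g v a). ck (graft f (dec_upd g v a) w))"
      by simp
  qed
  show "bilinear (ck_graft :: 'u ck \<Rightarrow> _)"
    "ck_graft (ck f) (ck g :: 'u ck) = (\<Sum>v\<in>verts g. ck (graft f g v))"
    unfolding ck_graft_def[abs_def]
    using bilinear_ck_lin2[of "\<lambda>f g. \<Sum>v\<in>verts g. ck (graft f g v)", OF 1 2]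
      ck_lin2_ck[of "\<lambda>f g. \<Sum>v\<in>verts g. ck (graft f g v)", OF 1 2] by auto
qed

lemmas lin_graft [lin] = lin_bil1[OF bilinear_graft] lin_bil2[OF bilinear_graft]

lemma word_pair_zero [simp]: "word [0, x] = 0" "word [x, 0] = 0"
  using word_zero[of "[]" "[x]"] word_zero[of "[x]" "[]"] by simp_all

lemma ck_lin_id: "ck_lin ck h = h"
  by (rule ck_eqI[where h = h, OF linear_ck_lin[OF ck_compat_ck] linear_ident])
    (simp add: ck_lin_ck[OF ck_compat_ck])

abbreviation inv_weight :: "'u::real_vector ck \<Rightarrow> 'u ck" where
  "inv_weight \<equiv> ck_scale (\<lambda>n. 1 / real n)"

lemma top_graft: "ck_top h k = ck_graft h (inv_weight k) + ck_counit k *\<^sub>R h"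
proof -
  let ?F = "\<lambda>h k. ck_graft h (inv_weight k) + ck_counit k *\<^sub>R h"
  have b: "bilinear ?F" by (intro bilinearI lin)
  have "(if verts g = {} then ck f
      else (1 / real (card (verts g))) *\<^sub>R (\<Sum>v\<in>verts g. ck (graft f g v))) = ?F (ck f) (ck g)"
    for f g :: "'a forest"
    by (simp add: ck_scale_ck linear_cmul[OF lin_graft(2)[OF linear_ident]] graft_ck
        linear_0[OF lin_graft(2)[OF linear_ident]])
  then have "ck_top h k = ck_lin (\<lambda>f. ck_lin (\<lambda>g. ?F (ck f) (ck g)) k) h"
    unfolding ck_top_def by presburger
  also have "\<dots> = ck_lin (\<lambda>f. ?F (ck f) (ck_lin ck k)) h"
    using b by (intro arg_cong[where f = "\<lambda>x. ck_lin x h"] ext ck_lin_comp[symmetric]) (auto simp: bilinear_def)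
  also have "\<dots> = ?F (ck_lin ck h) (ck_lin ck k)"
    by (rule ck_lin_comp[symmetric]) (intro lin)
  finally show ?thesis by (simp only: ck_lin_id)
qed

lemma bilinear_top: "bilinear ck_top"
  unfolding top_graft[abs_def] by (intro bilinearI lin)

lemmas lin_top [lin] = lin_bil1[OF bilinear_top] lin_bil2[OF bilinear_top]

lemma one_top [simp]: "ck_top ck_one h = h"
proof (rule ck_eqI[where h = h])
  fix f :: "'a forest"
  have "ck_graft ck_one (ck f) = real (card (verts f)) *\<^sub>R ck f"
    unfolding ck_one_def graft_ck by (simp add: ck_graft_empty sum_constant_scaleR)
  then show "ck_top ck_one (ck f) = ck f"
    by (simp add: top_graft ck_scale_ck linear_cmul[OF lin_graft(2)[OF linear_ident]] ck_empty)
qed (intro lin)+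

lemma counit_graft: "ck_counit (ck_graft h k) = 0"
  by (rule ck_eqI2[where h = h and k = k and G = "\<lambda>_ _. 0"])
    ((intro bilinearI lin)+, auto simp: graft_ck linear_sum[OF linear_ck_counit] intro!: sum.neutral)

lemma graft_one: "ck_graft h ck_one = 0"
  by (rule ck_eqI[where h = h]) ((intro lin)+, simp add: ck_one_def graft_ck)

lemma sum_if_swap:
  assumes "finite V" "\<And>B. B \<in> C \<Longrightarrow> B \<subseteq> V"
  shows "(\<Sum>v\<in>V. \<Sum>B\<in>C. if v \<in> B then p v B else q v B) = (\<Sum>B\<in>C. (\<Sum>v\<in>B. p v B) + (\<Sum>v\<in>V - B. q v B))"
proof (subst sum.swap, rule sum.cong[OF refl])
  fix B assume "B \<in> C"
  then have "B \<subseteq> V" by (rule assms)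
  then have "V \<inter> {v. v \<in> B} = B" "V \<inter> - {v. v \<in> B} = V - B" by auto
  then show "(\<Sum>v\<in>V. if v \<in> B then p v B else q v B) = (\<Sum>v\<in>B. p v B) + (\<Sum>v\<in>V - B. q v B)"
    using assms(1) by (simp add: sum.If_cases)
qed

lemma ck_disj_union_empty_left: "verts e = {} \<Longrightarrow> ck (disj_union e g) = ck g"
  using mult_ck[of e g] by (simp add: ck_empty)

text \<open>A cut of the grafting of \<open>f\<close> onto \<open>v\<close> consists of a cut \<open>S\<close> of \<open>g\<close> together with a cut of \<open>f\<close>, the latter
  being all of \<open>f\<close> if \<open>v \<in> S\<close>.  In that case the grafting takes place within the first factor, and
  otherwise within the second one; the sum over \<open>v\<close> accordingly splits into one over \<open>S\<close> and one over
  its complement.\<close>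

lemma cosum_graft:
  assumes B: "bilinear B"
  shows "cosum B (ck_graft h k) =
    cosum (\<lambda>a b. cosum (\<lambda>c d. B (ck_mult a c) (ck_graft b d)) k) h + cosum (\<lambda>c d. B (ck_graft h c) d) k"
proof (rule ck_eqI2[where h = h and k = k])
  note l = lin lin_bil1[OF B] lin_bil2[OF B]
  have b: "bilinear (\<lambda>c d. B (ck_mult a c) (ck_graft b d))" for a b
    by (intro bilinearI l)
  have b': "bilinear (\<lambda>a b. cosum (\<lambda>c d. B (ck_mult a c) (ck_graft b d)) k)" for k
    by (intro bilinearI l)
  have b'': "bilinear (\<lambda>c d. B (ck_graft h c) d)" for h
    by (intro bilinearI l)
  show "bilinear (\<lambda>h k. cosum B (ck_graft h k))" by (intro bilinearI l lin_cosum B)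
  show "bilinear (\<lambda>h k. cosum (\<lambda>a b. cosum (\<lambda>c d. B (ck_mult a c) (ck_graft b d)) k) h +
      cosum (\<lambda>c d. B (ck_graft h c) d) k)"
    by (intro bilinearI linear_compose_add linear_cosum b b' b'' cosum_param l)
  fix f g :: "'a forest"
  let ?r = "\<lambda>f A. pruned f A"
  have "cosum B (ck_graft (ck f) (ck g)) = (\<Sum>v\<in>verts g. cosum B (ck (graft f g v)))"
    by (simp add: graft_ck linear_sum[OF linear_cosum[OF B]])
  also have "\<dots> = (\<Sum>v\<in>verts g. \<Sum>S\<in>cuts g. if v \<in> S
      then B (ck (graft f (forest_restrict g S) v)) (?r g (verts g - S))
      else \<Sum>A\<in>cuts f. B (ck (disj_union (forest_restrict f A) (forest_restrict g S)))
        (ck (graft (forest_restrict f (verts f - A)) (forest_restrict g (verts g - S)) v)))"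
  proof (rule sum.cong[OF refl])
    fix v assume v: "v \<in> verts g"
    have e: "ck (forest_restrict (graft f g v) (par (verts f) S)) = ck (graft f (forest_restrict g S) v)"
      "ck (forest_restrict (graft f g v) (par {} (verts g - S))) = ?r g (verts g - S)" if "v \<in> S" for S
      using restrict_graft_in[OF that, of f "verts f" g]
        restrict_graft_out[of v "verts g - S" f g "{}"] edge_verts[of _ _ f] that
      by (auto simp: ck_disj_union_empty_left)
    have e': "ck (forest_restrict (graft f g v) (par A S)) = ck (disj_union (forest_restrict f A) (forest_restrict g S))"
      "ck (forest_restrict (graft f g v) (par (verts f - A) (verts g - S))) =
        ck (graft (forest_restrict f (verts f - A)) (forest_restrict g (verts g - S)) v)"
      if "v \<notin> S" "A \<in> cuts f" for A S
    proof -
      show "ck (forest_restrict (graft f g v) (par A S)) = ck (disj_union (forest_restrict f A) (forest_restrict g S))"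
        using restrict_graft_out[OF that(1), of f g A] by simp
      have "x \<in> verts f - A" if "(x, y) \<in> edges f" "y \<in> verts f - A" for x y
        using that \<open>A \<in> cuts f\<close> edge_verts[OF that(1)] by (auto simp: cuts_def)
      then show "ck (forest_restrict (graft f g v) (par (verts f - A) (verts g - S))) =
        ck (graft (forest_restrict f (verts f - A)) (forest_restrict g (verts g - S)) v)"
        using restrict_graft_in[of v "verts g - S" f "verts f - A" g] v that by simp
    qed
    show "cosum B (ck (graft f g v)) = (\<Sum>S\<in>cuts g. if v \<in> S
      then B (ck (graft f (forest_restrict g S) v)) (?r g (verts g - S))
      else \<Sum>A\<in>cuts f. B (ck (disj_union (forest_restrict f A) (forest_restrict g S)))
        (ck (graft (forest_restrict f (verts f - A)) (forest_restrict g (verts g - S)) v)))"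
      unfolding cosum_ck[OF B] sum_cuts_graft[OF v] verts_graft par_diff
      by (rule sum.cong[OF refl]) (auto simp: e e' ck_disj_union_empty_left intro!: sum.cong)
  qed
  also have "\<dots> = (\<Sum>S\<in>cuts g. (\<Sum>v\<in>S. B (ck (graft f (forest_restrict g S) v)) (?r g (verts g - S))) +
      (\<Sum>v\<in>verts g - S. \<Sum>A\<in>cuts f. B (ck (disj_union (forest_restrict f A) (forest_restrict g S)))
        (ck (graft (forest_restrict f (verts f - A)) (forest_restrict g (verts g - S)) v))))"
    by (rule sum_if_swap) (auto simp: cuts_def)
  also have "\<dots> = (\<Sum>S\<in>cuts g. B (ck_graft (ck f) (?r g S)) (?r g (verts g - S)) +
      (\<Sum>A\<in>cuts f. B (ck_mult (?r f A) (?r g S)) (ck_graft (?r f (verts f - A)) (?r g (verts g - S)))))"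
  proof (rule sum.cong[OF refl])
    fix S assume "S \<in> cuts g"
    then have "verts g \<inter> S = S" "verts g \<inter> (verts g - S) = verts g - S" using cut_subset[of S g] by auto
    moreover have "linear (\<lambda>x. B x y)" "linear (B y)" for y using B by (auto simp: bilinear_def)
    ultimately show "(\<Sum>v\<in>S. B (ck (graft f (forest_restrict g S) v)) (?r g (verts g - S))) +
      (\<Sum>v\<in>verts g - S. \<Sum>A\<in>cuts f. B (ck (disj_union (forest_restrict f A) (forest_restrict g S)))
        (ck (graft (forest_restrict f (verts f - A)) (forest_restrict g (verts g - S)) v))) =
      B (ck_graft (ck f) (?r g S)) (?r g (verts g - S)) +
      (\<Sum>A\<in>cuts f. B (ck_mult (?r f A) (?r g S)) (ck_graft (?r f (verts f - A)) (?r g (verts g - S))))"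
      by (simp add: graft_ck mult_ck linear_sum[of "\<lambda>x. B x _"] linear_sum[of "B _"] sum.swap[of _ "verts g - S"])
  qed
  also have "\<dots> = cosum (\<lambda>a b. cosum (\<lambda>c d. B (ck_mult a c) (ck_graft b d)) (ck g)) (ck f) +
      cosum (\<lambda>c d. B (ck_graft (ck f) c) d) (ck g)"
    unfolding cosum_ck[OF b'] cosum_ck[OF b''] unfolding cosum_ck[OF b] sum.distrib
    by (simp add: add.commute sum.swap[of _ "cuts g"])
  finally show "cosum B (ck_graft (ck f) (ck g)) =
    cosum (\<lambda>a b. cosum (\<lambda>c d. B (ck_mult a c) (ck_graft b d)) (ck g)) (ck f) +
    cosum (\<lambda>c d. B (ck_graft (ck f) c) d) (ck g)" .
qed

subsection \<open>Primitive elements\<close>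

lemma ck_plus_iff: "h \<in> ck_plus \<longleftrightarrow> ck_counit h = 0"
proof
  assume "h \<in> ck_plus"
  then show "ck_counit h = 0" unfolding ck_plus_def
    by (rule linear_vanish_span[OF linear_ck_counit, rotated]) (auto split: if_splits)
next
  assume h: "ck_counit h = 0"
  have "ck_red h \<in> ck_plus"
  proof (induction h rule: ck_induct)
    case zero
    show ?case by (simp add: linear_0[OF linear_red] ck_plus_def span_zero)
  next
    case (add c f h)
    have "ck_red (ck f) \<in> ck_plus"
      unfolding red_ck ck_plus_def by (auto intro: span_zero span_base)
    then show ?case using add
      by (simp add: linear_add[OF linear_red] linear_cmul[OF linear_red] ck_plus_def span_add span_scale)
  qed
  then show "h \<in> ck_plus" using h by (simp add: ck_red_def)
qed

lemma prim_iff: "p \<in> ck_prim \<longleftrightarrow> ck_counit p = 0 \<and> ck_cop p = word [ck_one, p] + word [p, ck_one]"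
  by (auto simp: ck_prim_def ck_plus_iff ck_red_cop_def ck_red_def algebra_simps)

lemma cosum_prim:
  assumes "p \<in> ck_prim" "bilinear B"
  shows "cosum B p = B ck_one p + B p ck_one"
  using assms by (simp add: cosum_pair_lin prim_iff linear_add[OF linear_pair_lin])

lemma ck_proj_one: "ck_proj n ck_one = (if n = 0 then ck_one else 0)"
  by (simp add: ck_one_def ck_scale_ck)

lemma ck_counit_proj: "ck_counit (ck_proj n h) = (if n = 0 then ck_counit h else 0)"
  by (rule ck_eqI[where h = h])
    ((intro lin)+, auto simp: ck_scale_ck linear_cmul[OF linear_ck_counit])

lemma ck_deg_0: "ck_deg 0 = span {ck_one}"
proof -
  have "{ck f | f :: 'a forest. card (verts f) = 0} = {ck_one}"
    by (auto simp: ck_empty) (auto simp: ck_one_def intro!: exI[of _ empty_forest])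
  then show ?thesis unfolding ck_deg_def by simp
qed

text \<open>The coproduct respects the grading, so \<open>1 \<otimes> p + p \<otimes> 1\<close> can be compared degree by degree.\<close>

lemma prim_proj:
  assumes p: "p \<in> ck_prim"
  shows "ck_proj n p \<in> ck_prim"
  unfolding prim_iff
proof
  show 0: "ck_counit (ck_proj n p) = 0"
    using p by (simp add: ck_counit_proj prim_iff)
  have b: "bilinear (\<lambda>a b. word [ck_proj i a, ck_proj j b])" for i j
    by (intro bilinearI lin)
  have "ck_cop (ck_proj n p) = (\<Sum>i\<le>n. cosum (\<lambda>a b. word [ck_proj i a, ck_proj (n - i) b]) p)"
    unfolding ck_cop_cosum by (rule cosum_proj[OF bilinear_word])
  also have "\<dots> = (\<Sum>i\<le>n. if i = 0 then word [ck_one, ck_proj n p] else 0) +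
      (\<Sum>i\<le>n. if i = n then word [ck_proj n p, ck_one] else 0)"
    unfolding cosum_prim[OF p b] sum.distrib
    by (intro arg_cong2[where f = "(+)"] sum.cong) (auto simp: ck_proj_one)
  finally show "ck_cop (ck_proj n p) = word [ck_one, ck_proj n p] + word [ck_proj n p, ck_one]"
    by simp
qed

lemma prim_scale:
  assumes "p \<in> ck_prim"
  shows "ck_scale c p \<in> ck_prim"
proof -
  obtain M where "ck_scale c p = (\<Sum>n\<le>M. c n *\<^sub>R ck_proj n p)"
    using ck_scale_expand by blast
  then show ?thesis
    using prim_proj[OF assms]
    by (auto intro!: subspace_sum[OF subspace_ck_prim] subspace_scale[OF subspace_ck_prim])
qed

lemma counit_top_prim: "p \<in> ck_prim \<Longrightarrow> ck_counit (ck_top h p) = 0"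
  by (simp add: top_graft prim_iff counit_graft)

text \<open>Dividing a primitive \<open>p\<close> by the weight gives another primitive \<open>q\<close>, and \<open>h \<top> p\<close> is the plain grafting of
  \<open>h\<close> onto \<open>q\<close>.  Of the two sums in \<open>cosum_graft\<close> only the terms \<open>1 \<otimes> q\<close> and \<open>q \<otimes> 1\<close> of the coproduct of
  \<open>q\<close> remain, and there grafting onto \<open>1\<close> gives \<open>0\<close>.\<close>

lemma cosum_top_prim:
  assumes p: "p \<in> ck_prim" and B: "bilinear B"
  shows "cosum B (ck_top h p) = cosum (\<lambda>a b. B a (ck_top b p)) h + B (ck_top h p) ck_one"
proof -
  note l = lin lin_bil1[OF B] lin_bil2[OF B]
  define q where "q = inv_weight p"
  have q: "q \<in> ck_prim" unfolding q_def by (rule prim_scale[OF p])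
  have t: "ck_top x p = ck_graft x q" for x
    using p by (simp add: top_graft q_def prim_iff)
  have b: "bilinear (\<lambda>c d. B (ck_mult a c) (ck_graft b d))" "bilinear (\<lambda>c d. B (ck_graft h c) d)" for a b
    by (intro bilinearI l)+
  show ?thesis
    unfolding t cosum_graft[OF B] cosum_prim[OF q b(1)] cosum_prim[OF q b(2)]
    by (simp add: graft_one bilinear_lzero[OF B] bilinear_rzero[OF B])
qed

subsection \<open>The projection onto primitive elements\<close>

text \<open>The projection \<open>E\<close> with \<open>\<Sum> h' \<top> E(h'') = h\<close> for \<open>h\<close> of positive weight, see \<open>top_primize\<close>.  Solving for
  the term with \<open>h' = 1\<close> gives \<open>E(h) = h - \<Sum> h' \<top> E(h'')\<close>, the sum being over the reduced coproduct.
  This recursion on the weight is unrolled into a locally finite sum, whose terms are visibly linear.\<close>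

primrec prim_iter :: "nat \<Rightarrow> 'u::real_vector ck \<Rightarrow> 'u ck" where
  "prim_iter 0 = ck_red"
| "prim_iter (Suc n) = cosum (\<lambda>a b. - ck_top (ck_red a) (prim_iter n b))"

definition primize :: "'u::real_vector ck \<Rightarrow> 'u ck" where
  "primize = total prim_iter"

lemma linear_prim_iter: "linear (prim_iter n :: 'u::real_vector ck \<Rightarrow> _)"
  and bilinear_prim_iter: "bilinear (\<lambda>a b :: 'u ck. - ck_top (ck_red a) (prim_iter n b))"
proof -
  have b: "bilinear (\<lambda>a b :: 'u ck. - ck_top (ck_red a) (prim_iter n b))"
    if "linear (prim_iter n :: 'u ck \<Rightarrow> _)" for n
    by (intro bilinearI lin linear_red that)
  show *: "linear (prim_iter n :: 'u ck \<Rightarrow> _)" for n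
    by (induction n) (simp_all add: linear_red linear_cosum[OF b])
  show "bilinear (\<lambda>a b :: 'u ck. - ck_top (ck_red a) (prim_iter n b))"
    by (rule b[OF *])
qed

lemma top_zero [simp]: "ck_top 0 h = 0" "ck_top h 0 = 0"
  by (simp_all add: bilinear_lzero[OF bilinear_top] bilinear_rzero[OF bilinear_top])

lemma locfin_prim_iter: "locfin (prim_iter :: nat \<Rightarrow> 'u::real_vector ck \<Rightarrow> _)"
proof -
  have "prim_iter n (ck f) = 0" if "card (verts f) \<le> n" for n and f :: "'u forest"
    using that
  proof (induction n arbitrary: f)
    case 0
    then show ?case by (simp add: red_ck)
  next
    case (Suc n)
    have "- ck_top (ck_red (pruned f A)) (prim_iter n (trunk f A)) = 0"
      if A: "A \<in> cuts f" for A
    proof (cases "A = {}")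
      case True
      then show ?thesis by (simp add: red_ck)
    next
      case False
      then have "verts f - A \<subset> verts f" using cut_subset[OF A] by blast
      then have "card (verts f - A) < card (verts f)" "verts f \<inter> (verts f - A) = verts f - A"
        by (auto intro: psubset_card_mono)
      then show ?thesis using Suc by simp
    qed
    then show ?case by (simp add: cosum_ck[OF bilinear_prim_iter] del: neg_equal_0_iff_equal)
  qed
  then show ?thesis by (simp add: locfin_def linear_prim_iter)
qed

lemma linear_primize: "linear primize"
  unfolding primize_def by (rule linear_total[OF locfin_prim_iter])

lemmas lin_primize [lin] = lin_comp[OF linear_primize] lin_comp[OF linear_red]

lemma primize_rec: "primize h = ck_red h - cosum (\<lambda>a b. ck_top (ck_red a) (primize b)) h"
proof -
  have b: "bilinear (\<lambda>a b. ck_top (ck_red a) (primize b))"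
    by (intro bilinearI lin linear_primize)
  show ?thesis
  proof (rule ck_eqI[where h = h, OF linear_primize], intro lin linear_red linear_cosum[OF b])
    fix f :: "'a forest"
    let ?N = "card (verts f)"
    have expand: "primize (pruned f A) = (\<Sum>n\<le>?N. prim_iter n (pruned f A))" for A
      unfolding primize_def by (rule total_ck[OF locfin_prim_iter card_restrict_le])
    have "- cosum (\<lambda>a b. ck_top (ck_red a) (primize b)) (ck f) =
        (\<Sum>A\<in>cuts f. \<Sum>n\<le>?N. - ck_top (ck_red (pruned f A))
          (prim_iter n (trunk f A)))"
      by (simp add: cosum_ck[OF b] expand linear_sum[OF lin_top(2)[OF linear_ident]] sum_negf
          del: forest_sel_simps)
    also have "\<dots> = (\<Sum>n\<le>?N. prim_iter (Suc n) (ck f))"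
      by (subst sum.swap) (simp add: cosum_ck[OF bilinear_prim_iter])
    finally have c: "- cosum (\<lambda>a b. ck_top (ck_red a) (primize b)) (ck f) = (\<Sum>n\<le>?N. prim_iter (Suc n) (ck f))" .
    have "primize (ck f) = (\<Sum>n\<le>Suc ?N. prim_iter n (ck f))"
      unfolding primize_def by (rule total_ck[OF locfin_prim_iter]) simp
    also have "\<dots> = prim_iter 0 (ck f) + (\<Sum>n\<le>?N. prim_iter (Suc n) (ck f))"
      by (rule sum.atMost_Suc_shift)
    finally show "primize (ck f) = ck_red (ck f) - cosum (\<lambda>a b. ck_top (ck_red a) (primize b)) (ck f)"
      unfolding c[symmetric] by simp
  qed
qed

lemma bilinear_top_primize: "bilinear (\<lambda>a b. ck_top a (primize b))"
  by (intro bilinearI lin linear_primize)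

lemma top_primize: "cosum (\<lambda>a b. ck_top a (primize b)) h = ck_red h"
proof -
  have "cosum (\<lambda>a b. ck_top a (primize b)) h =
      cosum (\<lambda>a b. ck_top (ck_red a) (primize b) + ck_counit a *\<^sub>R primize b) h"
    by (simp add: ck_red_def linear_diff[OF lin_top(1)[OF linear_ident]]
        linear_cmul[OF lin_top(1)[OF linear_ident]])
  also have "\<dots> = cosum (\<lambda>a b. ck_top (ck_red a) (primize b)) h + primize h"
    unfolding cosum_add cosum_counit(1)[OF linear_primize] ..
  finally show ?thesis using primize_rec[of h] by simp
qed

lemma primize_one [simp]: "primize (ck_one :: 'u::real_vector ck) = 0"
  using top_primize[of "ck_one :: 'u ck"] by (simp add: cosum_one[OF bilinear_top_primize])

lemma primize_forest:
  assumes "verts f \<noteq> {}"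
  shows "primize (ck f) = ck f - (\<Sum>A\<in>proper_cuts f.
    ck_top (pruned f A) (primize (trunk f A)))"
  using top_primize[of "ck f"] cosum_proper[OF bilinear_top_primize assms] assms
  by (simp add: red_ck algebra_simps)

text \<open>By induction on the weight: in \<open>E(h) = h - \<Sum> h' \<top> E(h'')\<close> the elements \<open>E(h'')\<close> are primitive, so the
  coproduct of the right hand side is known by \<open>cosum_top_prim\<close>.  After an application of coassociativity
  the double sum over \<open>h\<^sub>1 \<otimes> h\<^sub>2 \<top> E(h\<^sub>3)\<close> collapses by the equation defining \<open>E\<close>.\<close>

lemma primize_prim: "primize h \<in> ck_prim"
proof -
  have e: "ck_counit (primize h) = 0" for h :: "'a ck"
  proof (rule ck_weight_induct[where h = h and G = "\<lambda>_. 0", OF lin_ck_counit[OF linear_primize] linear_zero])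
    fix f :: "'a forest"
    assume IH: "\<And>g. card (verts g) < card (verts f) \<Longrightarrow> ck_counit (primize (ck g :: 'a ck)) = 0"
    show "ck_counit (primize (ck f)) = 0"
    proof (cases "verts f = {}")
      case True
      then show ?thesis by (simp add: ck_empty linear_0[OF linear_ck_counit])
    next
      case False
      then show ?thesis using IH[OF proper_cut_card(2)]
        by (simp add: primize_forest linear_diff[OF linear_ck_counit] linear_sum[OF linear_ck_counit]
            top_graft counit_graft linear_add[OF linear_ck_counit] linear_cmul[OF linear_ck_counit])
    qed
  qed
  have "ck_cop (primize h) = word [ck_one, primize h] + word [primize h, ck_one]"
  proof (rule ck_weight_induct[where h = h])
    show "linear (\<lambda>h. ck_cop (primize h))" "linear (\<lambda>h. word [ck_one, primize h] + word [primize h, ck_one])"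
      by (intro lin linear_primize)+
    fix f :: "'a forest"
    assume IH: "\<And>g. card (verts g) < card (verts f) \<Longrightarrow>
      ck_cop (primize (ck g :: 'a ck)) = word [ck_one, primize (ck g)] + word [primize (ck g), ck_one]"
    show "ck_cop (primize (ck f)) = word [ck_one, primize (ck f)] + word [primize (ck f), ck_one]"
    proof (cases "verts f = {}")
      case True
      then show ?thesis
        by (simp add: ck_empty linear_0[OF linear_ck_cop])
    next
      case False
      let ?l = "\<lambda>A. pruned f A" and ?r = "\<lambda>A. trunk f A"
      let ?T = "\<lambda>a b. cosum (\<lambda>x y. word [x, ck_top y (primize b)]) a"
      have bT: "bilinear (\<lambda>x y. word [x, ck_top y (primize b)])" for b :: "'a ck"
        by (intro bilinearI lin)
      have b: "bilinear ?T" by (intro bilinearI linear_cosum bT lin linear_primize)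
      have cop: "ck_cop (ck_top (?l A) (primize (?r A))) =
          ?T (?l A) (?r A) + word [ck_top (?l A) (primize (?r A)), ck_one]" if "A \<in> proper_cuts f" for A
        unfolding ck_cop_cosum
        by (rule cosum_top_prim[OF _ bilinear_word])
          (use IH[OF proper_cut_card(2)[OF that]] e in \<open>simp add: prim_iff\<close>)
      have "cosum ?T (ck f) = cosum (\<lambda>x c. cosum (\<lambda>y b. word [x, ck_top y (primize b)]) c) (ck f)"
        by (rule cosum_coassoc) (intro lin linear_primize)+
      also have "\<dots> = cosum (\<lambda>x c. word [x, ck_red c]) (ck f)"
        by (simp add: cosum_comp[OF lin_word_simps(2)[OF linear_ident], symmetric] top_primize)
      also have "\<dots> = ck_cop (ck f) - cosum (\<lambda>x c. ck_counit c *\<^sub>R word [x, ck_one]) (ck f)"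
        by (simp add: ck_red_def linear_diff[OF lin_word_simps(2)[OF linear_ident]] ck_cop_cosum
            linear_cmul[OF lin_word_simps(2)[OF linear_ident]] cosum_diff)
      also have "\<dots> = ck_cop (ck f) - word [ck f, ck_one]"
        by (simp only: cosum_counit(2)[OF lin_word_simps(1)[OF linear_ident]])
      finally have 1: "(\<Sum>A\<in>proper_cuts f. ?T (?l A) (?r A)) + word [ck_one, primize (ck f)] =
          ck_cop (ck f) - word [ck f, ck_one]"
        using cosum_one[OF bT] unfolding cosum_proper[OF b False]
        by (simp add: cosum_zero add.commute)
      have 2: "ck_cop (primize (ck f)) = ck_cop (ck f) -
          ((\<Sum>A\<in>proper_cuts f. ?T (?l A) (?r A)) + word [\<Sum>A\<in>proper_cuts f. ck_top (?l A) (primize (?r A)), ck_one])"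
        unfolding primize_forest[OF False] linear_diff[OF linear_ck_cop] linear_sum[OF linear_ck_cop]
          linear_sum[OF lin_word_simps(1)[OF linear_ident]]
        by (simp add: cop sum.distrib cong: sum.cong)
      have 3: "word [\<Sum>A\<in>proper_cuts f. ck_top (?l A) (primize (?r A)), ck_one] =
          word [ck f, ck_one] - word [primize (ck f), ck_one]"
        unfolding primize_forest[OF False] by (simp add: linear_diff[OF lin_word_simps(1)[OF linear_ident]])
      have "E = P + Q" if "S + P = C - F" "E = C - (S + T)" "T = F - Q"
        for S P C F E T Q :: "'a ck tens"
      proof -
        have "S = C - F - P" using that(1) by (simp add: eq_diff_eq)
        then show ?thesis using that(2,3) by simp
      qed
      from this[OF 1 2 3] show ?thesis .
    qed
  qed
  then show ?thesis by (simp add: prim_iff e)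
qed

text \<open>Since the coproduct of \<open>h \<top> p\<close> is known, the equation defining \<open>E\<close> at \<open>h \<top> p\<close> reads
  \<open>h \<top> p = \<Sum> h' \<top> E(h'' \<top> p)\<close>.  By induction on the weight of \<open>h\<close> only the terms with \<open>h' = 1\<close> and
  \<open>h'' = 1\<close> survive, and the latter already equals \<open>h \<top> p\<close>.\<close>

lemma primize_top_prim:
  assumes p: "p \<in> ck_prim"
  shows "primize (ck_top h p) = ck_counit h *\<^sub>R p"
proof (rule ck_weight_induct[where h = h])
  show "linear (\<lambda>h. primize (ck_top h p))" "linear (\<lambda>h. ck_counit h *\<^sub>R p)"
    by (intro lin linear_ck_counit)+
  fix f :: "'a forest"
  assume IH: "\<And>g. card (verts g) < card (verts f) \<Longrightarrow> primize (ck_top (ck g) p) = ck_counit (ck g) *\<^sub>R p"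
  let ?B = "\<lambda>a b. ck_top a (primize (ck_top b p))"
  have b: "bilinear ?B" by (intro bilinearI lin)
  have t: "ck_top h p = cosum ?B h" for h
    using top_primize[of "ck_top h p"]
    unfolding cosum_top_prim[OF p bilinear_top_primize] by (simp add: ck_red_def counit_top_prim[OF p])
  show "primize (ck_top (ck f) p) = ck_counit (ck f) *\<^sub>R p"
  proof (cases "verts f = {}")
    case True
    then show ?thesis using t[of ck_one] cosum_one[OF b] by (simp add: ck_empty)
  next
    case False
    have "ck_top (ck f) p = primize (ck_top (ck f) p) + ck_top (ck f) (primize p)"
      using t[of "ck f"] IH[OF proper_cut_card(2)] proper_cut_card(4)[of _ f]
      unfolding cosum_proper[OF b False] by simp
    moreover have "primize p = p" using t[of ck_one] cosum_one[OF b] by simp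
    ultimately show ?thesis using False by simp
  qed
qed

section \<open>Maps into the tensor coalgebra\<close>

abbreviation snoc :: "'a::real_vector tens \<Rightarrow> 'a \<Rightarrow> 'a tens" where
  "snoc t v \<equiv> tens_conc t (letter v)"

lemma bilinear_snoc: "bilinear snoc"
  by (intro bilinearI lin)

lemma snoc_zero [simp]: "snoc t 0 = 0" "snoc 0 v = 0"
  by (simp_all add: bilinear_lzero[OF bilinear_snoc] bilinear_rzero[OF bilinear_snoc])

lemma counit_snoc [simp]: "tens_counit (snoc t v) = 0"
  by (rule tens_eqI[where t = t], intro lin, intro lin, simp)

lemma pi_snoc: "tens_pi (snoc t v) = tens_counit t *\<^sub>R v"
  by (rule tens_eqI[where t = t], intro lin, intro lin linear_counit, simp)

lemma bilinear_deconc_snoc: "bilinear (\<lambda>x y. word [x, snoc y v])"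
  by (intro bilinearI lin)

lemma deconc_snoc:
  "deconc (snoc t v) = pair_lin (\<lambda>x y. word [x, snoc y v]) (deconc t) + word [snoc t v, word []]"
proof (rule tens_eqI[where t = t], intro lin, intro lin lin_comp[OF linear_pair_lin[OF bilinear_deconc_snoc]] linear_deconc)
  fix xs
  show "deconc (snoc (word xs) v) =
      pair_lin (\<lambda>x y. word [x, snoc y v]) (deconc (word xs)) + word [snoc (word xs) v, word []]"
    by (simp add: deconc_word linear_sum[OF linear_pair_lin[OF bilinear_deconc_snoc]]
        pair_lin_word[OF bilinear_deconc_snoc])
qed

lemma bilinear_snoc_pi: "bilinear (\<lambda>x y. snoc x (tens_pi y))"
  by (intro bilinearI lin linear_tens_pi)

text \<open>The last letter is split off by the one term of the coproduct whose right factor has length one.\<close>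

lemma tens_reconstruct:
  "t = tens_counit t *\<^sub>R word [] + pair_lin (\<lambda>x y. snoc x (tens_pi y)) (deconc t)"
proof (rule tens_eqI[where t = t and F = "\<lambda>t. t"], intro lin,
    intro lin linear_counit lin_comp[OF linear_pair_lin[OF bilinear_snoc_pi]] linear_deconc)
  fix xs :: "'a list"
  have e: "pair_lin (\<lambda>x y. snoc x (tens_pi y)) (deconc (word xs)) =
      (\<Sum>i\<le>length xs. snoc (word (take i xs)) (tens_pi (word (drop i xs))))"
    by (simp only: deconc_word linear_sum[OF linear_pair_lin[OF bilinear_snoc_pi]]
        pair_lin_word[OF bilinear_snoc_pi])
  show "word xs = tens_counit (word xs) *\<^sub>R word [] + pair_lin (\<lambda>x y. snoc x (tens_pi y)) (deconc (word xs))"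
  proof (cases xs rule: rev_cases)
    case Nil
    then show ?thesis unfolding e by simp
  next
    case (snoc ys y)
    have "(\<Sum>i\<le>length xs. snoc (word (take i xs)) (tens_pi (word (drop i xs)))) =
        (\<Sum>i\<le>length xs. if i = length ys then word xs else 0)"
      by (rule sum.cong) (auto simp: snoc word_zero[of "xs @ ys" "[]" for xs ys, simplified])
    then show ?thesis unfolding e by (simp add: snoc)
  qed
qed

text \<open>For linear \<open>\<phi>\<close> with \<open>\<phi>(1) = 0\<close>, this is the map of coalgebras to the tensor coalgebra with one-letter
  part \<open>\<phi>\<close>.\<close>

definition cofree_lift :: "('u::real_vector ck \<Rightarrow> 'v::real_vector) \<Rightarrow> 'u ck \<Rightarrow> 'v tens" where
  "cofree_lift \<phi> = total (coiter snoc (word []) \<phi>)"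

lemma bilinear_lift: "linear L \<Longrightarrow> linear \<phi> \<Longrightarrow> bilinear (\<lambda>a b. snoc (L a) (\<phi> b))"
  by (intro bilinearI lin)

lemma lift_proper:
  assumes L: "linear L" and \<phi>: "linear \<phi>" "\<phi> ck_one = 0" and f: "verts f \<noteq> {}"
  shows "cosum (\<lambda>a b. snoc (L a) (\<phi> b)) (ck f) = snoc (L ck_one) (\<phi> (ck f)) +
    (\<Sum>A\<in>proper_cuts f. snoc (L (pruned f A)) (\<phi> (trunk f A)))"
  by (simp add: cosum_proper[OF bilinear_lift[OF L \<phi>(1)] f] \<phi>)

text \<open>The equation expresses a value at \<open>h\<close> by values at elements of smaller weight, the term with \<open>h'' = 1\<close> being
  \<open>0\<close>.\<close>

lemma lift_unique:
  assumes L: "linear L" and M: "linear M" and \<phi>: "linear \<phi>" "\<phi> ck_one = 0"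
    and recL: "\<And>h. L h = ck_counit h *\<^sub>R word [] + cosum (\<lambda>a b. snoc (L a) (\<phi> b)) h"
    and recM: "\<And>h. M h = ck_counit h *\<^sub>R word [] + cosum (\<lambda>a b. snoc (M a) (\<phi> b)) h"
  shows "L h = M h"
proof (rule ck_weight_induct[OF L M])
  have 1: "L ck_one = word []" "M ck_one = word []"
    using recL[of ck_one] recM[of ck_one]
    by (simp_all add: cosum_one[OF bilinear_lift[OF L \<phi>(1)]] cosum_one[OF bilinear_lift[OF M \<phi>(1)]] \<phi>)
  fix f :: "'a forest"
  assume IH: "\<And>g. card (verts g) < card (verts f) \<Longrightarrow> L (ck g) = M (ck g)"
  show "L (ck f) = M (ck f)"
  proof (cases "verts f = {}")
    case True
    then show ?thesis by (simp add: ck_empty 1)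
  next
    case False
    then show ?thesis
      using IH[OF proper_cut_card(1)]
      by (simp add: recL[of "ck f"] recM[of "ck f"] lift_proper[OF L \<phi>] lift_proper[OF M \<phi>] 1)
  qed
qed

context
  fixes \<phi> :: "'u::real_vector ck \<Rightarrow> 'v::real_vector"
  assumes \<phi>: "linear \<phi>" "\<phi> ck_one = 0"
begin

lemma linear_lift: "linear (cofree_lift \<phi>)"
  unfolding cofree_lift_def by (rule linear_total[OF locfin_coiter[OF bilinear_snoc \<phi>]])

lemma lift_rec:
  "cofree_lift \<phi> h = ck_counit h *\<^sub>R word [] + cosum (\<lambda>a b. snoc (cofree_lift \<phi> a) (\<phi> b)) h"
  unfolding cofree_lift_def by (rule total_coiter[OF bilinear_snoc \<phi>])

lemma lift_one: "cofree_lift \<phi> ck_one = word []"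
  by (subst lift_rec) (simp add: cosum_one[OF bilinear_lift[OF linear_lift \<phi>(1)]] \<phi>)

lemma counit_lift: "tens_counit (cofree_lift \<phi> h) = ck_counit h"
  by (subst lift_rec) (simp add: linear_add[OF linear_counit] linear_cmul[OF linear_counit]
      cosum_comp[OF linear_counit] cosum_zero)

lemma pi_lift: "tens_pi (cofree_lift \<phi> h) = \<phi> h"
  by (subst lift_rec) (simp add: linear_add[OF linear_tens_pi] linear_cmul[OF linear_tens_pi]
      cosum_comp[OF linear_tens_pi] pi_snoc counit_lift cosum_counit(1)[OF \<phi>(1)])

text \<open>By induction on the weight: the coproduct of a word with appended letter arises from that of the word by
  appending the letter to all second factors, apart from one additional term.  Coassociativity then lets
  the recursion act on the second factor.\<close>

lemma deconc_lift: "deconc (cofree_lift \<phi> h) = cosum (\<lambda>a b. word [cofree_lift \<phi> a, cofree_lift \<phi> b]) h"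
proof -
  let ?L = "cofree_lift \<phi>"
  note ll = lin_comp[OF linear_lift] lin_comp[OF \<phi>(1)] linear_lift \<phi>(1)
  have bw: "bilinear (\<lambda>a b. word [?L a, ?L b])" by (intro bilinearI lin ll)
  have bs: "bilinear (\<lambda>a b. snoc (?L a) (\<phi> b))" by (rule bilinear_lift[OF linear_lift \<phi>(1)])
  show ?thesis
  proof (rule ck_weight_induct[where h = h])
    show "linear (\<lambda>h. deconc (?L h))" by (intro lin ll)
    show "linear (cosum (\<lambda>a b. word [?L a, ?L b]))" by (rule linear_cosum[OF bw])
    fix f :: "'u forest"
    assume IH: "\<And>g. card (verts g) < card (verts f) \<Longrightarrow>
      deconc (?L (ck g)) = cosum (\<lambda>a b. word [?L a, ?L b]) (ck g)"
    let ?D = "\<lambda>a b. pair_lin (\<lambda>x y. word [x, snoc y (\<phi> b)]) (deconc (?L a))"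
    let ?C = "\<lambda>a b. cosum (\<lambda>x y. word [?L x, snoc (?L y) (\<phi> b)]) a"
    have bC': "bilinear (\<lambda>x y. word [?L x, snoc (?L y) (\<phi> b)])" for b by (intro bilinearI lin ll)
    have bC: "bilinear ?C" by (intro bilinearI linear_cosum bC' lin ll)
    have bD: "bilinear ?D"
      unfolding pair_lin_def
      by (intro bilinearI lin_comp[OF linear_pair_lin[OF bilinear_deconc_snoc], unfolded pair_lin_def] lin ll)
    have DC: "?D a b = ?C a b" if "deconc (?L a) = cosum (\<lambda>a b. word [?L a, ?L b]) a" for a b
      unfolding that cosum_comp[OF linear_pair_lin[OF bilinear_deconc_snoc]]
        pair_lin_word[OF bilinear_deconc_snoc] ..
    have D1: "deconc (?L ck_one) = cosum (\<lambda>a b. word [?L a, ?L b]) ck_one"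
      by (simp add: cosum_one[OF bw] lift_one deconc_word)
    have "deconc (?L (ck f)) = ck_counit (ck f) *\<^sub>R word [word [], word []] + cosum ?D (ck f) +
        cosum (\<lambda>a b. word [snoc (?L a) (\<phi> b), word []]) (ck f)"
      by (subst lift_rec) (simp add: linear_add[OF linear_deconc] linear_cmul[OF linear_deconc] deconc_word
          cosum_comp[OF linear_deconc] deconc_snoc cosum_add)
    also have "cosum ?D (ck f) = cosum ?C (ck f)"
    proof (cases "verts f = {}")
      case True
      then show ?thesis by (simp add: ck_empty cosum_one[OF bD] cosum_one[OF bC] DC[OF D1])
    next
      case False
      have "?D (ck f) ck_one = ?C (ck f) ck_one"
        using linear_0[OF bilinear_deconc_snoc[THEN linear_pair_lin]] 
        by (simp add: \<phi> cosum_zero pair_lin_def tens_lin_def lin_ext_def if_distrib cong: if_cong)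
      then show ?thesis
        unfolding cosum_proper[OF bD False] cosum_proper[OF bC False]
        using DC[OF D1] DC[OF IH[OF proper_cut_card(1)]] by simp
    qed
    also have "cosum ?C (ck f) = cosum (\<lambda>x c. cosum (\<lambda>y b. word [?L x, snoc (?L y) (\<phi> b)]) c) (ck f)"
      by (rule cosum_coassoc) (intro lin ll)+
    also have "\<dots> = cosum (\<lambda>x c. word [?L x, ?L c] - ck_counit c *\<^sub>R word [?L x, word []]) (ck f)"
    proof -
      have "cosum (\<lambda>y b. word [?L x, snoc (?L y) (\<phi> b)]) c =
          word [?L x, ?L c] - ck_counit c *\<^sub>R word [?L x, word []]" for x c
      proof -
        have "cosum (\<lambda>y b. word [?L x, snoc (?L y) (\<phi> b)]) c = word [?L x, ?L c - ck_counit c *\<^sub>R word []]"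
          using lift_rec[of c]
          by (simp add: cosum_comp[OF lin_word_simps(2)[OF linear_ident], symmetric])
        then show ?thesis
          by (simp add: linear_diff[OF lin_word_simps(2)[OF linear_ident]]
              linear_cmul[OF lin_word_simps(2)[OF linear_ident]])
      qed
      then show ?thesis by simp
    qed
    also have "\<dots> = cosum (\<lambda>a b. word [?L a, ?L b]) (ck f) - word [?L (ck f), word []]"
      unfolding cosum_diff by (simp only: cosum_counit(2)[OF lin_word_simps(1)[OF linear_lift]])
    also have "cosum (\<lambda>a b. word [snoc (?L a) (\<phi> b), word []]) (ck f) =
        word [?L (ck f), word []] - ck_counit (ck f) *\<^sub>R word [word [], word []]"
    proof -
      have "cosum (\<lambda>a b. snoc (?L a) (\<phi> b)) (ck f) = ?L (ck f) - ck_counit (ck f) *\<^sub>R word []"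
        using lift_rec[of "ck f"] by simp
      then show ?thesis
        unfolding cosum_comp[OF lin_word_simps(1)[OF linear_ident], symmetric]
        by (simp add: linear_diff[OF lin_word_simps(1)[OF linear_ident]]
            linear_cmul[OF lin_word_simps(1)[OF linear_ident]])
    qed
    finally show "deconc (?L (ck f)) = cosum (\<lambda>a b. word [?L a, ?L b]) (ck f)" by simp
  qed
qed

end

text \<open>Together with \<open>lift_unique\<close> this shows that a map of coalgebras is determined by its one-letter part,
  if the latter vanishes at \<open>1\<close>.\<close>

lemma coalgebra_map_rec:
  assumes L: "linear L" and cop: "\<And>h. deconc (L h) = cosum (\<lambda>a b. word [L a, L b]) h"
    and eps: "\<And>h. tens_counit (L h) = ck_counit h"
  shows "L h = ck_counit h *\<^sub>R word [] + cosum (\<lambda>a b. snoc (L a) (tens_pi (L b))) h"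
  using tens_reconstruct[of "L h"]
  by (simp add: cop eps cosum_comp[OF linear_pair_lin[OF bilinear_snoc_pi]] pair_lin_word[OF bilinear_snoc_pi])

lemma tens_map_cop: "linear F \<Longrightarrow> tens_map F (ck_cop h) = cosum (\<lambda>a b. word [F a, F b]) h"
  by (simp add: ck_cop_cosum cosum_comp[OF linear_tens_map] tens_map_word)

subsection \<open>The isomorphism of Foissy\<close>

lemma linear_Rep_prim: "linear Rep_prim"
  by (rule linearI) (simp_all add: plus_prim.rep_eq scaleR_prim.rep_eq)

lemma Rep_prim_in [simp]: "Rep_prim p \<in> ck_prim"
  by (rule Rep_prim)

lemma multilin_growth: "multilin (\<lambda>ps. foldl ck_top ck_one (map Rep_prim ps))"
proof (rule multilinI)
  fix xs ys :: "'a prim list"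
  have "linear (\<lambda>a. foldl ck_top (g a) zs)" if "linear g" for g :: "'a prim \<Rightarrow> 'a ck" and zs
    using that
  proof (induction zs arbitrary: g)
    case (Cons z zs)
    show ?case using Cons.IH[of "\<lambda>a. ck_top (g a) z"] lin_top(1)[OF Cons.prems] by simp
  qed simp
  from this[of "\<lambda>a. ck_top (foldl ck_top ck_one (map Rep_prim xs)) (Rep_prim a)" "map Rep_prim ys"]
  show "linear (\<lambda>a. foldl ck_top ck_one (map Rep_prim (xs @ a # ys)))"
    by (simp add: lin_top(2)[OF linear_Rep_prim])
qed

lemma linear_growth: "linear (growth :: 'u::real_vector prim tens \<Rightarrow> _)"
  and growth_word: "growth (word (ps :: 'u prim list)) = foldl ck_top ck_one (map Rep_prim ps)"
  unfolding growth_def using tens_lin[OF multilin_growth] by auto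

lemma growth_snoc: "growth (snoc t p) = ck_top (growth t) (Rep_prim p)"
  by (rule tens_eqI[where t = t], intro lin_comp[OF linear_growth] lin, intro lin linear_growth)
    (simp add: growth_word)

lemma growth_Nil [simp]: "growth (word []) = ck_one"
  by (simp add: growth_word)

lemma growth_letter [simp]: "growth (letter p) = Rep_prim p"
  by (simp add: growth_word)

definition prim_part :: "'u::real_vector ck \<Rightarrow> 'u prim" where
  "prim_part h = Abs_prim (primize h)"

lemma Rep_prim_part [simp]: "Rep_prim (prim_part h) = primize h"
  by (simp add: prim_part_def Abs_prim_inverse primize_prim)

lemma linear_prim_part: "linear prim_part"
  by (rule linearI; rule Rep_prim_inject[THEN iffD1])
    (simp_all add: plus_prim.rep_eq scaleR_prim.rep_eq
      linear_add[OF linear_primize] linear_cmul[OF linear_primize])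

lemma prim_part_one [simp]: "prim_part ck_one = 0"
  by (rule Rep_prim_inject[THEN iffD1]) (simp add: zero_prim.rep_eq)

lemma prim_part_top: "prim_part (ck_top h (Rep_prim p)) = ck_counit h *\<^sub>R p"
  by (rule Rep_prim_inject[THEN iffD1]) (simp add: scaleR_prim.rep_eq primize_top_prim)

text \<open>Natural growth turns appending a letter into \<open>\<top>\<close>, so it transforms the recursion for the lift of \<open>E\<close> into
  the equation \<open>top_primize\<close>.\<close>

lemma growth_lift: "growth (cofree_lift prim_part h) = h"
proof -
  let ?L = "cofree_lift (prim_part :: 'a ck \<Rightarrow> _)"
  note ll = linear_lift[OF linear_prim_part prim_part_one]
  have b: "bilinear (\<lambda>a b. ck_top (growth (?L a)) (primize b))"
    by (intro bilinearI lin lin_comp[OF linear_growth] ll linear_primize)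
  have r: "growth (?L h) = ck_counit h *\<^sub>R ck_one + cosum (\<lambda>a b. ck_top (growth (?L a)) (primize b)) h" for h
    by (subst lift_rec[OF linear_prim_part prim_part_one])
      (simp add: linear_add[OF linear_growth] linear_cmul[OF linear_growth] cosum_comp[OF linear_growth] growth_snoc)
  have 1: "growth (?L ck_one) = ck_one"
    by (simp add: lift_one[OF linear_prim_part prim_part_one])
  show ?thesis
  proof (rule ck_weight_induct[where h = h])
    show "linear (\<lambda>h. growth (?L h))" "linear (\<lambda>h :: 'a ck. h)"
      by (intro lin_comp[OF linear_growth] ll lin)+
    fix f :: "'a forest"
    assume IH: "\<And>g. card (verts g) < card (verts f) \<Longrightarrow> growth (?L (ck g)) = ck g"
    show "growth (?L (ck f)) = ck f"
    proof (cases "verts f = {}")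
      case True
      then show ?thesis by (simp add: ck_empty 1)
    next
      case False
      have "cosum (\<lambda>a b. ck_top (growth (?L a)) (primize b)) (ck f) = cosum (\<lambda>a b. ck_top a (primize b)) (ck f)"
        unfolding cosum_proper[OF b False] cosum_proper[OF bilinear_top_primize False]
        using IH[OF proper_cut_card(1)] by (simp add: 1)
      then show ?thesis using False r[of "ck f"] by (simp add: top_primize red_ck)
    qed
  qed
qed

text \<open>The elements \<open>h \<top> p\<close> have the same coproduct as words with the letter \<open>p\<close> appended, and the one-letter part
  of \<open>h \<top> p\<close> is that of such a word by \<open>primize_top_prim\<close>.\<close>

lemma lift_growth: "cofree_lift prim_part (growth t) = t"
proof -
  note pp = linear_prim_part prim_part_one
  let ?L = "cofree_lift (prim_part :: 'a ck \<Rightarrow> _)"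
  have s: "?L (ck_top h (Rep_prim p)) = snoc (?L h) p" for h p
  proof -
    have "?L (ck_top h (Rep_prim p)) = cosum (\<lambda>a b. snoc (?L a) (prim_part b)) (ck_top h (Rep_prim p))"
      by (subst lift_rec[OF pp]) (simp add: counit_top_prim)
    also have "\<dots> = cosum (\<lambda>a b. ck_counit b *\<^sub>R snoc (?L a) p) h"
      unfolding cosum_top_prim[OF Rep_prim_in bilinear_lift[OF linear_lift[OF pp] pp(1)]]
      by (simp add: prim_part_top linear_cmul[OF lin_conc(2)[OF lin_word_simps(1)[OF linear_ident]]])
    also have "\<dots> = snoc (?L h) p"
      by (rule cosum_counit(2)) (intro lin linear_lift[OF pp])
    finally show ?thesis .
  qed
  have w: "?L (growth (word ps)) = word ps" for ps
  proof (induction ps rule: rev_induct)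
    case Nil
    show ?case by (simp add: lift_one[OF pp])
  next
    case (snoc p ps)
    have "growth (word (ps @ [p])) = ck_top (growth (word ps)) (Rep_prim p)"
      using growth_snoc[of "word ps" p] by simp
    then show ?case using snoc by (simp add: s)
  qed
  show ?thesis
    by (rule tens_eqI[where t = t and G = "\<lambda>t. t"], intro lin_comp[OF linear_lift[OF pp]] linear_growth, intro lin, rule w)
qed

lemma bij_growth: "bij growth"
  by (rule bijI') (metis lift_growth, metis growth_lift)

lemma inv_growth: "inv growth = cofree_lift prim_part"
  by (rule inv_unique_comp) (simp_all add: fun_eq_iff lift_growth growth_lift)

lemma ck_pi: "ck_pi h = prim_part h"
  by (simp add: ck_pi_def inv_growth pi_lift[OF linear_prim_part prim_part_one])

lemma cop_growth: "ck_cop (growth t) = tens_map growth (deconc t)"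
proof -
  let ?L = "cofree_lift (prim_part :: 'a ck \<Rightarrow> _)"
  note pp = linear_prim_part prim_part_one
  have "deconc t = cosum (\<lambda>a b. word [?L a, ?L b]) (growth t)"
    using deconc_lift[OF pp, of "growth t"] by (simp add: lift_growth)
  then have "tens_map growth (deconc t) = cosum (\<lambda>a b. word [growth (?L a), growth (?L b)]) (growth t)"
    by (simp add: cosum_comp[OF linear_tens_map[OF linear_growth]] linear_growth)
  then show ?thesis by (simp add: growth_lift ck_cop_cosum)
qed

lemma counit_growth: "ck_counit (growth t) = tens_counit t"
  using counit_lift[OF linear_prim_part prim_part_one, of "growth t"] by (simp add: lift_growth)

section \<open>The iterated reduced coproduct\<close>

lemma coiter_comp:
  assumes F: "linear F" and m: "\<And>t b. F (m t (\<psi> b)) = m' (F t) (\<psi>' b)"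
  shows "F (coiter m u \<psi> n h) = coiter m' (F u) \<psi>' n h"
proof (induction n arbitrary: h)
  case 0
  show ?case by (simp add: linear_cmul[OF F])
next
  case (Suc n)
  then show ?case by (simp add: cosum_comp[OF F] m)
qed

lemma red_red [simp]: "ck_red (ck_red h) = ck_red h"
  by (simp add: ck_red_def linear_diff[OF linear_ck_counit] linear_cmul[OF linear_ck_counit])

lemma red_cop_cosum: "ck_red_cop h = cosum (\<lambda>a b. word [ck_red a, ck_red b]) h"
proof -
  note l1 = linear_diff[OF lin_word_simps(1)[OF linear_ident]] linear_cmul[OF lin_word_simps(1)[OF linear_ident]]
  note l2 = linear_diff[OF lin_word_simps(2)[OF linear_ident]] linear_cmul[OF lin_word_simps(2)[OF linear_ident]]
  have lc: "linear (\<lambda>h. ck_counit h *\<^sub>R ck_one)" by (intro lin linear_ck_counit)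
  have "cosum (\<lambda>a b. word [ck_red a, ck_red b]) h =
      cosum (\<lambda>a b. word [a, b]) h - cosum (\<lambda>a b. ck_counit b *\<^sub>R word [a, ck_one]) h -
      (cosum (\<lambda>a b. ck_counit a *\<^sub>R word [ck_one, b]) h -
       cosum (\<lambda>a b. ck_counit a *\<^sub>R (ck_counit b *\<^sub>R word [ck_one, ck_one])) h)"
    by (simp add: ck_red_def l1 l2 cosum_diff scaleR_diff_right mult.commute)
  also have "\<dots> = ck_cop h - word [h, ck_one] - (word [ck_one, h] - ck_counit h *\<^sub>R word [ck_one, ck_one])"
    unfolding ck_cop_cosum cosum_counit(2)[OF lin_word_simps(1)[OF linear_ident]]
      cosum_counit(1)[OF lin_word_simps(2)[OF linear_ident]]
      cosum_counit(1)[OF lin_scaleR_left[OF linear_ck_counit]] ..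
  also have "\<dots> = ck_red_cop h"
  proof -
    have "ck_cop ck_one = word [ck_one, ck_one :: 'a ck]"
      unfolding ck_cop_cosum by (rule cosum_one[OF bilinear_word])
    then show ?thesis
      by (simp add: ck_red_cop_def ck_red_def l1 l2 linear_diff[OF linear_ck_cop] linear_cmul[OF linear_ck_cop])
  qed
  finally show ?thesis by simp
qed

text \<open>The iterates of the reduced coproduct act on the first factor, and appending a further factor on the right
  commutes with them.\<close>

lemma iter_coiter: "ck_red_cop_iter n h = coiter snoc (word []) ck_red n h"
proof -
  let ?C = "coiter snoc (word []) (ck_red :: 'a ck \<Rightarrow> _)"
  have 1: "?C (Suc 0) h = letter (ck_red h)" for h
    by (simp add: linear_cmul[OF lin_conc(1)[OF linear_ident]]
        cosum_counit(1)[OF lin_word_simps(1)[OF linear_red]])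
  have l: "linear F" if "F \<in> set (ck_red_cop # replicate n letter)" for F :: "'a ck \<Rightarrow> 'a ck tens" and n
    using that linear_ck_red_cop lin_word_simps(1)[OF linear_ident, of "[]"] by (auto simp: in_set_replicate)
  have "?C (Suc (Suc n)) h = otimes (ck_red_cop # replicate n letter) (?C (Suc n) h)" for n h
  proof (induction n arbitrary: h)
    case 0
    have "otimes [ck_red_cop] (letter v) = ck_red_cop v" for v :: "'a ck"
      using otimes_word[of "[ck_red_cop]" "[v]"] l[of _ 0] by simp
    then have "otimes (ck_red_cop # replicate 0 letter) (?C (Suc 0) h) = ck_red_cop (ck_red h)"
      by (simp only: 1 replicate_0)
    also have "\<dots> = ck_red_cop h"
      by (simp add: ck_red_cop_def)
    also have "\<dots> = ?C (Suc (Suc 0)) h"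
      by (simp add: 1[simplified] red_cop_cosum)
    finally show ?case ..
  next
    case (Suc n)
    have r: "ck_red_cop # replicate (Suc n) letter = (ck_red_cop # replicate n letter) @ [letter]"
      by (simp add: replicate_append_same)
    have "otimes (ck_red_cop # replicate (Suc n) letter) (?C (Suc (Suc n)) h) =
        cosum (\<lambda>a b. otimes (ck_red_cop # replicate (Suc n) letter) (snoc (?C (Suc n) a) (ck_red b))) h"
      by (simp only: coiter.simps(2)[of _ _ _ "Suc n"] cosum_comp[OF linear_otimes[OF l]])
    also have "\<dots> = cosum (\<lambda>a b. snoc (otimes (ck_red_cop # replicate n letter) (?C (Suc n) a)) (ck_red b)) h"
      by (simp only: r otimes_conc_letter[OF l lin_word_simps(1)[OF linear_ident]])
    also have "\<dots> = ?C (Suc (Suc (Suc n))) h"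
      by (simp only: Suc[symmetric] coiter.simps(2)[of _ _ _ "Suc (Suc n)"])
    finally show ?case ..
  qed
  note step = this
  show ?thesis
  proof (cases n)
    case 0
    then show ?thesis by simp
  next
    case (Suc k)
    have "ck_red_cop_iter (Suc k) h = ?C (Suc k) h"
      by (induction k) (simp_all only: ck_red_cop_iter.simps 1 step)
    then show ?thesis using Suc by simp
  qed
qed

lemma locfin_iter: "locfin (coiter snoc (word []) ck_red)"
  by (rule locfin_coiter[OF bilinear_snoc linear_red red_one])

lemma finite_iter: "finite {n. ck_red_cop_iter n h \<noteq> 0}"
  unfolding iter_coiter by (rule locfin_finite[OF locfin_iter])

lemma iter_lift:
  assumes \<phi>: "linear \<phi>" "\<phi> ck_one = 0"
  shows "cofree_lift \<phi> h = Sum_any (\<lambda>n. tens_map \<phi> (ck_red_cop_iter n h))"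
proof -
  have "\<phi> (ck_red b) = \<phi> b" for b
    by (simp add: ck_red_def linear_diff[OF \<phi>(1)] linear_cmul[OF \<phi>(1)] \<phi>)
  then have "tens_map \<phi> (snoc t (ck_red b)) = snoc (tens_map \<phi> t) (\<phi> b)" for t b
    by (simp add: tens_map_conc \<phi>)
  then have "tens_map \<phi> (coiter snoc (word []) ck_red n h) = coiter snoc (tens_map \<phi> (word [])) \<phi> n h" for n
    by (rule coiter_comp[OF linear_tens_map[OF \<phi>(1)]])
  then show ?thesis unfolding cofree_lift_def total_def iter_coiter by (simp add: \<phi>)
qed

section \<open>The Eulerian idempotent\<close>

abbreviation red_pow :: "nat \<Rightarrow> 'u::real_vector ck \<Rightarrow> 'u ck" where
  "red_pow \<equiv> coiter ck_mult ck_one ck_red"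

text \<open>The terms of the Eulerian idempotent are the convolution powers of the identity minus its unit part.\<close>

lemma tens_mult_iter: "tens_mult ck_mult ck_one (ck_red_cop_iter n h) = red_pow n h"
proof -
  note lm = linear_tens_mult[OF bilinear_mult]
  have f: "foldr ck_mult (xs @ [v]) ck_one = ck_mult (foldr ck_mult xs ck_one) v" for xs and v :: "'a ck"
    by (induction xs) (simp_all add: mult_assoc)
  have "tens_mult ck_mult ck_one (snoc t v) = ck_mult (tens_mult ck_mult ck_one t) v" for t and v :: "'a ck"
    by (rule tens_eqI[where t = t], intro lin_comp[OF lm] lin, intro lin lm)
      (simp add: tens_mult_word[OF bilinear_mult] f del: foldr_append)
  then have "tens_mult ck_mult ck_one (coiter snoc (word []) ck_red n h) =
      coiter ck_mult (tens_mult ck_mult ck_one (word [])) ck_red n h"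
    by (rule coiter_comp[OF lm])
  then show ?thesis by (simp add: iter_coiter tens_mult_word[OF bilinear_mult])
qed

abbreviation log_coeff :: "nat \<Rightarrow> real" where
  "log_coeff n \<equiv> if n = 0 then 0 else (-1) ^ (n - 1) / real n"

lemma locfin_red_pow: "locfin red_pow"
  by (rule locfin_coiter[OF bilinear_mult linear_red red_one])

lemma locfin_log: "locfin (\<lambda>n h. log_coeff n *\<^sub>R red_pow n h)"
  using locfin_red_pow unfolding locfin_def by (auto intro!: linear_compose_scale_right simp: linear_zero)

lemma eulerian_total: "eulerian = total (\<lambda>n h. log_coeff n *\<^sub>R red_pow n h)"
  unfolding eulerian_def total_def tens_mult_iter by (intro ext arg_cong[where f = Sum_any]) simp

lemma linear_eulerian: "linear eulerian"
  unfolding eulerian_total by (rule linear_total[OF locfin_log])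

lemma eulerian_ck:
  "card (verts f) \<le> N \<Longrightarrow> eulerian (ck f) = (\<Sum>n\<le>N. log_coeff n *\<^sub>R red_pow n (ck f))"
  unfolding eulerian_total by (rule total_ck[OF locfin_log])

lemma red_pow_one: "red_pow n (ck_one :: 'u::real_vector ck) = (if n = 0 then ck_one else 0)"
proof (cases n)
  case (Suc m)
  then have "red_pow n (ck empty_forest :: 'u ck) = 0"
    using locfin_red_pow[where 'a = 'u] unfolding locfin_def by (simp del: coiter.simps)
  then show ?thesis using Suc by (simp add: ck_one_def del: coiter.simps)
qed simp

lemma eulerian_one [simp]: "eulerian ck_one = 0"
  unfolding eulerian_def tens_mult_iter by (simp add: red_pow_one cong: if_cong)

lemma eulerian_prim:
  assumes p: "p \<in> ck_prim"
  shows "eulerian p = p"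
proof -
  have red: "ck_red p = p" using p by (simp add: ck_red_def prim_iff)
  have s: "red_pow (Suc n) p = (if n = 0 then p else 0)" for n
    using cosum_prim[OF p bilinear_coiter[OF bilinear_mult linear_red, of ck_one n]]
    by (simp add: red red_pow_one bilinear_lzero[OF bilinear_mult] bilinear_rzero[OF bilinear_mult])
  have "eulerian p = (\<Sum>n\<in>{1}. log_coeff n *\<^sub>R red_pow n p)"
    unfolding eulerian_total
  proof (rule total_superset)
    fix n :: nat assume "n \<notin> {1}"
    then show "log_coeff n *\<^sub>R red_pow n p = 0" using s[of "n - 1"] by (cases n) auto
  qed simp
  also have "\<dots> = p" using s[of 0] by simp
  finally show ?thesis .
qed

subsection \<open>Convolution powers of the identity\<close>

text \<open>In the convolution algebra \<open>id\<^sup>*\<^sup>k = \<Sum>n. (k choose n) J\<^sup>*\<^sup>n\<close>, where \<open>J\<close> is the identity minus its unit part.  This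
  is a polynomial in \<open>k\<close>, and its linear coefficient is the logarithm \<open>e\<close> of the identity.  As the algebra
  is commutative, \<open>id\<^sup>*\<^sup>k\<close> is multiplicative; in \<open>id\<^sup>*\<^sup>k(x y) = id\<^sup>*\<^sup>k(x) id\<^sup>*\<^sup>k(y)\<close> the linear coefficients give
  \<open>eulerian_mult\<close>.\<close>

abbreviation conv_pow :: "nat \<Rightarrow> 'u::real_vector ck \<Rightarrow> 'u ck" where
  "conv_pow \<equiv> coiter ck_mult ck_one (\<lambda>h. h)"

lemma conv_pow_Suc:
  fixes h :: "'u::real_vector ck"
  shows "conv_pow (Suc k) h = cosum (\<lambda>a b. ck_mult (conv_pow k a) (ck_red b)) h + conv_pow k h"
proof -
  have split: "ck_mult x b = ck_mult x (ck_red b) + ck_counit b *\<^sub>R x" for x b :: "'u ck"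
    by (simp add: ck_red_def linear_diff[OF lin_mult(2)[OF linear_ident]]
        linear_cmul[OF lin_mult(2)[OF linear_ident]])
  have "(\<lambda>a b. ck_mult (conv_pow k a) b) =
      (\<lambda>a b :: 'u ck. ck_mult (conv_pow k a) (ck_red b) + ck_counit b *\<^sub>R conv_pow k a)"
    by (intro ext) (rule split)
  then have "conv_pow (Suc k) h =
      cosum (\<lambda>a b. ck_mult (conv_pow k a) (ck_red b) + ck_counit b *\<^sub>R conv_pow k a) h"
    by (simp only: coiter.simps)
  then show ?thesis
    by (simp only: cosum_add cosum_counit(2)[OF linear_coiter[OF bilinear_mult linear_ident]])
qed

lemma conv_pow_binomial: "conv_pow k h = (\<Sum>n\<le>k. real (k choose n) *\<^sub>R red_pow n h)"
proof (induction k arbitrary: h)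
  case 0
  show ?case by simp
next
  case (Suc k)
  have "cosum (\<lambda>a b. ck_mult (conv_pow k a) (ck_red b)) h =
      (\<Sum>n\<le>k. real (k choose n) *\<^sub>R red_pow (Suc n) h)"
    by (simp add: Suc linear_sum[OF lin_mult(1)[OF linear_ident]] cosum_sum
        linear_cmul[OF lin_mult(1)[OF linear_ident]] cosum_scaleR)
  moreover have "conv_pow k h = red_pow 0 h + (\<Sum>n\<le>k. real (k choose Suc n) *\<^sub>R red_pow (Suc n) h)"
  proof -
    have "conv_pow k h = (\<Sum>n\<le>Suc k. real (k choose n) *\<^sub>R red_pow n h)"
      by (simp add: Suc)
    also have "\<dots> = real (k choose 0) *\<^sub>R red_pow 0 h + (\<Sum>n\<le>k. real (k choose Suc n) *\<^sub>R red_pow (Suc n) h)"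
      by (rule sum.atMost_Suc_shift)
    finally show ?thesis by simp
  qed
  ultimately have "conv_pow (Suc k) h = red_pow 0 h +
      (\<Sum>n\<le>k. real (Suc k choose Suc n) *\<^sub>R red_pow (Suc n) h)"
    unfolding conv_pow_Suc by (simp add: sum.distrib[symmetric] scaleR_add_left add.commute del: coiter.simps)
  also have "\<dots> = (\<Sum>n\<le>Suc k. real (Suc k choose n) *\<^sub>R red_pow n h)"
    by (subst sum.atMost_Suc_shift) simp
  finally show ?case .
qed

lemma conv_pow_ck:
  fixes f :: "'u::real_vector forest"
  assumes "card (verts f) \<le> N"
  shows "conv_pow k (ck f) = (\<Sum>n\<le>N. real (k choose n) *\<^sub>R red_pow n (ck f))"
proof -
  have "red_pow n (ck f) = 0" if "n > N" for n
    using locfin_red_pow[where 'a = 'u] assms that by (auto simp: locfin_def)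
  then have "(\<Sum>n\<le>N. real (k choose n) *\<^sub>R red_pow n (ck f)) =
      (\<Sum>n\<le>max N k. real (k choose n) *\<^sub>R red_pow n (ck f))"
    by (intro sum.mono_neutral_left) auto
  also have "\<dots> = (\<Sum>n\<le>k. real (k choose n) *\<^sub>R red_pow n (ck f))"
    by (intro sum.mono_neutral_right) auto
  finally show ?thesis by (simp add: conv_pow_binomial)
qed

lemma mult_mult_swap: "ck_mult (ck_mult a b) (ck_mult c d) = ck_mult (ck_mult a c) (ck_mult b d)"
  by (metis mult_assoc mult_commute)

lemma conv_pow_mult: "conv_pow k (ck_mult x y) = ck_mult (conv_pow k x) (conv_pow k y)"
proof (induction k arbitrary: x y)
  case 0
  show ?case by (simp add: ck_counit_mult linear_cmul[OF lin_mult(1)[OF linear_ident]]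
        linear_cmul[OF lin_mult(2)[OF linear_ident]])
next
  case (Suc k)
  have "conv_pow (Suc k) (ck_mult x y) =
      cosum (\<lambda>a b. cosum (\<lambda>c d. ck_mult (conv_pow k (ck_mult a c)) (ck_mult b d)) y) x"
    by (simp add: cosum_mult[OF bilinear_coiter[OF bilinear_mult linear_ident]])
  also have "\<dots> = cosum (\<lambda>a b. cosum (\<lambda>c d. ck_mult (ck_mult (conv_pow k a) b) (ck_mult (conv_pow k c) d)) y) x"
    unfolding Suc by (subst mult_mult_swap) rule
  also have "\<dots> = ck_mult (conv_pow (Suc k) x) (conv_pow (Suc k) y)"
    by (simp add: cosum_comp[OF lin_mult(2)[OF linear_ident], symmetric]
        cosum_comp[OF lin_mult(1)[OF linear_ident], symmetric])
  finally show ?case .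
qed

text \<open>The binomial coefficient \<open>X choose n\<close> as a polynomial in \<open>X\<close>.\<close>

definition binom_poly :: "nat \<Rightarrow> real poly" where
  "binom_poly n = smult (1 / fact n) (\<Prod>i<n. [:- real i, 1:])"

lemma poly_binom: "poly (binom_poly n) (real k) = real (k choose n)"
proof -
  have "real (k choose n) = (\<Prod>i<n. real k - real i) / fact n"
    using gbinomial_prod_rev[of "real k" n] by (simp add: binomial_gbinomial atLeast0LessThan)
  then show ?thesis by (simp add: binom_poly_def poly_prod)
qed

lemma coeff_binom_poly_0: "coeff (binom_poly n) 0 = (if n = 0 then 1 else 0)"
  using poly_binom[of n 0] by (simp add: poly_0_coeff_0)

lemma coeff_binom_poly_1: "coeff (binom_poly n) 1 = log_coeff n"
proof (cases n)
  case 0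
  then show ?thesis by (simp add: binom_poly_def)
next
  case (Suc m)
  have "(\<Prod>i<Suc m. [:- real i, 1:]) = pCons 0 (\<Prod>i<m. [:- real (Suc i), 1:])"
    by (subst prod.lessThan_Suc_shift) simp
  then have "coeff (\<Prod>i<Suc m. [:- real i, 1:]) 1 = poly (\<Prod>i<m. [:- real (Suc i), 1:]) 0"
    by (simp add: poly_0_coeff_0)
  also have "\<dots> = (\<Prod>i<m. - real (Suc i))"
    by (simp add: poly_prod)
  also have "\<dots> = (-1) ^ m * fact m"
    by (induction m) (simp_all add: algebra_simps)
  finally have c: "coeff (\<Prod>i<Suc m. [:- real i, 1:]) 1 = (-1) ^ m * fact m" .
  have "coeff (binom_poly n) 1 = 1 / fact (Suc m) * ((-1) ^ m * fact m)"
    by (simp only: Suc binom_poly_def coeff_smult c)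
  also have "\<dots> = (-1) ^ m / real (Suc m)"
    by (simp add: fact_Suc del: of_nat_Suc)
  finally show ?thesis using Suc by simp
qed

lemma coeff_mult_1: "coeff (p * q) 1 = coeff p 0 * coeff q 1 + coeff p 1 * coeff q 0"
  by (simp add: coeff_mult)

text \<open>This reduces the comparison of coefficients to polynomials over the reals.\<close>

lemma linear_functionals_separate:
  fixes x y :: "'a::real_vector"
  assumes "\<And>\<xi>. linear (\<xi> :: 'a \<Rightarrow> real) \<Longrightarrow> \<xi> x = \<xi> y"
  shows "x = y"
proof (rule ccontr)
  assume "x \<noteq> y"
  then have "independent {x - y}" by (simp add: dependent_single)
  then obtain g :: "'a \<Rightarrow> real" where "linear g" "g (x - y) = 1"
    using linear_independent_extend[of "{x - y}" "\<lambda>_. 1"] by auto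
  then show False using assms[of g] by (simp add: linear_diff)
qed

lemma poly_eq_on_nat:
  fixes p q :: "real poly"
  assumes "\<And>k. poly p (real k) = poly q (real k)"
  shows "p = q"
proof (rule ccontr)
  assume "p \<noteq> q"
  then have "finite {x. poly (p - q) x = 0}" by (intro poly_roots_finite) simp
  moreover have "range real \<subseteq> {x. poly (p - q) x = 0}" using assms by auto
  ultimately have "finite (range real)" by (rule finite_subset[rotated])
  then show False using finite_imageD[of real UNIV] by (simp add: inj_on_def)
qed

lemma eulerian_mult:
  "eulerian (ck_mult x y) = ck_counit x *\<^sub>R eulerian y + ck_counit y *\<^sub>R eulerian x"
proof (rule ck_eqI2[where h = x and k = y])
  show "bilinear (\<lambda>x y :: 'a ck. eulerian (ck_mult x y))"
    "bilinear (\<lambda>x y :: 'a ck. ck_counit x *\<^sub>R eulerian y + ck_counit y *\<^sub>R eulerian x)"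
    by (intro bilinearI lin linear_ck_counit linear_eulerian lin_comp[OF linear_eulerian])+
  fix f g :: "'a forest"
  define N where "N = card (verts f) + card (verts g)"
  let ?x = "ck f" and ?y = "ck g"
  show "eulerian (ck_mult ?x ?y) = ck_counit ?x *\<^sub>R eulerian ?y + ck_counit ?y *\<^sub>R eulerian ?x"
  proof (rule linear_functionals_separate)
    fix \<xi> :: "'a ck \<Rightarrow> real" assume l: "linear \<xi>"
    define X where "X n = \<xi> (red_pow n (ck_mult ?x ?y))" for n
    define Y where "Y a b = \<xi> (ck_mult (red_pow a ?x) (red_pow b ?y))" for a b
    note m = linear_sum[OF lin_mult(1)[OF linear_ident]] linear_sum[OF lin_mult(2)[OF linear_ident]]
      linear_cmul[OF lin_mult(1)[OF linear_ident]] linear_cmul[OF lin_mult(2)[OF linear_ident]]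
    have xy: "conv_pow k (ck_mult ?x ?y) = (\<Sum>n\<le>N. real (k choose n) *\<^sub>R red_pow n (ck_mult ?x ?y))"
      "eulerian (ck_mult ?x ?y) = (\<Sum>n\<le>N. log_coeff n *\<^sub>R red_pow n (ck_mult ?x ?y))" for k
      unfolding mult_ck by (rule conv_pow_ck eulerian_ck, simp add: N_def card_par)+
    have x: "conv_pow k ?x = (\<Sum>n\<le>N. real (k choose n) *\<^sub>R red_pow n ?x)"
      "eulerian ?x = (\<Sum>n\<le>N. log_coeff n *\<^sub>R red_pow n ?x)" for k
      by (rule conv_pow_ck eulerian_ck, simp add: N_def)+
    have y: "conv_pow k ?y = (\<Sum>n\<le>N. real (k choose n) *\<^sub>R red_pow n ?y)"
      "eulerian ?y = (\<Sum>n\<le>N. log_coeff n *\<^sub>R red_pow n ?y)" for k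
      by (rule conv_pow_ck eulerian_ck, simp add: N_def)+
    \<comment> \<open>both sides are the polynomial in \<open>k\<close> with the values \<open>\<xi> (conv_pow k (x y))\<close>\<close>
    have "(\<Sum>n\<le>N. smult (X n) (binom_poly n)) = (\<Sum>a\<le>N. \<Sum>b\<le>N. smult (Y a b) (binom_poly a * binom_poly b))"
    proof (rule poly_eq_on_nat)
      fix k
      have "poly (\<Sum>n\<le>N. smult (X n) (binom_poly n)) (real k) = \<xi> (conv_pow k (ck_mult ?x ?y))"
        unfolding xy by (simp add: poly_sum poly_binom X_def linear_sum[OF l] linear_cmul[OF l] mult.commute)
      also have "\<dots> = \<xi> (ck_mult (conv_pow k ?x) (conv_pow k ?y))"
        by (simp only: conv_pow_mult)
      also have "\<dots> = (\<Sum>a\<le>N. \<Sum>b\<le>N. real (k choose a) * real (k choose b) * Y a b)"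
        unfolding x y by (simp add: m linear_sum[OF l] linear_cmul[OF l] Y_def scaleR_sum_right
            sum_distrib_left mult.assoc mult.left_commute)
          (subst sum.swap, simp add: mult.left_commute)
      also have "\<dots> = poly (\<Sum>a\<le>N. \<Sum>b\<le>N. smult (Y a b) (binom_poly a * binom_poly b)) (real k)"
        by (simp add: poly_sum poly_binom mult.commute)
      finally show "poly (\<Sum>n\<le>N. smult (X n) (binom_poly n)) (real k) =
          poly (\<Sum>a\<le>N. \<Sum>b\<le>N. smult (Y a b) (binom_poly a * binom_poly b)) (real k)" .
    qed
    then have "coeff (\<Sum>n\<le>N. smult (X n) (binom_poly n)) 1 =
        coeff (\<Sum>a\<le>N. \<Sum>b\<le>N. smult (Y a b) (binom_poly a * binom_poly b)) 1" by simp
    then have "(\<Sum>n\<le>N. X n * log_coeff n) =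
        (\<Sum>a\<le>N. \<Sum>b\<le>N. Y a b * ((if a = 0 then 1 else 0) * log_coeff b + log_coeff a * (if b = 0 then 1 else 0)))"
      by (simp only: coeff_sum coeff_smult coeff_mult_1 coeff_binom_poly_0 coeff_binom_poly_1)
    also have "\<dots> = (\<Sum>b\<le>N. Y 0 b * log_coeff b) + (\<Sum>a\<le>N. Y a 0 * log_coeff a)"
    proof -
      have "(\<Sum>a\<le>N. \<Sum>b\<le>N. Y a b * ((if a = 0 then 1 else 0) * log_coeff b)) = (\<Sum>b\<le>N. Y 0 b * log_coeff b)"
        by (subst sum.remove[of _ 0]) (auto intro!: sum.neutral)
      moreover have "(\<Sum>b\<le>N. \<Sum>a\<le>N. Y a b * (log_coeff a * (if b = 0 then 1 else 0))) = (\<Sum>a\<le>N. Y a 0 * log_coeff a)"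
        by (subst sum.remove[of _ 0]) (auto intro!: sum.neutral)
      ultimately show ?thesis
        by (simp only: distrib_left sum.distrib sum.swap[of "\<lambda>a b. Y a b * (log_coeff a * _ b)"])
    qed
    finally have "(\<Sum>n\<le>N. X n * log_coeff n) = (\<Sum>b\<le>N. Y 0 b * log_coeff b) + (\<Sum>a\<le>N. Y a 0 * log_coeff a)" .
    moreover have "\<xi> (eulerian (ck_mult ?x ?y)) = (\<Sum>n\<le>N. X n * log_coeff n)"
      unfolding xy by (simp only: X_def linear_sum[OF l] linear_cmul[OF l] real_scaleR_def mult.commute)
    moreover have "\<xi> (ck_counit ?x *\<^sub>R eulerian ?y) = (\<Sum>b\<le>N. Y 0 b * log_coeff b)"
      unfolding y by (simp only: Y_def coiter.simps(1) m mult_one linear_sum[OF l] linear_cmul[OF l]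
          real_scaleR_def sum_distrib_left) (simp add: mult.commute mult.left_commute)
    moreover have "\<xi> (ck_counit ?y *\<^sub>R eulerian ?x) = (\<Sum>a\<le>N. Y a 0 * log_coeff a)"
      unfolding x by (simp only: Y_def coiter.simps(1) m mult_one linear_sum[OF l] linear_cmul[OF l]
          real_scaleR_def sum_distrib_left) (simp add: mult.commute mult.left_commute)
    ultimately show "\<xi> (eulerian (ck_mult ?x ?y)) =
        \<xi> (ck_counit ?x *\<^sub>R eulerian ?y + ck_counit ?y *\<^sub>R eulerian ?x)"
      by (simp only: linear_add[OF l])
  qed
qed

section \<open>The logarithm\<close>

definition log_letter :: "'u::real_vector ck \<Rightarrow> 'u prim" where
  "log_letter h = ck_pi (eulerian h)"

lemma linear_log_letter: "linear log_letter"
  unfolding log_letter_def[abs_def] ck_pi by (rule lin_comp[OF linear_prim_part linear_eulerian])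

lemma log_letter_one [simp]: "log_letter ck_one = 0"
  by (simp add: log_letter_def ck_pi linear_0[OF linear_prim_part])

lemma ck_pi_prim: "ck_pi (Rep_prim p) = p"
  using prim_part_top[of ck_one p] by (simp add: ck_pi)

lemma log_letter_prim [simp]: "log_letter (Rep_prim p) = p"
  by (simp add: log_letter_def eulerian_prim ck_pi_prim)

lemma log_letter_mult:
  "log_letter (ck_mult x y) = ck_counit x *\<^sub>R log_letter y + ck_counit y *\<^sub>R log_letter x"
  by (simp add: log_letter_def ck_pi eulerian_mult linear_add[OF linear_prim_part]
      linear_cmul[OF linear_prim_part])

definition log_map :: "'u::real_vector ck \<Rightarrow> 'u prim tens" where
  "log_map = cofree_lift log_letter"

lemmas linear_log = linear_lift[OF linear_log_letter log_letter_one, folded log_map_def]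
  and log_rec = lift_rec[OF linear_log_letter log_letter_one, folded log_map_def]
  and log_one = lift_one[OF linear_log_letter log_letter_one, folded log_map_def]
  and counit_log = counit_lift[OF linear_log_letter log_letter_one, folded log_map_def]
  and pi_log = pi_lift[OF linear_log_letter log_letter_one, folded log_map_def]
  and deconc_log = deconc_lift[OF linear_log_letter log_letter_one, folded log_map_def]

lemmas lin_log [lin] = lin_comp[OF linear_log] lin_comp[OF linear_log_letter] linear_log_letter

lemma cosum_swap:
  fixes Q :: "'u::real_vector ck \<Rightarrow> 'u ck \<Rightarrow> 'v::real_vector ck \<Rightarrow> 'v ck \<Rightarrow> 'c::real_vector"
  shows "cosum (\<lambda>a b. cosum (\<lambda>c d. Q a b c d) y) x = cosum (\<lambda>c d. cosum (\<lambda>a b. Q a b c d) x) y"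
proof -
  have u: "cosum B x = (\<Sum>f\<in>Poly_Mapping.keys (rep_ck x). Poly_Mapping.lookup (rep_ck x) f *\<^sub>R
      (\<Sum>A\<in>cuts f. B (pruned f A) (trunk f A)))" for B :: "_ \<Rightarrow> _ \<Rightarrow> 'c"
    by (simp add: cosum_def ck_lin_def lin_ext_def)
  show ?thesis unfolding u by (simp add: cosum_sum cosum_scaleR)
qed

lemma shuffle_cosum:
  "tens_shuffle (cosum (\<lambda>a b. snoc (L a) (\<phi> b)) x) (cosum (\<lambda>c d. snoc (M c) (\<psi> d)) y) =
    cosum (\<lambda>a b. snoc (tens_shuffle (L a) (cosum (\<lambda>c d. snoc (M c) (\<psi> d)) y)) (\<phi> b)) x +
    cosum (\<lambda>c d. snoc (tens_shuffle (cosum (\<lambda>a b. snoc (L a) (\<phi> b)) x) (M c)) (\<psi> d)) y"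
proof -
  let ?l = "\<lambda>a b. snoc (L a) (\<phi> b)" and ?r = "\<lambda>c d. snoc (M c) (\<psi> d)"
  have "tens_shuffle (cosum ?l x) (cosum ?r y) = cosum (\<lambda>a b. cosum (\<lambda>c d. tens_shuffle (?l a b) (?r c d)) y) x"
    by (subst cosum_swap)
      (simp only: cosum_comp[OF lin_shuffle(1)[OF linear_ident]] cosum_comp[OF lin_shuffle(2)[OF linear_ident]])
  also have "\<dots> = cosum (\<lambda>a b. cosum (\<lambda>c d. snoc (tens_shuffle (L a) (?r c d)) (\<phi> b)) y) x +
      cosum (\<lambda>a b. cosum (\<lambda>c d. snoc (tens_shuffle (?l a b) (M c)) (\<psi> d)) y) x"
    by (simp only: shuffle_conc_letter cosum_add)
  also have "cosum (\<lambda>a b. cosum (\<lambda>c d. snoc (tens_shuffle (L a) (?r c d)) (\<phi> b)) y) x =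
      cosum (\<lambda>a b. snoc (tens_shuffle (L a) (cosum ?r y)) (\<phi> b)) x"
    by (simp only: cosum_comp[OF lin_shuffle(2)[OF linear_ident]] cosum_comp[OF lin_conc(1)[OF linear_ident]])
  also have "cosum (\<lambda>a b. cosum (\<lambda>c d. snoc (tens_shuffle (?l a b) (M c)) (\<psi> d)) y) x =
      cosum (\<lambda>c d. snoc (tens_shuffle (cosum ?l x) (M c)) (\<psi> d)) y"
    by (subst cosum_swap)
      (simp only: cosum_comp[OF lin_shuffle(1)[OF linear_ident]] cosum_comp[OF lin_conc(1)[OF linear_ident]])
  finally show ?thesis .
qed

text \<open>Both sides satisfy the same recursion.  As \<open>log_letter\<close> is a derivation over the counit, the last letter of
  the logarithm of \<open>x y\<close> is \<open>log_letter x''\<close> or \<open>log_letter y''\<close>, and by induction the rest is a shuffle; the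
  last letter of a shuffle comes from one of the two factors in the same way.\<close>

lemma log_mult: "log_map (ck_mult x y) = tens_shuffle (log_map x) (log_map y)"
proof (rule ck_eqI2[where h = x and k = y])
  show "bilinear (\<lambda>x y :: 'a ck. log_map (ck_mult x y))"
    "bilinear (\<lambda>x y :: 'a ck. tens_shuffle (log_map x) (log_map y))"
    by (intro bilinearI lin linear_log)+
  fix f g :: "'a forest"
  show "log_map (ck_mult (ck f) (ck g)) = tens_shuffle (log_map (ck f)) (log_map (ck g))"
  proof (induction "card (verts f) + card (verts g)" arbitrary: f g rule: less_induct)
    case less
    let ?x = "ck f" and ?y = "ck g"
    show ?case
    proof (cases "verts f = {} \<or> verts g = {}")
      case True
      then show ?thesis by (auto simp: ck_empty log_one)
    next
      case False
      then have f: "verts f \<noteq> {}" and g: "verts g \<noteq> {}" by auto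
      have b: "bilinear (\<lambda>a b. snoc (log_map a) (log_letter b))"
        by (intro bilinearI lin linear_log)
      have bx: "bilinear (\<lambda>a b. snoc (log_map (ck_mult a ?y)) (log_letter b))"
        "bilinear (\<lambda>a b. snoc (tens_shuffle (log_map a) (log_map ?y)) (log_letter b))"
        by (intro bilinearI lin linear_log)+
      have by_y: "bilinear (\<lambda>c d. snoc (log_map (ck_mult ?x c)) (log_letter d))"
        "bilinear (\<lambda>c d. snoc (tens_shuffle (log_map ?x) (log_map c)) (log_letter d))"
        by (intro bilinearI lin linear_log)+
      have lx: "linear (\<lambda>a. cosum (\<lambda>c d. snoc (log_map (ck_mult a c)) (log_letter d)) ?y)"
        and ly: "\<And>b. linear (\<lambda>c. snoc (log_map (ck_mult b c)) z)" for z
        by (intro lin)+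
      have "log_map (ck_mult ?x ?y) =
          cosum (\<lambda>a b. cosum (\<lambda>c d. snoc (log_map (ck_mult a c)) (log_letter (ck_mult b d))) ?y) ?x"
        by (subst log_rec) (simp add: cosum_mult[OF b] ck_counit_mult f)
      also have "\<dots> = cosum (\<lambda>a b. ck_counit b *\<^sub>R cosum (\<lambda>c d. snoc (log_map (ck_mult a c)) (log_letter d)) ?y) ?x +
          cosum (\<lambda>a b. cosum (\<lambda>c d. ck_counit d *\<^sub>R snoc (log_map (ck_mult a c)) (log_letter b)) ?y) ?x"
        by (simp only: log_letter_mult linear_add[OF lin_conc(2)[OF lin_word_simps(1)[OF linear_ident]]]
            linear_cmul[OF lin_conc(2)[OF lin_word_simps(1)[OF linear_ident]]] cosum_add cosum_scaleR)
      also have "cosum (\<lambda>a b. cosum (\<lambda>c d. ck_counit d *\<^sub>R snoc (log_map (ck_mult a c)) (log_letter b)) ?y) ?x =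
          cosum (\<lambda>a b. snoc (log_map (ck_mult a ?y)) (log_letter b)) ?x"
        by (simp only: cosum_counit(2)[OF ly])
      also have "cosum (\<lambda>a b. ck_counit b *\<^sub>R cosum (\<lambda>c d. snoc (log_map (ck_mult a c)) (log_letter d)) ?y) ?x =
          cosum (\<lambda>c d. snoc (log_map (ck_mult ?x c)) (log_letter d)) ?y"
        by (rule cosum_counit(2)[OF lx])
      also have "\<dots> = cosum (\<lambda>c d. snoc (tens_shuffle (log_map ?x) (log_map c)) (log_letter d)) ?y"
        unfolding cosum_proper[OF by_y(1) g] cosum_proper[OF by_y(2) g]
        using less[of f] proper_cut_card(1)[of _ g] by (simp add: log_one)
      also have "cosum (\<lambda>a b. snoc (log_map (ck_mult a ?y)) (log_letter b)) ?x =
          cosum (\<lambda>a b. snoc (tens_shuffle (log_map a) (log_map ?y)) (log_letter b)) ?x"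
        unfolding cosum_proper[OF bx(1) f] cosum_proper[OF bx(2) f]
        using less[of _ g] proper_cut_card(1)[of _ f] by (simp add: log_one)
      also have "cosum (\<lambda>c d. snoc (tens_shuffle (log_map ?x) (log_map c)) (log_letter d)) ?y +
          cosum (\<lambda>a b. snoc (tens_shuffle (log_map a) (log_map ?y)) (log_letter b)) ?x =
          tens_shuffle (log_map ?x) (log_map ?y)"
      proof -
        have e: "log_map ?x = cosum (\<lambda>a b. snoc (log_map a) (log_letter b)) ?x"
          "log_map ?y = cosum (\<lambda>a b. snoc (log_map a) (log_letter b)) ?y"
          using log_rec[of ?x] log_rec[of ?y] f g by simp_all
        show ?thesis
          by (rule trans[OF add.commute
                shuffle_cosum[of log_map log_letter ?x log_map log_letter ?y, folded e, symmetric]])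
      qed
      finally show ?thesis .
    qed
  qed
qed

section \<open>The logarithm on the tensor coalgebra\<close>

text \<open>The logarithm in the coordinates given by natural growth.\<close>

definition tens_log :: "'u::real_vector prim tens \<Rightarrow> 'u prim tens" where
  "tens_log t = log_map (growth t)"

lemma linear_tens_log: "linear tens_log"
  unfolding tens_log_def[abs_def] by (rule lin_comp[OF linear_log linear_growth])

lemmas lin_tens_log [lin] = lin_comp[OF linear_tens_log]

definition block_letter :: "'u::real_vector prim list \<Rightarrow> 'u prim" where
  "block_letter ps = log_letter (growth (word ps))"

lemma block_letter_simps [simp]: "block_letter [] = 0" "block_letter [p] = p"
  by (simp_all add: block_letter_def)

lemma lin_block_letter: "linear (\<lambda>a. block_letter (xs @ a # ys))"
  unfolding block_letter_def by (intro lin lin_comp[OF linear_growth])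

lemma tens_log_word:
  "tens_log (word ps) = (if ps = [] then word [] else 0) +
    (\<Sum>i\<le>length ps. snoc (tens_log (word (take i ps))) (block_letter (drop i ps)))"
proof -
  have b: "bilinear (\<lambda>a b. snoc (log_map a) (log_letter b))"
    by (intro bilinearI lin linear_log)
  have "cosum (\<lambda>a b. snoc (log_map a) (log_letter b)) (growth (word ps)) =
      (\<Sum>i\<le>length ps. snoc (tens_log (word (take i ps))) (block_letter (drop i ps)))"
    by (simp only: cosum_pair_lin[OF b] cop_growth deconc_word linear_sum[OF linear_tens_map[OF linear_growth]]
        tens_map_word[OF linear_growth] linear_sum[OF linear_pair_lin[OF b]] list.map pair_lin_word[OF b]
        tens_log_def block_letter_def)
  then show ?thesis
    using log_rec[of "growth (word ps)"] by (simp add: tens_log_def counit_growth)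
qed

definition compositions :: "nat \<Rightarrow> nat \<Rightarrow> nat list set" where
  "compositions m n = {ms. length ms = m \<and> (\<forall>x\<in>set ms. 1 \<le> x) \<and> sum_list ms = n}"

lemma compositions_0: "compositions 0 n = (if n = 0 then {[]} else {})"
  by (auto simp: compositions_def)

lemma compositions_snoc: "ms @ [k] \<in> compositions (Suc m) n \<longleftrightarrow> 1 \<le> k \<and> k \<le> n \<and> ms \<in> compositions m (n - k)"
  by (auto simp: compositions_def)

lemma compositions_le: "ms \<in> compositions m n \<Longrightarrow> m \<le> n"
proof (induction m arbitrary: ms n)
  case (Suc m)
  then obtain k ms' where ms: "ms = ms' @ [k]"
    by (cases ms rule: rev_cases) (auto simp: compositions_def)
  then have k: "1 \<le> k" "k \<le> n" "ms' \<in> compositions m (n - k)" using Suc.prems by (simp_all add: compositions_snoc)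
  have "m \<le> n - k" by (rule Suc.IH[OF k(3)])
  then show ?case using k by simp
qed simp

lemma compositions_bij:
  "bij_betw (\<lambda>(i, ms). ms @ [n - i]) (SIGMA i:{..<n}. compositions m i) (compositions (Suc m) n)"
proof (rule bij_betwI')
  fix ms assume ms: "ms \<in> compositions (Suc m) n"
  then obtain ms' k where e: "ms = ms' @ [k]"
    by (cases ms rule: rev_cases) (auto simp: compositions_def)
  then have k: "1 \<le> k" "k \<le> n" "ms' \<in> compositions m (n - k)" using ms by (simp_all add: compositions_snoc)
  then show "\<exists>x\<in>(SIGMA i:{..<n}. compositions m i). ms = (case x of (i, ms) \<Rightarrow> ms @ [n - i])"
    by (intro bexI[of _ "(n - k, ms')"]) (auto simp: e)
qed (auto simp: compositions_snoc compositions_def)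

lemma finite_compositions [simp]: "finite (compositions m n)"
proof (induction m arbitrary: n)
  case 0
  show ?case by (simp add: compositions_0)
next
  case (Suc m)
  then have "finite (SIGMA i:{..<n}. compositions m i)" by (intro finite_SigmaI) auto
  then show ?case using compositions_bij bij_betw_finite by blast
qed

lemma compositions_same: "compositions n n = {replicate n 1}"
proof (induction n)
  case 0
  show ?case by (simp add: compositions_0)
next
  case (Suc n)
  have "ms = replicate (Suc n) 1" if ms: "ms \<in> compositions (Suc n) (Suc n)" for ms
  proof -
    obtain ms' k where e: "ms = ms' @ [k]"
      using ms by (cases ms rule: rev_cases) (auto simp: compositions_def)
    then have k: "1 \<le> k" "k \<le> Suc n" "ms' \<in> compositions n (Suc n - k)" using ms by (simp_all add: compositions_snoc)
    then have "k = 1" using compositions_le[OF k(3)] by simp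
    then show ?thesis using k Suc e by (simp add: replicate_append_same)
  qed
  moreover have "replicate (Suc n) 1 \<in> compositions (Suc n) (Suc n)"
    by (auto simp: compositions_def sum_list_replicate)
  ultimately show ?case by blast
qed

lemma blocks_snoc: "blocks (ms @ [k]) ps = blocks ms ps @ [take k (drop (sum_list ms) ps)]"
  by (induction ms arbitrary: ps) (simp_all add: add.commute)

lemma blocks_take: "sum_list ms \<le> i \<Longrightarrow> blocks ms (take i ps) = blocks ms ps"
  by (induction ms arbitrary: ps i) (simp_all add: drop_take min_def)

lemma length_blocks [simp]: "length (blocks ms ps) = length ms"
  by (induction ms arbitrary: ps) simp_all

lemma proj_snoc: "tens_proj (Suc m) (snoc t v) = snoc (tens_proj m t) v" "tens_proj 0 (snoc t v) = 0"
  by (rule tens_eqI[where t = t], intro lin, intro lin linear_tens_proj, simp)+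

text \<open>The last-letter recursion cuts off the last block of the word; unrolling it gives all ways of cutting the
  word into \<open>m\<close> non-empty blocks.\<close>

lemma proj_tens_log:
  "tens_proj m (tens_log (word ps)) = (\<Sum>ms\<in>compositions m (length ps). word (map block_letter (blocks ms ps)))"
proof (induction m arbitrary: ps)
  case 0
  show ?case
    by (subst tens_log_word) (simp add: linear_add[OF linear_tens_proj] linear_sum[OF linear_tens_proj]
        proj_snoc compositions_0 linear_0[OF linear_tens_proj])
next
  case (Suc m)
  let ?n = "length ps"
  have "tens_proj (Suc m) (tens_log (word ps)) =
      (\<Sum>i\<le>?n. snoc (tens_proj m (tens_log (word (take i ps)))) (block_letter (drop i ps)))"
    by (subst tens_log_word) (simp add: linear_add[OF linear_tens_proj] linear_sum[OF linear_tens_proj]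
        proj_snoc linear_0[OF linear_tens_proj])
  also have "\<dots> = (\<Sum>i<?n. snoc (tens_proj m (tens_log (word (take i ps)))) (block_letter (drop i ps)))"
    by (rule sum.mono_neutral_right) (auto simp: not_less)
  also have "\<dots> = (\<Sum>i<?n. \<Sum>ms\<in>compositions m i. word (map block_letter (blocks (ms @ [?n - i]) ps)))"
  proof (rule sum.cong[OF refl])
    fix i assume i: "i \<in> {..<?n}"
    have "snoc (word (map block_letter (blocks ms (take i ps)))) (block_letter (drop i ps)) =
        word (map block_letter (blocks (ms @ [?n - i]) ps))" if "ms \<in> compositions m i" for ms
      using that i by (simp add: compositions_def blocks_snoc blocks_take)
    moreover have "length (take i ps) = i" using i by simp
    ultimately show "snoc (tens_proj m (tens_log (word (take i ps)))) (block_letter (drop i ps)) =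
        (\<Sum>ms\<in>compositions m i. word (map block_letter (blocks (ms @ [?n - i]) ps)))"
      by (simp only: Suc linear_sum[OF lin_conc(1)[OF linear_ident]] cong: sum.cong)
  qed
  also have "\<dots> = (\<Sum>(i, ms)\<in>(SIGMA i:{..<?n}. compositions m i). word (map block_letter (blocks (ms @ [?n - i]) ps)))"
    by (rule sum.Sigma) auto
  also have "\<dots> = (\<Sum>ms\<in>compositions (Suc m) ?n. word (map block_letter (blocks ms ps)))"
    using sum.reindex_bij_betw[OF compositions_bij, of "\<lambda>ms. word (map block_letter (blocks ms ps))" ?n m]
    by (simp add: case_prod_unfold)
  finally show ?case .
qed

lemma multilin_blocks:
  "multilin (\<lambda>ps. if length ps = sum_list ms then word (map block_letter (blocks ms ps)) else 0)"
proof (rule multilinI)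
  fix xs ys :: "'a prim list"
  have "linear (\<lambda>a. word (us @ map block_letter (blocks ms (xs @ a # ys))))"
    if "Suc (length xs + length ys) = sum_list ms" for us
    using that
  proof (induction ms arbitrary: us xs)
    case (Cons m ms)
    show ?case
    proof (cases "m \<le> length xs")
      case True
      then show ?thesis
        using Cons.IH[of "drop m xs" "us @ [block_letter (take m xs)]"] Cons.prems by simp
    next
      case False
      then obtain j where j: "m - length xs = Suc j" by (metis Suc_diff_Suc not_le)
      then show ?thesis using False
        by (simp add: lin_word[OF lin_block_letter])
    qed
  qed simp
  from this[of "[]"] show "linear (\<lambda>a. if length (xs @ a # ys) = sum_list ms
      then word (map block_letter (blocks ms (xs @ a # ys))) else 0)"
    by (cases "Suc (length xs + length ys) = sum_list ms") (simp_all add: linear_zero)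
qed

lemma linear_block_op: "linear (block_op ms :: 'u::real_vector prim tens \<Rightarrow> _)"
  and block_op_word: "block_op ms (word (ps :: 'u prim list)) =
    (if length ps = sum_list ms then word (map block_letter (blocks ms ps)) else 0)"
  using tens_lin[OF multilin_blocks[where 'a = 'u and ms = ms]]
  unfolding block_op_def block_letter_def log_letter_def by auto

lemmas lin_block_op [lin] = lin_comp[OF linear_block_op]

lemma block_op_proj: "block_op ms (tens_proj n t) = (if n = sum_list ms then block_op ms t else 0)"
  by (rule tens_eqI[where t = t], intro lin, intro lin linear_block_op)
    (auto simp: block_op_word linear_0[OF linear_block_op])

lemma proj_block_op: "tens_proj m (block_op ms t) = (if m = length ms then block_op ms t else 0)"
  by (rule tens_eqI[where t = t], intro lin linear_block_op, intro lin linear_block_op)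
    (auto simp: block_op_word linear_0[OF linear_tens_proj])

definition log_comp :: "nat \<Rightarrow> nat \<Rightarrow> 'u::real_vector prim tens \<Rightarrow> 'u prim tens" where
  "log_comp m n t = (\<Sum>ms\<in>compositions m n. block_op ms t)"

lemma linear_log_comp: "linear (log_comp m n)"
  unfolding log_comp_def[abs_def] by (intro lin linear_block_op)

lemma proj_proj: "tens_proj m (tens_proj n t) = (if m = n then tens_proj n t else 0)"
  by (rule tens_eqI[where t = t], intro lin linear_tens_proj, intro lin linear_tens_proj)
    (auto simp: linear_0[OF linear_tens_proj])

lemma proj_tens_log_proj: "tens_proj m (tens_log (tens_proj n t)) = log_comp m n t"
proof (rule tens_eqI[where t = t])
  fix ps :: "'a prim list"
  show "tens_proj m (tens_log (tens_proj n (word ps))) = log_comp m n (word ps)"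
    by (auto simp: proj_tens_log log_comp_def block_op_word compositions_def linear_0[OF linear_tens_log]
        linear_0[OF linear_tens_proj])
qed (intro lin linear_tens_proj linear_log_comp)+

lemma proj_log_comp: "tens_proj k (log_comp m n t) = (if k = m then log_comp m n t else 0)"
  unfolding proj_tens_log_proj[symmetric] proj_proj by simp

lemma log_comp_proj: "log_comp m n (tens_proj k t) = (if k = n then log_comp m n t else 0)"
  unfolding proj_tens_log_proj[symmetric] proj_proj
  by (simp add: linear_0[OF linear_tens_proj] linear_0[OF linear_tens_log])

lemma log_comp_0: "m > n \<Longrightarrow> log_comp m n t = 0" "n > 0 \<Longrightarrow> log_comp 0 n t = 0"
  using compositions_le[of _ m n] unfolding log_comp_def by (auto simp: compositions_0 intro!: sum.neutral)

lemma log_comp_same: "log_comp n n t = tens_proj n t"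
proof (rule tens_eqI[where t = t, OF linear_log_comp linear_tens_proj])
  fix ps :: "'a prim list"
  have "map block_letter (blocks (replicate (length ps) 1) ps) = ps"
    by (induction ps) simp_all
  then show "log_comp n n (word ps) = tens_proj n (word ps)"
    by (auto simp: log_comp_def compositions_same block_op_word sum_list_replicate)
qed

lemma proj_sum: "\<exists>N. \<forall>M\<ge>N. t = (\<Sum>n\<le>M. tens_proj n t) \<and> (\<forall>n>M. tens_proj n t = 0)"
  using span_words[of t]
proof (induction rule: span_induct_alt)
  case base
  show ?case by (simp add: linear_0[OF linear_tens_proj])
next
  case (step c x y)
  then obtain ps where x: "x = word ps" by blast
  obtain N where N: "\<And>M. M \<ge> N \<Longrightarrow> y = (\<Sum>n\<le>M. tens_proj n y)" "\<And>M n. M \<ge> N \<Longrightarrow> n > M \<Longrightarrow> tens_proj n y = 0"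
    using step by blast
  show ?case
  proof (intro exI[of _ "max N (length ps)"] allI impI conjI)
    fix M assume M: "M \<ge> max N (length ps)"
    then have "x = (\<Sum>n\<le>M. tens_proj n x)" by (simp add: x)
    then have e: "c *\<^sub>R x + y = c *\<^sub>R (\<Sum>n\<le>M. tens_proj n x) + (\<Sum>n\<le>M. tens_proj n y)"
      using N(1)[of M] M by simp
    have "(\<Sum>n\<le>M. tens_proj n (c *\<^sub>R x + y)) = c *\<^sub>R (\<Sum>n\<le>M. tens_proj n x) + (\<Sum>n\<le>M. tens_proj n y)"
      by (simp add: linear_add[OF linear_tens_proj] linear_cmul[OF linear_tens_proj] sum.distrib scaleR_sum_right)
    then show "c *\<^sub>R x + y = (\<Sum>n\<le>M. tens_proj n (c *\<^sub>R x + y))"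
      by (rule e[THEN trans, OF sym])
    fix n assume "n > M"
    then show "tens_proj n (c *\<^sub>R x + y) = 0"
      using N(2)[of M n] M by (simp add: linear_add[OF linear_tens_proj] linear_cmul[OF linear_tens_proj] x)
  qed
qed

lemma sum_proj:
  assumes "\<And>m. m \<notin> K \<Longrightarrow> tens_proj m t = 0" "finite K"
  shows "t = (\<Sum>m\<in>K. tens_proj m t)"
proof -
  obtain N where N: "t = (\<Sum>n\<le>N. tens_proj n t)" "\<And>n. n > N \<Longrightarrow> tens_proj n t = 0"
    using proj_sum[of t] by blast
  have "(\<Sum>n\<le>N. tens_proj n t) = (\<Sum>n\<in>{..N} \<union> K. tens_proj n t)"
    using N(2) assms(2) by (intro sum.mono_neutral_left) auto
  also have "\<dots> = (\<Sum>n\<in>K. tens_proj n t)"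
    using assms by (intro sum.mono_neutral_right) auto
  finally show ?thesis using N(1) by simp
qed

lemma tens_log_proj: "tens_log (tens_proj n t) = (\<Sum>m\<le>n. log_comp m n t)"
  using sum_proj[of "{..n}" "tens_log (tens_proj n t)"]
  by (simp add: proj_tens_log_proj log_comp_0 not_le[symmetric])

lemma tens_log_proj_pos:
  assumes "n \<ge> 1"
  shows "tens_log (tens_proj n t) = (\<Sum>m\<in>{1..<n}. log_comp m n t) + tens_proj n t"
proof -
  have "{..n} = insert 0 (insert n {1..<n})" using assms by auto
  then show ?thesis using assms by (simp add: tens_log_proj log_comp_0 log_comp_same add.commute)
qed

text \<open>The components \<open>log_comp m n\<close> form a triangular matrix whose diagonal entries are identities.\<close>

lemma bij_tens_log: "bij (tens_log :: 'u::real_vector prim tens \<Rightarrow> _)"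
  unfolding bij_def
proof
  show "inj (tens_log :: 'u prim tens \<Rightarrow> _)"
    unfolding linear_injective_0[OF linear_tens_log]
  proof (intro allI impI, rule ccontr)
    fix t :: "'u prim tens" assume t: "tens_log t = 0" "t \<noteq> 0"
    obtain K where K: "t = (\<Sum>n\<le>K. tens_proj n t)" "\<And>n. n > K \<Longrightarrow> tens_proj n t = 0"
      using proj_sum[of t] by blast
    then have ex: "\<exists>n. tens_proj n t \<noteq> 0" using t(2) by (metis sum.neutral)
    \<comment> \<open>the longest words of \<open>t\<close> cannot be cancelled, as all other contributions are shorter\<close>
    define N where "N = (GREATEST n. tens_proj n t \<noteq> 0)"
    have le: "n \<le> K" if "tens_proj n t \<noteq> 0" for n using K(2) that by (metis not_le)
    have N: "tens_proj N t \<noteq> 0"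
      unfolding N_def using GreatestI_ex_nat[of "\<lambda>n. tens_proj n t \<noteq> 0" K] ex le by blast
    have mx: "tens_proj n t = 0" if "n > N" for n
      using Greatest_le_nat[of "\<lambda>n. tens_proj n t \<noteq> 0" n K] le that unfolding N_def by (metis not_le)
    have "tens_proj N (tens_log t) = tens_proj N (tens_log (\<Sum>n\<le>K. tens_proj n t))"
      using K(1) by metis
    also have "\<dots> = (\<Sum>n\<le>K. log_comp N n t)"
      by (simp add: linear_sum[OF linear_tens_log] linear_sum[OF linear_tens_proj] proj_tens_log_proj)
    also have "\<dots> = (\<Sum>n\<in>{N}. log_comp N n t)"
    proof (rule sum.mono_neutral_right)
      show "\<forall>n\<in>{..K} - {N}. log_comp N n t = 0"
      proof
        fix n assume n: "n \<in> {..K} - {N}"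
        show "log_comp N n t = 0"
        proof (cases "n < N")
          case False
          then have "tens_proj n t = 0" using n mx by auto
          have "log_comp N n t = log_comp N n (tens_proj n t)" by (simp add: log_comp_proj)
          then show ?thesis using \<open>tens_proj n t = 0\<close> by (simp add: linear_0[OF linear_log_comp])
        qed (simp add: log_comp_0)
      qed
    qed (use N le in auto)
    finally show False using N t(1) by (simp add: log_comp_same linear_0[OF linear_tens_proj])
  qed
  have sub: "subspace (range tens_log)" by (rule linear_subspace_image[OF linear_tens_log subspace_UNIV])
  have r: "tens_proj n t \<in> range tens_log" for n and t :: "'u prim tens"
  proof (induction n arbitrary: t rule: less_induct)
    case (less n)
    have e: "tens_proj n t = tens_log (tens_proj n t) - (\<Sum>m<n. log_comp m n t)"
      unfolding tens_log_proj by (simp add: lessThan_Suc_atMost[symmetric] log_comp_same)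
    have "log_comp m n t \<in> range tens_log" if "m < n" for m
      using less[OF that, of "log_comp m n t"] by (simp add: proj_log_comp)
    then have "(\<Sum>m<n. log_comp m n t) \<in> range tens_log"
      by (intro subspace_sum[OF sub]) simp
    from subspace_diff[OF sub rangeI this] show ?case
      by (subst e)
  qed
  have "t \<in> range tens_log" for t :: "'u prim tens"
  proof -
    obtain N where "t = (\<Sum>n\<le>N. tens_proj n t)" using proj_sum[of t] by blast
    moreover have "(\<Sum>n\<le>N. tens_proj n t) \<in> range tens_log" by (intro subspace_sum[OF sub] r)
    ultimately show ?thesis by metis
  qed
  then show "surj (tens_log :: 'u prim tens \<Rightarrow> _)" by blast
qed

lemma linear_inv:
  assumes "linear F" "bij F"
  shows "linear (inv F)"
proof (rule linearI)
  fix x y c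
  have "F (inv F x) = x" for x using assms(2) by (simp add: bij_is_surj surj_f_inv_f)
  then have "F (inv F x + inv F y) = x + y" "F (c *\<^sub>R inv F x) = c *\<^sub>R x"
    by (simp_all add: linear_add[OF assms(1)] linear_cmul[OF assms(1)])
  then show "inv F (x + y) = inv F x + inv F y" "inv F (c *\<^sub>R x) = c *\<^sub>R inv F x"
    using assms(2) by (metis bij_is_inj inv_f_f)+
qed

definition tens_exp :: "'u::real_vector prim tens \<Rightarrow> 'u prim tens" where
  "tens_exp = inv tens_log"

lemma linear_tens_exp: "linear tens_exp"
  unfolding tens_exp_def by (rule linear_inv[OF linear_tens_log bij_tens_log])

lemma tens_exp_log [simp]: "tens_exp (tens_log t) = t"
  by (simp add: tens_exp_def bij_is_inj[OF bij_tens_log])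

lemma tens_log_exp [simp]: "tens_log (tens_exp t) = t"
  by (simp add: tens_exp_def bij_is_surj[OF bij_tens_log] surj_f_inv_f)

lemma tens_exp_rec:
  assumes "n \<ge> 1"
  shows "tens_exp (tens_proj n t) = tens_proj n t - (\<Sum>k\<in>{1..<n}. tens_exp (log_comp k n t))"
proof -
  have "tens_proj n t = tens_exp ((\<Sum>m\<in>{1..<n}. log_comp m n t) + tens_proj n t)"
    unfolding tens_log_proj_pos[OF assms, symmetric] by simp
  then have "tens_proj n t = (\<Sum>k\<in>{1..<n}. tens_exp (log_comp k n t)) + tens_exp (tens_proj n t)"
    by (simp only: linear_add[OF linear_tens_exp] linear_sum[OF linear_tens_exp])
  then show ?thesis by (metis add_diff_cancel_left')
qed

lemma proj_tens_exp:
  assumes "n \<ge> 1" "m = 0 \<or> m \<ge> n"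
  shows "tens_proj m (tens_exp (tens_proj n t)) = (if m = n then tens_proj n t else 0)"
  using assms
proof (induction n arbitrary: t rule: less_induct)
  case (less n)
  have "tens_proj m (tens_exp (log_comp k n t)) = 0" if "k \<in> {1..<n}" for k
    using less.IH[of k "log_comp k n t"] that less.prems by (auto simp: proj_log_comp)
  then show ?case using less.prems
    by (subst tens_exp_rec) (auto simp: linear_diff[OF linear_tens_proj] linear_sum[OF linear_tens_proj] proj_proj)
qed

lemma tens_exp_proj_sum:
  assumes "n \<ge> 1"
  shows "tens_exp (tens_proj n t) = (\<Sum>m=1..n. tens_proj m (tens_exp (tens_proj n t)))"
  by (rule sum_proj) (use assms proj_tens_exp[OF assms, of _ t] in \<open>auto simp: not_le\<close>)

lemma tens_exp_comp_rec:
  assumes "1 \<le> m" "m < n"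
  shows "tens_proj m (tens_exp (tens_proj n t)) = - (\<Sum>k\<in>{m..<n}. tens_proj m (tens_exp (log_comp k n t)))"
proof -
  have "tens_proj m (tens_exp (tens_proj n t)) = - (\<Sum>k\<in>{1..<n}. tens_proj m (tens_exp (log_comp k n t)))"
    using assms by (subst tens_exp_rec)
      (auto simp: linear_diff[OF linear_tens_proj] linear_sum[OF linear_tens_proj] proj_proj)
  also have "(\<Sum>k\<in>{1..<n}. tens_proj m (tens_exp (log_comp k n t))) =
      (\<Sum>k\<in>{m..<n}. tens_proj m (tens_exp (log_comp k n t)))"
  proof (rule sum.mono_neutral_right)
    show "\<forall>k\<in>{1..<n} - {m..<n}. tens_proj m (tens_exp (log_comp k n t)) = 0"
    proof
      fix k assume "k \<in> {1..<n} - {m..<n}"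
      then show "tens_proj m (tens_exp (log_comp k n t)) = 0"
        using proj_tens_exp[of k m "log_comp k n t"] by (auto simp: proj_log_comp)
    qed
  qed (use assms in auto)
  finally show ?thesis .
qed

subsection \<open>The explicit formula\<close>

lemma exp_index_single: "([n], []) \<in> exp_index \<longleftrightarrow> 1 \<le> n"
  by (auto simp: exp_index_def)

lemma exp_index_snoc:
  assumes "ns \<noteq> []"
  shows "(ns @ [n], mss @ [ms]) \<in> exp_index \<longleftrightarrow>
    (ns, mss) \<in> exp_index \<and> last ns < n \<and> ms \<in> compositions (last ns) n"
proof (cases "length ns = length mss + 1")
  case True
  have last: "last ns = ns ! length mss" using True assms by (simp add: last_conv_nth)
  have sorted: "sorted_wrt (<) (ns @ [n]) \<longleftrightarrow> sorted_wrt (<) ns \<and> last ns < n"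
  proof -
    have "x < n" if "sorted_wrt (<) ns" "last ns < n" "x \<in> set ns" for x
    proof -
      obtain us where us: "ns = us @ [last ns]" using assms by (metis append_butlast_last_id)
      have "x \<le> last ns" using that(1,3) by (subst (asm) (1 2) us) (auto simp: sorted_wrt_append)
      then show ?thesis using that(2) by simp
    qed
    then show ?thesis using assms by (auto simp: sorted_wrt_append)
  qed
  have all: "(\<forall>i<length (mss @ [ms]). P i) \<longleftrightarrow> (\<forall>i<length mss. P i) \<and> P (length mss)" for P
    by (auto simp: less_Suc_eq)
  show ?thesis
    unfolding exp_index_def mem_Collect_eq prod.case sorted all compositions_def
    using True assms by (auto simp: nth_append last)
qed (auto simp: exp_index_def)

lemma exp_index_cases:
  assumes "i \<in> exp_index"
  obtains n where "i = ([n], [])" "1 \<le> n"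
  | ns n mss ms where "i = (ns @ [n], mss @ [ms])" "ns \<noteq> []"
proof -
  obtain ns mss where i: "i = (ns, mss)" by (cases i)
  have len: "length ns = length mss + 1" "1 \<le> hd ns" using assms by (auto simp: i exp_index_def)
  show ?thesis
  proof (cases mss rule: rev_cases)
    case Nil
    then obtain n where "ns = [n]" using len by (cases ns) auto
    then show ?thesis using that(1)[of n] i Nil len by simp
  next
    case (snoc mss' ms)
    then obtain ns' n where "ns = ns' @ [n]" using len by (cases ns rule: rev_cases) auto
    moreover have "ns' \<noteq> []" using len snoc calculation by auto
    ultimately show ?thesis using that(2) i snoc by blast
  qed
qed

text \<open>Chains ending at length \<open>n\<close>.  Apart from \<open>([n], [])\<close>, which stands for the identity, they arise from shorter
  ones by adding an innermost factor, see \<open>exp_index_at_rec\<close>.\<close>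

definition exp_index_at :: "nat \<Rightarrow> (nat list \<times> nat list list) set" where
  "exp_index_at n = {i \<in> exp_index. last (fst i) = n}"

lemma exp_index_pos: "(ns, mss) \<in> exp_index \<Longrightarrow> ns \<noteq> [] \<and> 1 \<le> last ns"
proof -
  assume i: "(ns, mss) \<in> exp_index"
  then have ns: "ns \<noteq> []" "1 \<le> hd ns" "sorted_wrt (<) ns" by (auto simp: exp_index_def)
  moreover have "hd ns \<le> x" if "x \<in> set ns" for x using ns that by (cases ns) auto
  ultimately show ?thesis using last_in_set[of ns] by fastforce
qed

lemma exp_index_at_0: "exp_index_at 0 = {}"
  using exp_index_pos by (force simp: exp_index_at_def)

abbreviation extend_index :: "nat \<Rightarrow> nat list \<Rightarrow> nat list \<times> nat list list \<Rightarrow> nat list \<times> nat list list" where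
  "extend_index n ms i \<equiv> (fst i @ [n], snd i @ [ms])"

lemma exp_index_at_rec:
  assumes "1 \<le> n"
  shows "exp_index_at n = insert ([n], [])
    ((\<lambda>(k, ms, i). extend_index n ms i) ` (SIGMA k:{1..<n}. compositions k n \<times> exp_index_at k))"
  (is "_ = insert _ (?f ` ?S)")
proof (intro equalityI subsetI)
  fix i assume i: "i \<in> exp_index_at n"
  then have "i \<in> exp_index" by (simp add: exp_index_at_def)
  then show "i \<in> insert ([n], []) (?f ` ?S)"
  proof (cases rule: exp_index_cases)
    case (1 n')
    then show ?thesis using i by (simp add: exp_index_at_def)
  next
    case (2 ns n' mss ms)
    then have n': "n' = n" using i by (simp add: exp_index_at_def)
    have "(ns, mss) \<in> exp_index" "last ns < n" "ms \<in> compositions (last ns) n"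
      using \<open>i \<in> exp_index\<close> exp_index_snoc[OF 2(2)] 2(1) n' by auto
    then have "(last ns, ms, (ns, mss)) \<in> ?S"
      using exp_index_pos by (auto simp: exp_index_at_def)
    then have "?f (last ns, ms, (ns, mss)) \<in> ?f ` ?S" by (rule imageI)
    then show ?thesis using 2(1) n' by simp
  qed
next
  fix i assume "i \<in> insert ([n], []) (?f ` ?S)"
  then consider "i = ([n], [])" | k ms ns mss where "i = (ns @ [n], mss @ [ms])" "k < n" "ms \<in> compositions k n"
      "(ns, mss) \<in> exp_index_at k" by auto
  then show "i \<in> exp_index_at n"
  proof cases
    case 1
    then show ?thesis using assms by (simp add: exp_index_at_def exp_index_single)
  next
    case (2 k ms ns mss)
    then show ?thesis
      using exp_index_snoc[of ns n mss ms] exp_index_pos[of ns mss] by (auto simp: exp_index_at_def)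
  qed
qed

lemma finite_exp_index_at: "finite (exp_index_at n)"
proof (induction n rule: less_induct)
  case (less n)
  show ?case
  proof (cases "n = 0")
    case False
    have "finite (SIGMA k:{1..<n}. compositions k n \<times> exp_index_at k)"
      using less by (intro finite_SigmaI) auto
    then show ?thesis using exp_index_at_rec[of n] False by simp
  qed (simp add: exp_index_at_0)
qed

lemma linear_foldr_block: "linear (foldr block_op mss)"
proof (induction mss)
  case (Cons ms mss)
  from lin_comp[OF linear_block_op[of ms] Cons] show ?case by (simp add: o_def)
qed (simp add: id_def linear_ident)

lemma linear_exp_term: "linear (exp_term i)"
  unfolding exp_term_def
  by (cases i) (simp, intro lin lin_comp[OF linear_foldr_block] linear_tens_proj)

lemma exp_term_proj: "exp_term i (tens_proj n t) = (if n = last (fst i) then exp_term i t else 0)"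
  by (cases i) (auto simp: exp_term_def proj_proj linear_0[OF linear_foldr_block])

lemma exp_term_extend:
  assumes "i \<in> exp_index_at k" "ms \<in> compositions k n"
  shows "exp_term (extend_index n ms i) t = - exp_term i (block_op ms t)"
  using assms by (cases i) (simp add: exp_term_def exp_index_at_def compositions_def block_op_proj proj_block_op)

text \<open>Collecting the chains with the same innermost factor gives the recursion \<open>tens_exp_rec\<close>.\<close>

lemma sum_exp_term: "1 \<le> n \<Longrightarrow> (\<Sum>i\<in>exp_index_at n. exp_term i t) = tens_exp (tens_proj n t)"
proof (induction n arbitrary: t rule: less_induct)
  case (less n)
  let ?f = "\<lambda>(k, ms, i). extend_index n ms i" and ?S = "SIGMA k:{1..<n}. compositions k n \<times> exp_index_at k"
  have fin: "finite ?S" by (intro finite_SigmaI) (auto simp: finite_exp_index_at)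
  have new: "([n], []) \<notin> ?f ` ?S" by auto
  have inj: "inj_on ?f ?S"
    by (auto simp: inj_on_def exp_index_at_def compositions_def prod_eq_iff)
  have "(\<Sum>i\<in>exp_index_at n. exp_term i t) = exp_term ([n], []) t + (\<Sum>x\<in>?S. exp_term (?f x) t)"
    using fin new by (simp only: exp_index_at_rec[OF less.prems] sum.insert finite_imageI
        sum.reindex[OF inj] o_def not_False_eq_True)
  also have "exp_term ([n], []) t = tens_proj n t"
    by (simp add: exp_term_def)
  also have "(\<Sum>x\<in>?S. exp_term (?f x) t) = (\<Sum>(k, x)\<in>?S. - exp_term (snd x) (block_op (fst x) t))"
  proof (rule sum.cong[OF refl])
    fix x assume x: "x \<in> ?S"
    obtain k ms i where "x = (k, ms, i)" by (cases x)
    then show "exp_term (?f x) t = (case x of (k, x) \<Rightarrow> - exp_term (snd x) (block_op (fst x) t))"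
      using x exp_term_extend[of i k ms n t] by simp
  qed
  also have "\<dots> = (\<Sum>k\<in>{1..<n}. \<Sum>x\<in>compositions k n \<times> exp_index_at k. - exp_term (snd x) (block_op (fst x) t))"
    by (rule sum.Sigma[symmetric]) (auto simp: finite_exp_index_at)
  also have "\<dots> = (\<Sum>k\<in>{1..<n}. - tens_exp (log_comp k n t))"
  proof (rule sum.cong[OF refl])
    fix k assume k: "k \<in> {1..<n}"
    have "(\<Sum>x\<in>compositions k n \<times> exp_index_at k. - exp_term (snd x) (block_op (fst x) t)) =
        - (\<Sum>ms\<in>compositions k n. \<Sum>i\<in>exp_index_at k. exp_term i (block_op ms t))"
      by (simp add: sum_negf sum.cartesian_product case_prod_unfold)
    also have "(\<Sum>ms\<in>compositions k n. \<Sum>i\<in>exp_index_at k. exp_term i (block_op ms t)) =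
        (\<Sum>ms\<in>compositions k n. tens_exp (block_op ms t))"
      using k less.IH[of k] by (intro sum.cong) (auto simp: proj_block_op compositions_def)
    finally show "(\<Sum>x\<in>compositions k n \<times> exp_index_at k. - exp_term (snd x) (block_op (fst x) t)) =
        - tens_exp (log_comp k n t)"
      by (simp add: log_comp_def linear_sum[OF linear_tens_exp])
  qed
  finally show ?case by (simp only: sum_negf tens_exp_rec[OF less.prems]) simp
qed

lemma sh_plus_proj_0: "t \<in> sh_plus \<Longrightarrow> tens_proj 0 t = 0"
  unfolding sh_plus_def by (rule linear_vanish_span[OF linear_tens_proj, rotated]) auto

lemma tens_exp_formula:
  assumes t: "t \<in> sh_plus"
  shows "finite {i \<in> exp_index. exp_term i t \<noteq> 0}"
    and "tens_exp t = Sum_any (\<lambda>i. if i \<in> exp_index then exp_term i t else 0)"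
proof -
  obtain N where N: "t = (\<Sum>n\<le>N. tens_proj n t)" "\<And>n. n > N \<Longrightarrow> tens_proj n t = 0"
    using proj_sum[of t] by blast
  have sub: "{i \<in> exp_index. exp_term i t \<noteq> 0} \<subseteq> (\<Union>n\<le>N. exp_index_at n)"
  proof
    fix i assume i: "i \<in> {i \<in> exp_index. exp_term i t \<noteq> 0}"
    have "exp_term i (tens_proj (last (fst i)) t) = exp_term i t"
      by (simp add: exp_term_proj)
    then have "tens_proj (last (fst i)) t \<noteq> 0"
      using i by (auto simp: linear_0[OF linear_exp_term])
    then have "last (fst i) \<le> N" using N(2) not_le by blast
    then show "i \<in> (\<Union>n\<le>N. exp_index_at n)" using i by (auto simp: exp_index_at_def)
  qed
  have fin: "finite (\<Union>n\<le>N. exp_index_at n)" by (simp add: finite_exp_index_at)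
  show "finite {i \<in> exp_index. exp_term i t \<noteq> 0}" by (rule finite_subset[OF sub fin])
  have "Sum_any (\<lambda>i. if i \<in> exp_index then exp_term i t else 0) =
      (\<Sum>i\<in>(\<Union>n\<le>N. exp_index_at n). if i \<in> exp_index then exp_term i t else 0)"
    using sub by (intro Sum_any.expand_superset[OF fin]) auto
  also have "\<dots> = (\<Sum>i\<in>(\<Union>n\<le>N. exp_index_at n). exp_term i t)"
    by (rule sum.cong) (auto simp: exp_index_at_def)
  also have "\<dots> = (\<Sum>n\<le>N. \<Sum>i\<in>exp_index_at n. exp_term i t)"
  proof (rule sum.UNION_disjoint)
    show "\<forall>n\<in>{..N}. finite (exp_index_at n)" by (simp add: finite_exp_index_at)
  qed (auto simp: exp_index_at_def)
  also have "\<dots> = (\<Sum>n\<le>N. tens_exp (tens_proj n t))"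
  proof (rule sum.cong[OF refl])
    fix n
    show "(\<Sum>i\<in>exp_index_at n. exp_term i t) = tens_exp (tens_proj n t)"
      using sum_exp_term[of n t] sh_plus_proj_0[OF t]
      by (cases "n = 0") (auto simp: exp_index_at_0 linear_0[OF linear_tens_exp])
  qed
  also have "\<dots> = tens_exp t"
    using N(1) by (simp add: linear_sum[OF linear_tens_exp, symmetric])
  finally show "tens_exp t = Sum_any (\<lambda>i. if i \<in> exp_index then exp_term i t else 0)" ..
qed

lemma bij_log: "bij (log_map :: 'u::real_vector ck \<Rightarrow> _)"
proof -
  have "(log_map :: 'u ck \<Rightarrow> _) = tens_log \<circ> inv growth"
    by (simp add: fun_eq_iff tens_log_def inv_growth growth_lift)
  moreover have "bij (tens_log \<circ> inv growth :: 'u ck \<Rightarrow> _)"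
    by (rule bij_comp[OF bij_imp_bij_inv[OF bij_growth] bij_tens_log])
  ultimately show ?thesis by (simp only:)
qed

lemma inv_log: "inv log_map t = growth (tens_exp t)"
  by (rule inv_f_eq[OF bij_is_inj[OF bij_log]]) (simp add: tens_log_def[symmetric])

section \<open>Gradings\<close>

lemma linear_image_span:
  assumes "linear F" "subspace S" "\<And>x. x \<in> B \<Longrightarrow> F x \<in> S" "t \<in> span B"
  shows "F t \<in> S"
  using assms(4)
proof (induction rule: span_induct_alt)
  case base
  show ?case using assms(1,2) by (simp add: linear_0 subspace_0)
next
  case (step c x y)
  then show ?case using assms(1-3) by (simp add: linear_add linear_cmul subspace_add subspace_scale)
qed

lemma tens_deg_image:
  assumes "linear F" "subspace S"
    and "\<And>xs ds. list_all2 (\<lambda>x d. x \<in> G d) xs ds \<Longrightarrow> sum_list ds = n \<Longrightarrow> F (word xs) \<in> S"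
    and "t \<in> tens_deg G n"
  shows "F t \<in> S"
  using assms(4) unfolding tens_deg_def
  by (rule linear_image_span[OF assms(1,2), rotated]) (use assms(3) in blast)

lemma subspace_tens_deg: "subspace (tens_deg G n)"
  unfolding tens_deg_def by (rule subspace_span)

lemma word_tens_deg: "list_all2 (\<lambda>x d. x \<in> G d) xs ds \<Longrightarrow> word xs \<in> tens_deg G (sum_list ds)"
  unfolding tens_deg_def by (intro span_base) blast

lemma snoc_tens_deg:
  assumes "t \<in> tens_deg G i" "v \<in> G j"
  shows "snoc t v \<in> tens_deg G (i + j)"
proof (rule tens_deg_image[OF _ subspace_tens_deg _ assms(1)])
  fix xs ds assume "list_all2 (\<lambda>x d. x \<in> G d) xs ds" "sum_list ds = i"
  then show "snoc (word xs) v \<in> tens_deg G (i + j)"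
    using word_tens_deg[of G "xs @ [v]" "ds @ [j]"] assms(2) by (simp add: list_all2_appendI)
qed (intro lin)

lemma tens_map_deg:
  assumes F: "linear F" "\<And>d x. x \<in> G d \<Longrightarrow> F x \<in> G' d" and t: "t \<in> tens_deg G n"
  shows "tens_map F t \<in> tens_deg G' n"
proof (rule tens_deg_image[OF linear_tens_map[OF F(1)] subspace_tens_deg _ t])
  fix xs ds assume "list_all2 (\<lambda>x d. x \<in> G d) xs ds" "sum_list ds = n"
  then show "tens_map F (word xs) \<in> tens_deg G' n"
    using word_tens_deg[of G' "map F xs" ds] list_all2_mono[of "\<lambda>x d. x \<in> G d" xs ds "\<lambda>x d. F x \<in> G' d"] F
    by (auto simp: list_all2_map1)
qed

lemma subspace_ck_deg: "subspace (ck_deg n)"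
  unfolding ck_deg_def by (rule subspace_span)

lemma ck_in_deg: "card (verts f) = n \<Longrightarrow> ck f \<in> ck_deg n"
  unfolding ck_deg_def by (intro span_base) blast

lemma ck_deg_image:
  assumes "linear F" "subspace S" "\<And>f. card (verts f) = n \<Longrightarrow> F (ck f) \<in> S" "h \<in> ck_deg n"
  shows "F h \<in> S"
  using assms(4) unfolding ck_deg_def
  by (rule linear_image_span[OF assms(1,2), rotated]) (use assms(3) in blast)

lemma ck_deg_image2:
  assumes F: "bilinear F" and S: "subspace S"
    and "\<And>f g. card (verts f) = i \<Longrightarrow> card (verts g) = j \<Longrightarrow> F (ck f) (ck g) \<in> S"
    and "h \<in> ck_deg i" "k \<in> ck_deg j"
  shows "F h k \<in> S"
proof -
  have "F (ck f) k \<in> S" if "card (verts f) = i" for f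
    by (rule ck_deg_image[OF _ S _ assms(5)]) (use F assms(3) that in \<open>auto simp: bilinear_def\<close>)
  then show ?thesis
    by (rule ck_deg_image[where F = "\<lambda>h. F h k", OF _ S _ assms(4), rotated])
      (use F in \<open>auto simp: bilinear_def\<close>)
qed

lemma ck_restrict_deg: "A \<subseteq> verts f \<Longrightarrow> pruned f A \<in> ck_deg (card A)"
  by (rule ck_in_deg) (simp add: Int_absorb1)

lemma card_cut: "A \<in> cuts f \<Longrightarrow> card A + card (verts f - A) = card (verts f)"
  using cut_subset[of A f] by (simp add: card_Diff_subset finite_subset card_mono)

lemma cosum_deg:
  assumes B: "bilinear B" and S: "subspace S"
    and "\<And>i j a b. i + j = n \<Longrightarrow> a \<in> ck_deg i \<Longrightarrow> b \<in> ck_deg j \<Longrightarrow> B a b \<in> S" and h: "h \<in> ck_deg n"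
  shows "cosum B h \<in> S"
proof (rule ck_deg_image[OF linear_cosum[OF B] S _ h])
  fix f :: "'a forest" assume "card (verts f) = n"
  then show "cosum B (ck f) \<in> S"
    unfolding cosum_ck[OF B] using card_cut[of _ f] cut_subset[of _ f]
    by (intro subspace_sum[OF S] assms(3)[OF _ ck_restrict_deg ck_restrict_deg]) auto
qed

lemma ck_one_deg: "ck_one \<in> ck_deg 0"
  unfolding ck_one_def by (rule ck_in_deg) simp

lemma mult_deg: "a \<in> ck_deg i \<Longrightarrow> b \<in> ck_deg j \<Longrightarrow> ck_mult a b \<in> ck_deg (i + j)"
  by (rule ck_deg_image2[OF bilinear_mult subspace_ck_deg])
    (auto simp: mult_ck card_par intro!: ck_in_deg)

lemma top_deg:
  assumes "a \<in> ck_deg i" "b \<in> ck_deg j"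
  shows "ck_top a b \<in> ck_deg (i + j)"
proof (rule ck_deg_image2[OF bilinear_top subspace_ck_deg _ assms])
  fix f g :: "'a forest" assume fg: "card (verts f) = i" "card (verts g) = j"
  have "ck_graft (ck f) (ck g) \<in> ck_deg (i + j)"
    unfolding graft_ck using fg
    by (intro subspace_sum[OF subspace_ck_deg] ck_in_deg) (simp add: card_par)
  moreover have "ck_counit (ck g) *\<^sub>R ck f \<in> ck_deg (i + j)"
    using fg by (auto intro: ck_in_deg subspace_0[OF subspace_ck_deg])
  ultimately show "ck_top (ck f) (ck g) \<in> ck_deg (i + j)"
    unfolding top_graft ck_scale_ck linear_cmul[OF lin_graft(2)[OF linear_ident]]
    by (rule subspace_add[OF subspace_ck_deg subspace_scale[OF subspace_ck_deg]])
qed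

lemma red_deg: "h \<in> ck_deg n \<Longrightarrow> ck_red h \<in> ck_deg n"
  by (rule ck_deg_image[OF linear_red subspace_ck_deg])
    (auto simp: red_ck intro: ck_in_deg subspace_0[OF subspace_ck_deg])

lemma primize_deg: "h \<in> ck_deg n \<Longrightarrow> primize h \<in> ck_deg n"
proof (rule ck_deg_image[OF linear_primize subspace_ck_deg])
  fix f :: "'a forest"
  have "primize (ck f) \<in> ck_deg (card (verts f))"
  proof (induction f rule: measure_induct_rule[where f = "\<lambda>f. card (verts f)"])
    case (less f)
    show ?case
    proof (cases "verts f = {}")
      case True
      then show ?thesis by (simp add: ck_empty subspace_0[OF subspace_ck_deg])
    next
      case False
      have "ck_top (pruned f A) (primize (trunk f A)) \<in> ck_deg (card (verts f))"
        if A: "A \<in> proper_cuts f" for A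
      proof -
        have A': "A \<in> cuts f" "A \<subseteq> verts f"
          using A cut_subset[of A f] by (auto simp: proper_cuts_def)
        have "primize (trunk f A) \<in> ck_deg (card (verts f - A))"
          using less[OF proper_cut_card(2)[OF A]] by (simp add: Int_absorb1)
        from top_deg[OF ck_restrict_deg[OF A'(2)] this] show ?thesis
          by (simp add: card_cut[OF A'(1)])
      qed
      then show ?thesis unfolding primize_forest[OF False]
        by (intro subspace_diff[OF subspace_ck_deg] subspace_sum[OF subspace_ck_deg] ck_in_deg refl)
    qed
  qed
  then show "card (verts f) = n \<Longrightarrow> primize (ck f) \<in> ck_deg n" by simp
qed

lemma red_pow_deg: "h \<in> ck_deg n \<Longrightarrow> red_pow k h \<in> ck_deg n"
proof (induction k arbitrary: h n)
  case 0
  show ?case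
    by (rule ck_deg_image[OF _ subspace_ck_deg _ 0])
      (auto simp: ck_empty intro: linear_coiter[OF bilinear_mult linear_red, of _ 0, simplified]
        ck_one_deg subspace_0[OF subspace_ck_deg])
next
  case (Suc k)
  show ?case unfolding coiter.simps
    by (rule cosum_deg[OF bilinear_coiter[OF bilinear_mult linear_red] subspace_ck_deg _ Suc.prems])
      (use mult_deg[OF Suc.IH red_deg] in blast)
qed

lemma eulerian_deg: "h \<in> ck_deg n \<Longrightarrow> eulerian h \<in> ck_deg n"
proof (rule ck_deg_image[OF linear_eulerian subspace_ck_deg])
  fix f :: "'a forest" assume "card (verts f) = n"
  then show "eulerian (ck f) \<in> ck_deg n"
    unfolding eulerian_ck[OF order_refl]
    by (intro subspace_sum[OF subspace_ck_deg] subspace_scale[OF subspace_ck_deg] red_pow_deg ck_in_deg)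
qed

lemma ck_pi_deg: "h \<in> ck_deg n \<Longrightarrow> ck_pi h \<in> prim_deg n"
  by (simp add: ck_pi prim_deg_def primize_deg)

lemma log_letter_deg: "h \<in> ck_deg n \<Longrightarrow> log_letter h \<in> prim_deg n"
  by (simp add: log_letter_def ck_pi_deg eulerian_deg)

lemma subspace_prim_deg: "subspace (prim_deg n)"
  unfolding subspace_def prim_deg_def
  by (auto simp: zero_prim.rep_eq plus_prim.rep_eq scaleR_prim.rep_eq
      subspace_0[OF subspace_ck_deg] subspace_add[OF subspace_ck_deg] subspace_scale[OF subspace_ck_deg])

lemma lift_deg:
  assumes \<phi>: "linear \<phi>" "\<phi> ck_one = 0" and deg: "\<And>n h. h \<in> ck_deg n \<Longrightarrow> \<phi> h \<in> G n" and h: "h \<in> ck_deg n"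
  shows "cofree_lift \<phi> h \<in> tens_deg G n"
proof (rule ck_deg_image[OF linear_lift[OF \<phi>] subspace_tens_deg _ h])
  fix f :: "'a forest"
  have "cofree_lift \<phi> (ck f) \<in> tens_deg G (card (verts f))"
  proof (induction f rule: measure_induct_rule[where f = "\<lambda>f. card (verts f)"])
    case (less f)
    have w: "word [] \<in> tens_deg G 0" using word_tens_deg[of G "[]" "[]"] by simp
    show ?case
    proof (cases "verts f = {}")
      case True
      then show ?thesis using w by (simp add: ck_empty lift_one[OF \<phi>])
    next
      case False
      have "snoc (cofree_lift \<phi> (pruned f A)) (\<phi> (trunk f A))
          \<in> tens_deg G (card (verts f))" if A: "A \<in> proper_cuts f" for A
      proof -
        have A': "A \<in> cuts f" "A \<subseteq> verts f"
          using A cut_subset[of A f] by (auto simp: proper_cuts_def)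
        have "cofree_lift \<phi> (pruned f A) \<in> tens_deg G (card A)"
          using less[OF proper_cut_card(1)[OF A]] A'(2) by (simp add: Int_absorb1)
        from snoc_tens_deg[OF this deg[OF ck_restrict_deg[of "verts f - A" f]]] show ?thesis
          by (simp add: card_cut[OF A'(1)])
      qed
      moreover have "snoc (word []) (\<phi> (ck f)) \<in> tens_deg G (card (verts f))"
        using snoc_tens_deg[OF w deg[OF ck_in_deg[OF refl]]] by simp
      ultimately show ?thesis using False
        by (subst lift_rec[OF \<phi>]) (auto simp: lift_proper[OF linear_lift[OF \<phi>] \<phi> False] lift_one[OF \<phi>]
            intro!: subspace_add[OF subspace_tens_deg] subspace_sum[OF subspace_tens_deg])
    qed
  qed
  then show "card (verts f) = n \<Longrightarrow> cofree_lift \<phi> (ck f) \<in> tens_deg G n" by simp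
qed

lemma growth_deg: "t \<in> tens_deg prim_deg n \<Longrightarrow> growth t \<in> ck_deg n"
proof (rule tens_deg_image[OF linear_growth subspace_ck_deg])
  fix ps :: "'a prim list" and ds
  assume ps: "list_all2 (\<lambda>x d. x \<in> prim_deg d) ps ds" "sum_list ds = n"
  have "foldl ck_top a (map Rep_prim ps) \<in> ck_deg (i + sum_list ds)" if "a \<in> ck_deg i" for a i
    using ps(1) that
  proof (induction arbitrary: a i rule: list_all2_induct)
    case (Cons p ps d ds)
    have "ck_top a (Rep_prim p) \<in> ck_deg (i + d)"
      using top_deg[OF Cons.prems] Cons.hyps by (simp add: prim_deg_def)
    from Cons.IH[OF this] show ?case by (simp add: add.assoc)
  qed simp
  from this[OF ck_one_deg] show "growth (word ps) \<in> ck_deg n"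
    using ps(2) by (simp add: growth_word)
qed

lemma lift_prim_deg: "h \<in> ck_deg n \<Longrightarrow> cofree_lift prim_part h \<in> tens_deg prim_deg n"
  by (rule lift_deg[OF linear_prim_part prim_part_one]) (use ck_pi_deg in \<open>auto simp: ck_pi\<close>)

lemma log_deg: "h \<in> ck_deg n \<Longrightarrow> log_map h \<in> tens_deg prim_deg n"
  unfolding log_map_def by (rule lift_deg[OF linear_log_letter log_letter_one log_letter_deg])

text \<open>Homogeneous components in the tensor algebra of the primitives, transferred from the forests along
  natural growth, which preserves degrees in both directions.\<close>

definition sh_proj :: "nat \<Rightarrow> 'u::real_vector prim tens \<Rightarrow> 'u prim tens" where
  "sh_proj n t = cofree_lift prim_part (ck_proj n (growth t))"

lemma linear_sh_proj: "linear (sh_proj n)"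
  unfolding sh_proj_def[abs_def]
  by (rule lin_comp[OF linear_lift[OF linear_prim_part prim_part_one] lin_ck_scale[OF linear_growth]])

lemma sh_proj_deg: "sh_proj n t \<in> tens_deg prim_deg n"
  unfolding sh_proj_def by (rule lift_prim_deg[OF ck_proj_deg])

lemma sh_proj_on_deg: "t \<in> tens_deg prim_deg n \<Longrightarrow> sh_proj m t = (if m = n then t else 0)"
  by (simp add: sh_proj_def ck_proj_on_deg[OF growth_deg] lift_growth
      linear_0[OF linear_lift[OF linear_prim_part prim_part_one]])

lemma vec_grading_sh: "vec_grading (tens_deg prim_deg)"
proof (rule vec_gradingI[of _ sh_proj])
  fix t :: "'a prim tens"
  obtain M where M: "growth t = (\<Sum>n\<le>M. ck_proj n (growth t))" "\<forall>n>M. ck_proj n (growth t) = 0"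
    using ck_proj_sum by blast
  note l = linear_lift[OF linear_prim_part prim_part_one]
  have "t = cofree_lift prim_part (\<Sum>n\<le>M. ck_proj n (growth t))"
    using M(1) lift_growth[of t] by metis
  then have "t = (\<Sum>n\<le>M. sh_proj n t)"
    by (simp only: linear_sum[OF l] sh_proj_def)
  then show "\<exists>M. t = (\<Sum>n\<le>M. sh_proj n t) \<and> (\<forall>n>M. sh_proj n t = 0)"
    using M(2) by (auto simp: sh_proj_def linear_0[OF l])
qed (auto simp: subspace_tens_deg linear_sh_proj sh_proj_deg sh_proj_on_deg)

text \<open>The logarithm is graded and injective, so a homogeneous component of the preimage of \<open>t\<close> vanishes as soon as
  that component of \<open>t\<close> does.\<close>

lemma log_image_deg: "log_map ` ck_deg n = (tens_deg prim_deg n :: 'u::real_vector prim tens set)"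
proof (intro equalityI subsetI)
  fix t :: "'u prim tens" assume t: "t \<in> tens_deg prim_deg n"
  obtain h where h: "t = log_map h" using bij_log by (metis bij_pointE)
  obtain M where M: "h = (\<Sum>m\<le>M. ck_proj m h)" "\<And>m. m > M \<Longrightarrow> ck_proj m h = 0"
    using ck_proj_sum[of h] by blast
  have "ck_proj m h = 0" if "m \<noteq> n" for m
  proof (cases "m \<le> M")
    case True
    have "t = (\<Sum>k\<le>M. log_map (ck_proj k h))"
      unfolding h using M(1) by (metis (no_types) linear_sum[OF linear_log])
    then have "sh_proj m t = (\<Sum>k\<le>M. sh_proj m (log_map (ck_proj k h)))"
      by (metis (no_types, lifting) linear_sum[OF linear_sh_proj] sum.cong)
    also have "\<dots> = (\<Sum>k\<le>M. if k = m then log_map (ck_proj m h) else 0)"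
      by (rule sum.cong[OF refl]) (simp add: sh_proj_on_deg[OF log_deg[OF ck_proj_deg]])
    finally have "log_map (ck_proj m h) = log_map 0"
      using True t that by (simp add: sh_proj_on_deg[OF t] linear_0[OF linear_log])
    then show ?thesis using bij_is_inj[OF bij_log] by (metis injD)
  qed (use M(2) in simp)
  then have "(\<Sum>m\<le>M. ck_proj m h) \<in> ck_deg n"
    by (intro subspace_sum[OF subspace_ck_deg]) (metis ck_proj_deg subspace_0[OF subspace_ck_deg])
  then show "t \<in> log_map ` ck_deg n" using M(1) h by auto
qed (auto intro: log_deg)

definition prim_component :: "nat \<Rightarrow> 'u::real_vector prim \<Rightarrow> 'u prim" where
  "prim_component n p = Abs_prim (ck_proj n (Rep_prim p))"

lemma Rep_prim_component: "Rep_prim (prim_component n p) = ck_proj n (Rep_prim p)"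
  unfolding prim_component_def by (rule Abs_prim_inverse) (rule prim_proj[OF Rep_prim_in])

lemma vec_grading_prim: "vec_grading prim_deg"
proof (rule vec_gradingI[of _ prim_component])
  fix n m and p :: "'a prim"
  note R = Rep_prim_component
  show "linear (prim_component n :: 'a prim \<Rightarrow> _)"
    by (rule linearI; rule Rep_prim_inject[THEN iffD1])
      (simp_all add: R plus_prim.rep_eq scaleR_prim.rep_eq linear_add[OF linear_ck_scale] linear_cmul[OF linear_ck_scale])
  show "prim_component n p \<in> prim_deg n"
    by (simp add: prim_deg_def R ck_proj_deg)
  show "p \<in> prim_deg n \<Longrightarrow> prim_component n p = p"
    by (simp add: prim_deg_def prim_component_def ck_proj_on_deg Rep_prim_inverse)
  show "p \<in> prim_deg n \<Longrightarrow> m \<noteq> n \<Longrightarrow> prim_component m p = 0"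
    by (simp add: prim_deg_def prim_component_def ck_proj_on_deg zero_prim_def)
  obtain M where M: "Rep_prim p = (\<Sum>n\<le>M. ck_proj n (Rep_prim p))" "\<forall>n>M. ck_proj n (Rep_prim p) = 0"
    using ck_proj_sum by blast
  have "Rep_prim (\<Sum>n\<le>M. prim_component n p) = (\<Sum>n\<le>M. ck_proj n (Rep_prim p))"
    by (simp add: linear_sum[OF linear_Rep_prim] R)
  then have "p = (\<Sum>n\<le>M. prim_component n p)"
    using M(1) by (metis Rep_prim_inject)
  then show "\<exists>M. p = (\<Sum>n\<le>M. prim_component n p) \<and> (\<forall>n>M. prim_component n p = 0)"
    using M(2) by (auto simp: prim_component_def zero_prim_def)
qed (rule subspace_prim_deg)

section \<open>Hopf algebras\<close>

lemma linear_eq_on_pairs: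
  assumes "linear P" "linear Q" "\<And>a b. P (word [a, b]) = Q (word [a, b])" "t \<in> span {word [a, b] | a b. True}"
  shows "P t = Q t"
proof -
  have "P t - Q t = 0"
    by (rule linear_vanish_span[where F = "\<lambda>t. P t - Q t", OF linear_compose_sub[OF assms(1,2)] _ assms(4)])
      (use assms(3) in auto)
  then show ?thesis by simp
qed

lemma tens_map_comp:
  assumes "linear F" "linear G"
  shows "tens_map G (tens_map F t) = tens_map (\<lambda>x. G (F x)) t"
  by (rule tens_eqI[where t = t])
    (auto simp: o_def assms lin_comp[OF assms(2,1)] intro!: lin_comp[OF linear_tens_map[OF assms(2)]] linear_tens_map lin_comp[OF assms(2,1)])

lemma tens_map_ident: "tens_map (\<lambda>x. x) t = t"
  by (rule tens_eqI[where t = t, OF linear_tens_map[OF linear_ident] linear_ident])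
    (simp add: tens_map_word[OF linear_ident])

lemma letter_lin: "linear letter"
  by (rule lin_word_simps(1)[OF linear_ident])

lemma cop_pairs: "ck_cop h \<in> span {word [a, b] | a b. True}"
proof (induction h rule: ck_induct)
  case zero
  show ?case by (simp add: linear_0[OF linear_ck_cop] span_zero)
next
  case (add c f h)
  have "ck_cop (ck f) \<in> span {word [a, b] | a b. True}"
    unfolding ck_cop_cosum cosum_ck[OF bilinear_word] by (intro span_sum span_base) blast
  then show ?case using add
    by (simp add: linear_add[OF linear_ck_cop] linear_cmul[OF linear_ck_cop] span_add span_scale)
qed

text \<open>The convolution inverse \<open>S = \<Sum>n. (-1)\<^sup>n J\<^sup>*\<^sup>n\<close> of the identity, with \<open>J\<close> the identity minus its unit part.\<close>

definition ck_antipode :: "'u::real_vector ck \<Rightarrow> 'u ck" where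
  "ck_antipode = total (coiter ck_mult ck_one (\<lambda>h. - ck_red h))"

text \<open>The recursion for \<open>S\<close> says that it is a left inverse.  Associativity gives \<open>S * (id * S) = S\<close>, from which
  \<open>id * S = \<epsilon> 1\<close> follows by induction on the weight.\<close>

lemma ck_antipode:
  shows linear_antipode: "linear (ck_antipode :: 'u::real_vector ck \<Rightarrow> _)"
    and antipode_left: "cosum (\<lambda>a b. ck_mult (ck_antipode a) b) (h :: 'u ck) = ck_counit h *\<^sub>R ck_one"
    and antipode_right: "cosum (\<lambda>a b. ck_mult a (ck_antipode b)) (h :: 'u ck) = ck_counit h *\<^sub>R ck_one"
proof -
  let ?S = "ck_antipode :: 'u ck \<Rightarrow> _"
  have neg: "linear (\<lambda>h :: 'u ck. - ck_red h)" by (intro lin linear_red)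
  show l: "linear ?S"
    unfolding ck_antipode_def by (rule linear_total[OF locfin_coiter[OF bilinear_mult neg]]) simp
  have rec: "?S h = ck_counit h *\<^sub>R ck_one + cosum (\<lambda>a b. ck_mult (?S a) (- ck_red b)) h" for h
    unfolding ck_antipode_def by (rule total_coiter[OF bilinear_mult neg]) simp
  note m = linear_diff[OF lin_mult(2)[OF linear_ident]] linear_cmul[OF lin_mult(2)[OF linear_ident]]
    linear_neg[OF lin_mult(2)[OF linear_ident]]
  have left: "cosum (\<lambda>a b. ck_mult (?S a) b) h = ck_counit h *\<^sub>R ck_one" for h
  proof -
    have "cosum (\<lambda>a b. ck_mult (?S a) (- ck_red b)) h =
        cosum (\<lambda>a b. ck_counit b *\<^sub>R ?S a) h - cosum (\<lambda>a b. ck_mult (?S a) b) h"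
      by (simp add: ck_red_def m cosum_diff)
    then show ?thesis using rec[of h] by (simp add: cosum_counit(2)[OF l])
  qed
  show "cosum (\<lambda>a b. ck_mult (?S a) b) h = ck_counit h *\<^sub>R ck_one" by (rule left)
  let ?X = "cosum (\<lambda>a b. ck_mult a (?S b))"
  have bX: "bilinear (\<lambda>a b. ck_mult a (?S b))" by (intro bilinearI lin l)
  note lX = linear_cosum[OF bX]
  have bSX: "bilinear (\<lambda>a b. ck_mult (?S a) (?X b))" by (intro bilinearI lin l lX)
  have S1: "?S ck_one = ck_one"
  proof -
    have "bilinear (\<lambda>a b. ck_mult (?S a) (- ck_red b))" by (intro bilinearI lin l linear_red)
    from cosum_one[OF this] rec[of ck_one] show ?thesis
      by (simp add: linear_0[OF lin_mult(2)[OF linear_ident]])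
  qed
  have SX: "cosum (\<lambda>a b. ck_mult (?S a) (?X b)) h = ?S h" for h
  proof -
    have "cosum (\<lambda>a b. ck_mult (?S a) (?X b)) h =
        cosum (\<lambda>a c. cosum (\<lambda>y z. ck_mult (?S a) (ck_mult y (?S z))) c) h"
      by (simp only: cosum_comp[OF lin_mult(2)[OF linear_ident]])
    also have "\<dots> = cosum (\<lambda>a c. cosum (\<lambda>x y. ck_mult (?S x) (ck_mult y (?S c))) a) h"
      by (rule cosum_coassoc[symmetric]) (intro lin l)+
    also have "\<dots> = cosum (\<lambda>a c. ck_mult (cosum (\<lambda>x y. ck_mult (?S x) y) a) (?S c)) h"
      by (simp only: mult_assoc[symmetric] cosum_comp[OF lin_mult(1)[OF linear_ident]])
    also have "\<dots> = cosum (\<lambda>a c. ck_counit a *\<^sub>R ?S c) h"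
      by (simp add: left linear_cmul[OF lin_mult(1)[OF linear_ident]])
    also have "\<dots> = ?S h" by (rule cosum_counit(1)[OF l])
    finally show ?thesis .
  qed
  show "?X h = ck_counit h *\<^sub>R ck_one"
  proof (rule ck_weight_induct[where h = h, OF lX])
    show "linear (\<lambda>h :: 'u ck. ck_counit h *\<^sub>R ck_one)" by (intro lin linear_ck_counit)
    fix f :: "'u forest"
    assume IH: "\<And>g. card (verts g) < card (verts f) \<Longrightarrow> ?X (ck g) = ck_counit (ck g) *\<^sub>R ck_one"
    have X1: "?X ck_one = ck_one" using cosum_one[OF bX] S1 by simp
    show "?X (ck f) = ck_counit (ck f) *\<^sub>R ck_one"
    proof (cases "verts f = {}")
      case True
      then show ?thesis by (simp add: ck_empty X1)
    next
      case False
      have "?S (ck f) = ?X (ck f) + ?S (ck f)"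
        using SX[of "ck f"] IH[OF proper_cut_card(2)] proper_cut_card(4)[of _ f]
        unfolding cosum_proper[OF bSX False]
        by (simp add: S1 X1 linear_0[OF lin_mult(2)[OF linear_ident]])
      then show ?thesis using False by simp
    qed
  qed
qed

lemma ck_hopf_simps [simp]:
  "hmul ck_hopf = ck_mult" "hone ck_hopf = ck_one" "hcop ck_hopf = ck_cop"
  "hcounit ck_hopf = ck_counit" "hdeg ck_hopf = ck_deg"
  by (simp_all add: ck_hopf_def)

lemma sh_hopf_simps [simp]:
  "hmul sh_hopf = tens_shuffle" "hone sh_hopf = word []" "hcop sh_hopf = deconc"
  "hcounit sh_hopf = tens_counit" "hdeg sh_hopf = tens_deg prim_deg"
  by (simp_all add: sh_hopf_def)

lemma otimes_cop:
  assumes "linear F" "linear G"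
  shows "otimes [F, G] (ck_cop h) = cosum (\<lambda>a b. tens_conc (F a) (G b)) h"
proof -
  have l: "linear (otimes [F, G])" by (rule linear_otimes) (use assms in auto)
  show ?thesis by (simp add: ck_cop_cosum cosum_comp[OF l] otimes_pair[OF assms])
qed

lemma is_hopf_ck: "is_hopf (ck_hopf :: 'u::real_vector ck hopf_data)"
proof -
  have alg: "is_algebra (ck_hopf :: 'u ck hopf_data)"
    by (simp add: is_algebra_def mult_assoc lin_mult[OF linear_ident])
  have eps: "linear (\<lambda>a :: 'u ck. ck_counit a *\<^sub>R word [])" by (intro lin linear_ck_counit)
  note cz = linear_cmul[OF lin_conc(1)[OF linear_ident]] linear_cmul[OF lin_conc(2)[OF linear_ident]]
  have "otimes [ck_cop, letter] (ck_cop x) = otimes [letter, ck_cop] (ck_cop x)" for x :: "'u ck"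
  proof -
    have "otimes [ck_cop, letter] (ck_cop x) = cosum (\<lambda>a c. cosum (\<lambda>y z. tens_conc (word [y, z]) (letter c)) a) x"
      unfolding otimes_cop[OF linear_ck_cop letter_lin]
      by (simp only: ck_cop_cosum cosum_comp[OF lin_conc(1)[OF linear_ident]])
    also have "\<dots> = cosum (\<lambda>a c. cosum (\<lambda>y z. tens_conc (letter a) (word [y, z])) c) x"
      unfolding conc_word append_Cons append_Nil by (rule cosum_coassoc) (intro lin)+
    also have "\<dots> = otimes [letter, ck_cop] (ck_cop x)"
      unfolding otimes_cop[OF letter_lin linear_ck_cop]
      by (simp only: ck_cop_cosum cosum_comp[OF lin_conc(2)[OF linear_ident]])
    finally show ?thesis .
  qed
  moreover have "otimes [\<lambda>a. ck_counit a *\<^sub>R word [], letter] (ck_cop x) = letter x"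
    "otimes [letter, \<lambda>a. ck_counit a *\<^sub>R word []] (ck_cop x) = letter x" for x :: "'u ck"
    using cosum_counit[OF letter_lin, of x]
    by (simp_all add: otimes_cop[OF eps letter_lin] otimes_cop[OF letter_lin eps] cz)
  ultimately have coalg: "is_coalgebra (ck_hopf :: 'u ck hopf_data)"
    by (simp add: is_coalgebra_def linear_ck_cop linear_ck_counit cop_pairs[simplified])
  have cop_mult: "ck_cop (ck_mult x y) = tens_componentwise ck_mult (ck_cop x) (ck_cop y)" for x y :: "'u ck"
  proof -
    note cw = bilinear_componentwise[OF bilinear_mult]
    have "tens_componentwise ck_mult (ck_cop x) (ck_cop y) =
        cosum (\<lambda>a b. cosum (\<lambda>c d. tens_componentwise ck_mult (word [a, b]) (word [c, d])) y) x"
      by (simp only: ck_cop_cosum cosum_comp[OF lin_bil1[OF cw linear_ident]])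
        (simp only: cosum_comp[OF lin_bil2[OF cw linear_ident]])
    then show ?thesis
      unfolding ck_cop_cosum cosum_mult[OF bilinear_word] by (simp add: componentwise_word[OF bilinear_mult])
  qed
  have cop_one: "ck_cop ck_one = word [ck_one, ck_one :: 'u ck]"
    unfolding ck_cop_cosum by (rule cosum_one[OF bilinear_word])
  have l: "linear (\<lambda>a :: 'u ck. letter (ck_antipode a))" by (intro lin linear_antipode)
  have anti: "tens_mult ck_mult ck_one (otimes [\<lambda>a. letter (ck_antipode a), letter] (ck_cop x)) = ck_counit x *\<^sub>R ck_one"
    "tens_mult ck_mult ck_one (otimes [letter, \<lambda>a. letter (ck_antipode a)] (ck_cop x)) = ck_counit x *\<^sub>R ck_one"
    for x :: "'u ck"
    by (simp_all add: otimes_cop[OF l letter_lin] otimes_cop[OF letter_lin l]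
        cosum_comp[OF linear_tens_mult[OF bilinear_mult]] tens_mult_word[OF bilinear_mult] antipode_left antipode_right)
  show ?thesis
    unfolding is_hopf_def ck_hopf_simps
    using alg coalg cop_mult cop_one anti linear_antipode
    by (auto simp: ck_counit_mult intro!: exI[of _ ck_antipode])
qed

lemma counit_deg: "n > 0 \<Longrightarrow> h \<in> ck_deg n \<Longrightarrow> ck_counit h = 0"
proof -
  assume n: "n > 0" and h: "h \<in> ck_deg n"
  have "ck_counit h \<in> {0}"
    by (rule ck_deg_image[OF linear_ck_counit _ _ h]) (use n in \<open>auto simp: subspace_def\<close>)
  then show ?thesis by simp
qed

lemma cop_deg: "h \<in> ck_deg n \<Longrightarrow> ck_cop h \<in> tens_deg ck_deg n"
  unfolding ck_cop_cosum
proof (rule cosum_deg[OF bilinear_word subspace_tens_deg])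
  fix i j and a b :: "'a ck" assume "i + j = n" "a \<in> ck_deg i" "b \<in> ck_deg j"
  then show "word [a, b] \<in> tens_deg ck_deg n"
    using word_tens_deg[of ck_deg "[a, b]" "[i, j]"] by simp
qed

lemma graded_ck: "is_graded_connected_hopf ck_hopf"
  unfolding is_graded_connected_hopf_def
  by (auto simp: is_hopf_ck vec_grading_ck mult_deg cop_deg counit_deg ck_deg_0)

subsection \<open>Transport along isomorphisms\<close>

text \<open>The axioms for the shuffle algebra are obtained in this way from those for forests, with the logarithm as
  \<open>F\<close>.\<close>

lemma hopf_transport:
  fixes H :: "('a::real_vector) hopf_data" and K :: "('b::real_vector) hopf_data"
  assumes H: "is_hopf H" and F: "linear F" "bij F"
    and mul: "\<And>x y. F (hmul H x y) = hmul K (F x) (F y)" and one: "F (hone H) = hone K"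
    and cop: "\<And>x. hcop K (F x) = tens_map F (hcop H x)" and eps: "\<And>x. hcounit K (F x) = hcounit H x"
  shows "is_hopf K"
proof -
  let ?G = "inv F"
  have FG [simp]: "F (?G x) = x" for x using F(2) by (simp add: bij_is_surj surj_f_inv_f)
  have GF [simp]: "?G (F x) = x" for x using F(2) by (simp add: bij_is_inj)
  have ex: "\<exists>x'. x = F x'" for x by (metis FG)
  note lG = linear_inv[OF F] and lT = linear_tens_map[OF F(1)]
  have bm: "bilinear (hmul H)" using H by (simp add: is_hopf_def is_algebra_def bilinear_def)
  have mulK: "hmul K x y = F (hmul H (?G x) (?G y))" for x y by (simp add: mul)
  have bmK: "bilinear (hmul K)"
    unfolding mulK[abs_def]
    by (intro bilinearI lin_comp[OF F(1)] lin_bil1[OF bm] lin_bil2[OF bm] lG)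
  have assoc: "hmul K (hmul K x y) z = hmul K x (hmul K y z)" and unit: "hmul K (hone K) x = x" "hmul K x (hone K) = x"
    for x y z
    using H by (simp_all add: mulK one[symmetric] is_hopf_def is_algebra_def)
  have alg: "is_algebra K"
    using bmK assoc unit by (simp add: is_algebra_def bilinear_def)
  have lcH: "linear (hcop H)" "linear (hcounit H)" using H by (simp_all add: is_hopf_def is_coalgebra_def)
  have copK: "hcop K x = tens_map F (hcop H (?G x))" and epsK: "hcounit K x = hcounit H (?G x)" for x
    using cop[of "?G x"] eps[of "?G x"] by simp_all
  have lcK: "linear (hcop K)" "linear (hcounit K)"
    unfolding copK[abs_def] epsK[abs_def]
    by (intro lin_comp[OF lT] lin_comp[OF lcH(1)] lG, intro lin_comp[OF lcH(2)] lG)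
  have pairs: "hcop H x \<in> span {word [a, b] | a b. True}" for x
    using H by (simp add: is_hopf_def is_coalgebra_def)
  have pairsK: "hcop K x \<in> span {word [a, b] | a b. True}" for x
    unfolding copK by (rule linear_image_span[OF lT subspace_span _ pairs], rule span_base) (auto simp: F(1), blast)
  have ot: "otimes [P', Q'] (tens_map F t) = tens_map F (otimes [P, Q] t)"
    if t: "t \<in> span {word [a, b] | a b. True}" and l: "linear P" "linear Q" "linear P'" "linear Q'"
      and P: "\<And>a. P' (F a) = tens_map F (P a)" and Q: "\<And>a. Q' (F a) = tens_map F (Q a)"
    for P Q :: "'a \<Rightarrow> 'a tens" and P' Q' :: "'b \<Rightarrow> 'b tens" and t
  proof (rule linear_eq_on_pairs[OF _ _ _ t])
    have lo: "linear (otimes [P, Q])" "linear (otimes [P', Q'])" by (rule linear_otimes, use l in auto)+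
    show "linear (\<lambda>t. otimes [P', Q'] (tens_map F t))" "linear (\<lambda>t. tens_map F (otimes [P, Q] t))"
      by (rule lin_comp[OF lo(2) lT] lin_comp[OF lT lo(1)])+
    fix a b
    show "otimes [P', Q'] (tens_map F (word [a, b])) = tens_map F (otimes [P, Q] (word [a, b]))"
      by (simp add: F(1) otimes_pair l P Q tens_map_conc)
  qed
  have lc: "linear (\<lambda>a. hcounit H a *\<^sub>R word [])" "linear (\<lambda>a. hcounit K a *\<^sub>R word [])"
    by (intro lin lcH lcK)+
  have coalg: "is_coalgebra K"
    unfolding is_coalgebra_def
  proof (intro conjI allI lcK pairsK)
    fix x
    obtain x' where x: "x = F x'" using ex by blast
    have "otimes [hcop K, letter] (hcop K x) = tens_map F (otimes [hcop H, letter] (hcop H x'))"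
      "otimes [letter, hcop K] (hcop K x) = tens_map F (otimes [letter, hcop H] (hcop H x'))"
      unfolding x cop by (rule ot[OF pairs]; simp add: lcH lcK letter_lin cop F(1))+
    then show "otimes [hcop K, letter] (hcop K x) = otimes [letter, hcop K] (hcop K x)"
      using H by (simp add: is_hopf_def is_coalgebra_def)
    have "otimes [\<lambda>a. hcounit K a *\<^sub>R word [], letter] (hcop K x) =
        tens_map F (otimes [\<lambda>a. hcounit H a *\<^sub>R word [], letter] (hcop H x'))"
      unfolding x cop by (rule ot[OF pairs]; simp add: lc letter_lin F(1) eps linear_cmul[OF lT])
    then show "otimes [\<lambda>a. hcounit K a *\<^sub>R word [], letter] (hcop K x) = letter x"
      using H by (simp add: is_hopf_def is_coalgebra_def F(1) x)
    have "otimes [letter, \<lambda>a. hcounit K a *\<^sub>R word []] (hcop K x) =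
        tens_map F (otimes [letter, \<lambda>a. hcounit H a *\<^sub>R word []] (hcop H x'))"
      unfolding x cop by (rule ot[OF pairs]; simp add: lc letter_lin F(1) eps linear_cmul[OF lT])
    then show "otimes [letter, \<lambda>a. hcounit K a *\<^sub>R word []] (hcop K x) = letter x"
      using H by (simp add: is_hopf_def is_coalgebra_def F(1) x)
  qed
  have cw: "tens_componentwise (hmul K) (tens_map F s) (tens_map F t) = tens_map F (tens_componentwise (hmul H) s t)" for s t
  proof -
    note b = bilinear_componentwise[OF bm] bilinear_componentwise[OF bmK]
    have 1: "tens_componentwise (hmul K) (tens_map F (word xs)) (tens_map F t) =
        tens_map F (tens_componentwise (hmul H) (word xs) t)" for xs
    proof (rule tens_eqI[where t = t])
      show "linear (\<lambda>t. tens_componentwise (hmul K) (tens_map F (word xs)) (tens_map F t))"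
        by (rule lin_bil2[OF b(2) lT])
      show "linear (\<lambda>t. tens_map F (tens_componentwise (hmul H) (word xs) t))"
        by (rule lin_comp[OF lT lin_bil2[OF b(1) linear_ident]])
      fix ys
      have "map2 (hmul K) (map F xs) (map F ys) = map F (map2 (hmul H) xs ys)"
        by (simp add: zip_map_map mul case_prod_unfold)
      then show "tens_componentwise (hmul K) (tens_map F (word xs)) (tens_map F (word ys)) =
          tens_map F (tens_componentwise (hmul H) (word xs) (word ys))"
        by (simp add: F(1) componentwise_word[OF bm] componentwise_word[OF bmK] linear_0[OF lT])
    qed
    show ?thesis
      by (rule tens_eqI[where t = s, OF lin_bil1[OF b(2) lT] lin_comp[OF lT lin_bil1[OF b(1) linear_ident]] 1])
  qed
  have cop_mul: "hcop K (hmul K x y) = tens_componentwise (hmul K) (hcop K x) (hcop K y)" for x y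
    using H by (simp add: mulK cop copK cw is_hopf_def)
  have cop_one: "hcop K (hone K) = word [hone K, hone K]"
    using H by (simp add: one[symmetric] cop F(1) is_hopf_def)
  have eps_mul: "hcounit K (hmul K x y) = hcounit K x * hcounit K y" "hcounit K (hone K) = 1" for x y
    using H by (simp_all add: mulK eps epsK one[symmetric] is_hopf_def)
  obtain S where S: "linear S"
    "\<And>x. tens_mult (hmul H) (hone H) (otimes [\<lambda>a. letter (S a), letter] (hcop H x)) = hcounit H x *\<^sub>R hone H"
    "\<And>x. tens_mult (hmul H) (hone H) (otimes [letter, \<lambda>a. letter (S a)] (hcop H x)) = hcounit H x *\<^sub>R hone H"
    using H unfolding is_hopf_def by blast
  define S' where "S' = (\<lambda>x. F (S (?G x)))"
  have lS': "linear S'" unfolding S'_def by (rule lin_comp[OF F(1) lin_comp[OF S(1) lG]])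
  have tm: "tens_mult (hmul K) (hone K) (tens_map F t) = F (tens_mult (hmul H) (hone H) t)" for t
  proof (rule tens_eqI[where t = t, OF lin_comp[OF linear_tens_mult[OF bmK] lT] lin_comp[OF F(1) linear_tens_mult[OF bm]]])
    fix xs
    have "foldr (hmul K) (map F xs) (hone K) = F (foldr (hmul H) xs (hone H))"
      by (induction xs) (simp_all add: one mul)
    then show "tens_mult (hmul K) (hone K) (tens_map F (word xs)) = F (tens_mult (hmul H) (hone H) (word xs))"
      by (simp add: F(1) tens_mult_word[OF bm] tens_mult_word[OF bmK])
  qed
  have lS: "linear (\<lambda>a. letter (S a))" "linear (\<lambda>a. letter (S' a))" by (intro lin S(1) lS')+
  have "tens_mult (hmul K) (hone K) (otimes [\<lambda>a. letter (S' a), letter] (hcop K x)) = hcounit K x *\<^sub>R hone K \<and>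
      tens_mult (hmul K) (hone K) (otimes [letter, \<lambda>a. letter (S' a)] (hcop K x)) = hcounit K x *\<^sub>R hone K" for x
  proof -
    obtain x' where x: "x = F x'" using ex by blast
    have "otimes [\<lambda>a. letter (S' a), letter] (hcop K x) = tens_map F (otimes [\<lambda>a. letter (S a), letter] (hcop H x'))"
      "otimes [letter, \<lambda>a. letter (S' a)] (hcop K x) = tens_map F (otimes [letter, \<lambda>a. letter (S a)] (hcop H x'))"
      unfolding x cop by (rule ot[OF pairs]; simp add: lS letter_lin F(1) S'_def lS[unfolded S'_def])+
    then show ?thesis
      by (simp add: tm S eps x one linear_cmul[OF F(1)])
  qed
  then show ?thesis
    unfolding is_hopf_def using alg coalg cop_mul cop_one eps_mul lS' by blast
qed

lemma graded_transport:
  fixes H :: "('a::real_vector) hopf_data" and K :: "('b::real_vector) hopf_data"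
  assumes H: "is_graded_connected_hopf H" and F: "linear F" "bij F"
    and mul: "\<And>x y. F (hmul H x y) = hmul K (F x) (F y)" and one: "F (hone H) = hone K"
    and cop: "\<And>x. hcop K (F x) = tens_map F (hcop H x)" and eps: "\<And>x. hcounit K (F x) = hcounit H x"
    and deg: "\<And>n. hdeg K n = F ` hdeg H n" and grad: "vec_grading (hdeg K)"
  shows "is_graded_connected_hopf K"
  unfolding is_graded_connected_hopf_def
proof (intro conjI allI impI ballI grad)
  have hH: "is_hopf H" using H by (simp add: is_graded_connected_hopf_def)
  show "is_hopf K" by (rule hopf_transport[OF hH F mul one cop eps])
  show "hmul K x y \<in> hdeg K (i + j)" if "x \<in> hdeg K i" "y \<in> hdeg K j" for i j x y
    using that H unfolding deg is_graded_connected_hopf_def by (auto simp: mul[symmetric])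
  show "hcop K x \<in> tens_deg (hdeg K) n" if "x \<in> hdeg K n" for n x
  proof -
    have "x \<in> F ` hdeg H n" using that by (simp add: deg)
    then obtain x' where x: "x = F x'" "x' \<in> hdeg H n" by blast
    have "tens_map F (hcop H x') \<in> tens_deg (hdeg K) n"
      by (rule tens_map_deg[OF F(1), of "hdeg H"]) (use H x in \<open>auto simp: deg is_graded_connected_hopf_def\<close>)
    then show ?thesis by (simp add: x cop)
  qed
  show "hcounit K x = 0" if "0 < n" "x \<in> hdeg K n" for n x
    using that H by (auto simp: deg eps is_graded_connected_hopf_def)
  show "hdeg K 0 = span {hone K}"
    using H linear_span_image[OF F(1), of "{hone H}"]
    by (simp add: deg one is_graded_connected_hopf_def)
qed

lemma hopf_iso_inv:
  assumes "hopf_iso H K F"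
  shows "hopf_hom K H (inv F)"
proof -
  have F: "linear F" "bij F" and mul: "\<And>x y. F (hmul H x y) = hmul K (F x) (F y)" and one: "F (hone H) = hone K"
    and cop: "\<And>x. hcop K (F x) = tens_map F (hcop H x)" and eps: "\<And>x. hcounit K (F x) = hcounit H x"
    using assms by (auto simp: hopf_iso_def hopf_hom_def)
  have FG: "F (inv F x) = x" for x using F(2) by (simp add: bij_is_surj surj_f_inv_f)
  have GF: "inv F (F x) = x" for x using F(2) by (simp add: bij_is_inj)
  note lG = linear_inv[OF F]
  show ?thesis
    unfolding hopf_hom_def
  proof (intro conjI allI lG)
    fix x y
    show "inv F (hmul K x y) = hmul H (inv F x) (inv F y)" by (metis FG GF mul)
    show "inv F (hone K) = hone H" by (metis GF one)
    have "tens_map (inv F) (hcop K (F (inv F x))) = hcop H (inv F x)"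
      unfolding cop tens_map_comp[OF F(1) lG] GF tens_map_ident ..
    then show "hcop H (inv F x) = tens_map (inv F) (hcop K x)" by (simp add: FG)
    show "hcounit H (inv F x) = hcounit K x" by (metis FG eps)
  qed
qed

lemma hopf_hom_comp:
  assumes "hopf_hom H K F" "hopf_hom K L G"
  shows "hopf_hom H L (\<lambda>x. G (F x))"
  using assms unfolding hopf_hom_def by (auto simp: lin_comp tens_map_comp)

subsection \<open>The logarithm is an isomorphism of Hopf algebras\<close>

lemma hopf_iso_log: "hopf_iso ck_hopf sh_hopf log_map"
  by (simp add: hopf_iso_def hopf_hom_def linear_log log_mult log_one deconc_log counit_log bij_log
      tens_map_cop[OF linear_log])

lemma log_unique:
  assumes L: "hopf_iso ck_hopf sh_hopf L" and pi: "\<And>h. tens_pi (L h) = log_letter h"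
  shows "L = log_map"
proof
  fix h
  have l: "linear L" and cop: "\<And>h. deconc (L h) = tens_map L (ck_cop h)" and eps: "\<And>h. tens_counit (L h) = ck_counit h"
    using L by (auto simp: hopf_iso_def hopf_hom_def)
  show "L h = log_map h"
  proof (rule lift_unique[OF l linear_log linear_log_letter log_letter_one _ log_rec])
    show "L h = ck_counit h *\<^sub>R word [] + cosum (\<lambda>a b. snoc (L a) (log_letter b)) h" for h
      using coalgebra_map_rec[OF l, of h] by (simp add: cop eps tens_map_cop[OF l] pi)
  qed
qed

lemma ck_Log: "ck_Log = log_map"
  unfolding ck_Log_def
  by (rule the_equality) (use hopf_iso_log pi_log log_unique in \<open>auto simp: log_letter_def\<close>)

lemma ck_Exp: "ck_Exp = inv log_map"
  by (simp add: ck_Exp_def ck_Log)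

lemma shuffle_commute: "tens_shuffle s t = tens_shuffle t s"
proof -
  have w: "tens_shuffle (word xs) t = tens_shuffle t (word xs)" for xs
    by (rule tens_eqI[where t = t], intro lin, intro lin) (unfold shuffle_word, rule shuffle_sum_commute)
  show ?thesis by (rule tens_eqI[where t = s], intro lin, intro lin, rule w)
qed

lemma graded_sh: "is_graded_connected_hopf (sh_hopf :: 'u::real_vector prim tens hopf_data)"
  by (rule graded_transport[OF graded_ck linear_log bij_log])
    (simp_all add: log_mult log_one deconc_log tens_map_cop[OF linear_log] counit_log log_image_deg vec_grading_sh)

lemma ck_pi_image: "ck_pi ` ck_deg n = prim_deg n"
proof (intro equalityI subsetI)
  fix p assume "p \<in> prim_deg n"
  then show "p \<in> ck_pi ` ck_deg n"
    by (intro image_eqI[of _ _ "Rep_prim p"]) (simp_all add: ck_pi_prim prim_deg_def)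
qed (auto intro: ck_pi_deg)

lemma tens_pi_image: "tens_pi ` tens_deg prim_deg n = (prim_deg n :: 'u::real_vector prim set)"
proof (intro equalityI subsetI)
  fix p :: "'u prim" assume "p \<in> prim_deg n"
  then show "p \<in> tens_pi ` tens_deg prim_deg n"
    using word_tens_deg[of prim_deg "[p]" "[n]"] by (intro image_eqI[of _ _ "letter p"]) simp_all
next
  fix p :: "'u prim" assume "p \<in> tens_pi ` tens_deg prim_deg n"
  then obtain t where t: "p = tens_pi t" "t \<in> tens_deg prim_deg n" by blast
  have "tens_pi (word ps) \<in> prim_deg n"
    if "list_all2 (\<lambda>x d. x \<in> prim_deg d) ps ds" "sum_list ds = n" for ps :: "'u prim list" and ds
    using that by (cases ps) (auto simp: subspace_0[OF subspace_prim_deg] list_all2_Cons1)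
  then show "p \<in> prim_deg n"
    unfolding t(1) by (rule tens_deg_image[OF linear_tens_pi subspace_prim_deg _ t(2)])
qed

lemma Binf_ck: "is_comm_Binf (ck_hopf :: 'u::real_vector ck hopf_data) (ck_pi :: 'u ck \<Rightarrow> 'u prim)"
proof -
  note pp = linear_prim_part prim_part_one
  have p: "tens_pi (cofree_lift prim_part h) = ck_pi h" for h :: "'u ck"
    by (simp add: pi_lift[OF pp] ck_pi)
  have "linear (ck_pi :: 'u ck \<Rightarrow> _)" by (simp add: ck_pi[abs_def] linear_prim_part)
  moreover have "bij (cofree_lift (prim_part :: 'u ck \<Rightarrow> _))"
    using bij_imp_bij_inv[OF bij_growth] by (simp add: inv_growth)
  ultimately have "cofree_along (ck_hopf :: 'u ck hopf_data) ck_pi"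
    unfolding cofree_along_def
    by (auto intro!: exI[of _ "cofree_lift prim_part"] simp: linear_lift[OF pp] ck_pi_image vec_grading_prim
        deconc_lift[OF pp] tens_map_cop[OF linear_lift[OF pp]] counit_lift[OF pp] p lift_prim_deg)
  then show ?thesis by (simp add: is_comm_Binf_def graded_ck mult_commute)
qed

lemma Binf_sh: "is_comm_Binf (sh_hopf :: 'u::real_vector prim tens hopf_data) (tens_pi :: 'u prim tens \<Rightarrow> 'u prim)"
proof -
  have "cofree_along (sh_hopf :: 'u prim tens hopf_data) tens_pi"
    unfolding cofree_along_def
    by (auto intro!: exI[of _ "\<lambda>t. t"] simp: linear_tens_pi tens_pi_image vec_grading_prim linear_ident
        tens_map_ident bij_def)
  then show ?thesis unfolding is_comm_Binf_def sh_hopf_simps using graded_sh shuffle_commute by blast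
qed

section \<open>Naturality of the logarithm\<close>

lemma growth_append: "growth (word (ps @ [p])) = ck_top (growth (word ps)) (Rep_prim p)"
  using growth_snoc[of "word ps" p] by simp

context
  fixes \<theta> :: "'u::real_vector \<Rightarrow> 'v::real_vector"
  assumes \<theta>: "linear \<theta>"
begin

lemma cop_map: "ck_cop (ck_map \<theta> h) = tens_map (ck_map \<theta>) (ck_cop h)"
  unfolding tens_map_cop[OF linear_ck_map[OF \<theta>]] by (simp add: ck_cop_cosum cosum_map[OF \<theta> bilinear_word])

lemma map_prim: "p \<in> ck_prim \<Longrightarrow> ck_map \<theta> p \<in> ck_prim"
  by (simp add: prim_iff cop_map ck_counit_map[OF \<theta>] linear_add[OF linear_tens_map[OF linear_ck_map[OF \<theta>]]]
      tens_map_word[OF linear_ck_map[OF \<theta>]] ck_map_one[OF \<theta>])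

lemma map_deg: "h \<in> ck_deg n \<Longrightarrow> ck_map \<theta> h \<in> ck_deg n"
  by (rule ck_deg_image[OF linear_ck_map[OF \<theta>] subspace_ck_deg]) (auto simp: ck_map_ck[OF \<theta>] intro: ck_in_deg)

lemma graded_hom_map: "graded_hopf_hom ck_hopf ck_hopf (ck_map \<theta>)"
  by (auto simp: graded_hopf_hom_def hopf_hom_def linear_ck_map \<theta> ck_map_mult ck_map_one cop_map
      ck_counit_map map_deg)

lemma Rep_prim_map: "Rep_prim (prim_map \<theta> p) = ck_map \<theta> (Rep_prim p)"
  unfolding prim_map_def by (rule Abs_prim_inverse) (rule map_prim[OF Rep_prim_in])

lemma linear_prim_map: "linear (prim_map \<theta>)"
  by (rule linearI; rule Rep_prim_inject[THEN iffD1])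
    (simp_all add: Rep_prim_map plus_prim.rep_eq scaleR_prim.rep_eq
      linear_add[OF linear_ck_map[OF \<theta>]] linear_cmul[OF linear_ck_map[OF \<theta>]])

lemma linear_sh_map: "linear (sh_map \<theta>)"
  and sh_map_word: "sh_map \<theta> (word ps) = word (map (prim_map \<theta>) ps)"
  unfolding sh_map_def by (simp_all add: linear_tens_map linear_prim_map)

lemma map_scale: "ck_map \<theta> (ck_scale c h) = ck_scale c (ck_map \<theta> h)"
  by (rule ck_eqI[where h = h], intro lin_comp[OF linear_ck_map[OF \<theta>]] linear_ck_scale,
      intro lin linear_ck_map[OF \<theta>])
    (simp add: ck_scale_ck ck_map_ck[OF \<theta>] linear_cmul[OF linear_ck_map[OF \<theta>]])

lemma map_graft: "ck_map \<theta> (ck_graft h k) = ck_graft (ck_map \<theta> h) (ck_map \<theta> k)"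
  by (rule ck_eqI2[where h = h and k = k])
    ((intro bilinearI lin lin_comp[OF linear_ck_map[OF \<theta>]] linear_ck_map[OF \<theta>])+,
      simp add: graft_ck ck_map_ck[OF \<theta>] linear_sum[OF linear_ck_map[OF \<theta>]] map_dec_graft)

lemma map_top: "ck_map \<theta> (ck_top h k) = ck_top (ck_map \<theta> h) (ck_map \<theta> k)"
  by (simp add: top_graft linear_add[OF linear_ck_map[OF \<theta>]] linear_cmul[OF linear_ck_map[OF \<theta>]]
      map_graft map_scale ck_counit_map[OF \<theta>])

lemma map_growth: "ck_map \<theta> (growth t) = growth (sh_map \<theta> t)"
proof (rule tens_eqI[where t = t, OF lin_comp[OF linear_ck_map[OF \<theta>] linear_growth]
      lin_comp[OF linear_growth linear_sh_map]])
  fix ps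
  show "ck_map \<theta> (growth (word ps)) = growth (sh_map \<theta> (word ps))"
  proof (induction ps rule: rev_induct)
    case Nil
    show ?case by (simp add: sh_map_word ck_map_one[OF \<theta>])
  next
    case (snoc p ps)
    then show ?case by (simp add: sh_map_word map_top Rep_prim_map growth_append)
  qed
qed

lemma pi_sh_map: "tens_pi (sh_map \<theta> t) = prim_map \<theta> (tens_pi t)"
proof (rule tens_eqI[where t = t, OF lin_comp[OF linear_tens_pi linear_sh_map] lin_comp[OF linear_prim_map linear_tens_pi]])
  fix ps
  show "tens_pi (sh_map \<theta> (word ps)) = prim_map \<theta> (tens_pi (word ps))"
    by (cases ps) (simp_all add: sh_map_word linear_0[OF linear_prim_map])
qed

lemma ck_pi_map: "ck_pi (ck_map \<theta> h) = prim_map \<theta> (ck_pi h)"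
proof -
  obtain t where h: "h = growth t" using growth_lift by metis
  show ?thesis
    unfolding h map_growth by (simp add: ck_pi_def pi_sh_map bij_is_inj[OF bij_growth])
qed

lemma red_pow_map: "red_pow n (ck_map \<theta> h) = ck_map \<theta> (red_pow n h)"
proof (induction n arbitrary: h)
  case 0
  show ?case by (simp add: ck_counit_map[OF \<theta>] linear_cmul[OF linear_ck_map[OF \<theta>]] ck_map_one[OF \<theta>])
next
  case (Suc n)
  have "ck_red (ck_map \<theta> b) = ck_map \<theta> (ck_red b)" for b
    by (simp add: ck_red_def ck_counit_map[OF \<theta>] linear_diff[OF linear_ck_map[OF \<theta>]]
        linear_cmul[OF linear_ck_map[OF \<theta>]] ck_map_one[OF \<theta>])
  then show ?case
    by (simp add: cosum_map[OF \<theta> bilinear_coiter[OF bilinear_mult linear_red]] Suc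
        cosum_comp[OF linear_ck_map[OF \<theta>]] ck_map_mult[OF \<theta>])
qed

lemma eulerian_map: "eulerian (ck_map \<theta> h) = ck_map \<theta> (eulerian h)"
proof (rule ck_eqI[where h = h, OF lin_comp[OF linear_eulerian linear_ck_map[OF \<theta>]]
      lin_comp[OF linear_ck_map[OF \<theta>] linear_eulerian]])
  fix f
  have "eulerian (ck_map \<theta> (ck f)) = (\<Sum>n\<le>card (verts f). log_coeff n *\<^sub>R red_pow n (ck_map \<theta> (ck f)))"
    unfolding ck_map_ck[OF \<theta>] by (rule eulerian_ck) simp
  then show "eulerian (ck_map \<theta> (ck f)) = ck_map \<theta> (eulerian (ck f))"
    by (simp only: red_pow_map eulerian_ck[OF order_refl] linear_sum[OF linear_ck_map[OF \<theta>]]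
        linear_cmul[OF linear_ck_map[OF \<theta>]])
qed

text \<open>Both sides are lifts of the same map, since \<open>\<pi>\<close> and the Eulerian idempotent are natural.\<close>

lemma log_natural: "log_map (ck_map \<theta> h) = sh_map \<theta> (log_map h)"
proof (rule lift_unique[where \<phi> = "\<lambda>h. prim_map \<theta> (log_letter h)"])
  note lm = linear_ck_map[OF \<theta>]
  have letter: "log_letter (ck_map \<theta> h) = prim_map \<theta> (log_letter h)" for h
    by (simp add: log_letter_def eulerian_map ck_pi_map)
  show "linear (\<lambda>h. log_map (ck_map \<theta> h))" "linear (\<lambda>h. sh_map \<theta> (log_map h))"
    "linear (\<lambda>h. prim_map \<theta> (log_letter h))" "prim_map \<theta> (log_letter ck_one) = 0"
    using lin_comp[OF linear_log lm] lin_comp[OF linear_sh_map linear_log]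
      lin_comp[OF linear_prim_map linear_log_letter] by (simp_all add: linear_0[OF linear_prim_map])
  fix h
  have b: "bilinear (\<lambda>a b. snoc (log_map a) (log_letter b))"
    by (intro bilinearI lin linear_log)
  show "log_map (ck_map \<theta> h) = ck_counit h *\<^sub>R word [] +
      cosum (\<lambda>a b. snoc (log_map (ck_map \<theta> a)) (prim_map \<theta> (log_letter b))) h"
    using log_rec[of "ck_map \<theta> h"] by (simp add: ck_counit_map[OF \<theta>] cosum_map[OF \<theta> b] letter)
  have "sh_map \<theta> (snoc t p) = snoc (sh_map \<theta> t) (prim_map \<theta> p)" for t p
    unfolding sh_map_def by (simp add: tens_map_conc linear_prim_map)
  then show "sh_map \<theta> (log_map h) = ck_counit h *\<^sub>R word [] +
      cosum (\<lambda>a b. snoc (sh_map \<theta> (log_map a)) (prim_map \<theta> (log_letter b))) h"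
    using arg_cong[OF log_rec[of h], of "sh_map \<theta>"]
    by (simp add: linear_add[OF linear_sh_map] linear_cmul[OF linear_sh_map] sh_map_word
        cosum_comp[OF linear_sh_map])
qed

end

theorem theorem3p4:
  assumes U: "\<exists>B :: 'u::real_vector set. finite B \<and> span B = UNIV"
    and V: "\<exists>B :: 'v::real_vector set. finite B \<and> span B = UNIV"
    and W: "\<exists>B :: 'w::real_vector set. finite B \<and> span B = UNIV"
  shows
    "\<comment> \<open>existence and uniqueness of the logarithm\<close>
     (\<exists>!L :: 'u ck \<Rightarrow> 'u prim tens.
        hopf_iso ck_hopf sh_hopf L \<and> (\<forall>h. tens_pi (L h) = ck_pi (eulerian h))) \<and>
     \<comment> \<open>formula for the logarithm\<close>
     (\<forall>h :: 'u ck. finite {n. ck_red_cop_iter n h \<noteq> 0} \<and>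
        ck_Log h = Sum_any (\<lambda>n. tens_map (ck_pi \<circ> eulerian) (ck_red_cop_iter n h))) \<and>
     \<comment> \<open>formula for its inverse, the exponential\<close>
     (\<forall>t \<in> (sh_plus :: 'u prim tens set).
        finite {i \<in> exp_index. exp_term i t \<noteq> 0} \<and>
        ck_Exp t = growth (Sum_any (\<lambda>i. if i \<in> exp_index then exp_term i t else 0))) \<and>
     \<comment> \<open>recursion for the exponential\<close>
     (\<forall>n\<ge>1. \<forall>t :: 'u prim tens.
        ck_Exp (tens_proj n t) = growth (\<Sum>m=1..n. Exp_comp m n t) \<and>
        Exp_comp n n t = tens_proj n t) \<and>
     (\<forall>m n. \<forall>t :: 'u prim tens. 1 \<le> m \<and> m < n \<longrightarrow>
        Exp_comp m n t = - (\<Sum>k\<in>{m..<n}. Exp_comp m k (Log_comp k n t))) \<and>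
     \<comment> \<open>the two functors to commutative B-infinity algebras\<close>
     is_comm_Binf (ck_hopf :: 'u ck hopf_data) (ck_pi :: 'u ck \<Rightarrow> 'u prim) \<and>
     is_comm_Binf (sh_hopf :: 'u prim tens hopf_data) (tens_pi :: 'u prim tens \<Rightarrow> 'u prim) \<and>
     (\<forall>\<theta> :: 'u \<Rightarrow> 'v. linear \<theta> \<longrightarrow>
        ck_map \<theta> ` ck_prim \<subseteq> ck_prim \<and>
        graded_hopf_hom ck_hopf ck_hopf (ck_map \<theta>) \<and>
        graded_hopf_hom sh_hopf sh_hopf (sh_map \<theta>)) \<and>
     ck_map (id :: 'u \<Rightarrow> 'u) = id \<and> sh_map (id :: 'u \<Rightarrow> 'u) = id \<and>
     (\<forall>(\<theta> :: 'u \<Rightarrow> 'v) (\<eta> :: 'v \<Rightarrow> 'w). linear \<theta> \<and> linear \<eta> \<longrightarrow>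
        ck_map (\<eta> \<circ> \<theta>) = ck_map \<eta> \<circ> ck_map \<theta> \<and> sh_map (\<eta> \<circ> \<theta>) = sh_map \<eta> \<circ> sh_map \<theta>) \<and>
     \<comment> \<open>logarithm and exponential are mutually inverse natural isomorphisms between them\<close>
     graded_hopf_hom ck_hopf sh_hopf (ck_Log :: 'u ck \<Rightarrow> 'u prim tens) \<and>
     graded_hopf_hom sh_hopf ck_hopf (ck_Exp :: 'u prim tens \<Rightarrow> 'u ck) \<and>
     (\<forall>h :: 'u ck. ck_Exp (ck_Log h) = h) \<and> (\<forall>t :: 'u prim tens. ck_Log (ck_Exp t) = t) \<and>
     (\<forall>\<theta> :: 'u \<Rightarrow> 'v. linear \<theta> \<longrightarrow>
        ck_Log \<circ> ck_map \<theta> = sh_map \<theta> \<circ> ck_Log \<and>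
        ck_Exp \<circ> sh_map \<theta> = ck_map \<theta> \<circ> ck_Exp) \<and>
     \<comment> \<open>identity on primitives\<close>
     (\<forall>p :: 'u prim. ck_Log (Rep_prim p) = letter p \<and> ck_Exp (letter p) = Rep_prim p)"
proof -
  have uniq: "\<exists>!L :: 'u ck \<Rightarrow> 'u prim tens.
      hopf_iso ck_hopf sh_hopf L \<and> (\<forall>h. tens_pi (L h) = ck_pi (eulerian h))"
    by (rule ex1I[of _ log_map]) (use hopf_iso_log pi_log log_unique in \<open>auto simp: log_letter_def\<close>)
  have formula: "\<forall>h :: 'u ck. finite {n. ck_red_cop_iter n h \<noteq> 0} \<and>
      ck_Log h = Sum_any (\<lambda>n. tens_map (ck_pi \<circ> eulerian) (ck_red_cop_iter n h))"
    unfolding ck_Log log_map_def iter_lift[OF linear_log_letter log_letter_one]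
    by (simp add: finite_iter log_letter_def[abs_def] o_def)
  have Exp: "ck_Exp t = growth (tens_exp t)" for t :: "'u prim tens"
    by (simp add: ck_Exp inv_log)
  have exp_formula: "\<forall>t \<in> (sh_plus :: 'u prim tens set).
      finite {i \<in> exp_index. exp_term i t \<noteq> 0} \<and>
      ck_Exp t = growth (Sum_any (\<lambda>i. if i \<in> exp_index then exp_term i t else 0))"
    by (intro ballI conjI tens_exp_formula(1)) (simp_all only: Exp tens_exp_formula(2))
  have Log_comp: "Log_comp m n t = log_comp m n t" for m n and t :: "'u prim tens"
    using proj_tens_log_proj[of m n t] by (simp add: Log_comp_def ck_Log tens_log_def)
  have Exp_comp: "Exp_comp m n t = tens_proj m (tens_exp (tens_proj n t))" for m n and t :: "'u prim tens"
    by (simp add: Exp_comp_def Exp bij_is_inj[OF bij_growth])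
  have rec1: "\<forall>n\<ge>1. \<forall>t :: 'u prim tens.
      ck_Exp (tens_proj n t) = growth (\<Sum>m=1..n. Exp_comp m n t) \<and> Exp_comp n n t = tens_proj n t"
    unfolding Exp Exp_comp
    by (intro allI impI conjI arg_cong[where f = growth] tens_exp_proj_sum) (simp_all add: proj_tens_exp)
  have rec2: "\<forall>m n. \<forall>t :: 'u prim tens. 1 \<le> m \<and> m < n \<longrightarrow>
      Exp_comp m n t = - (\<Sum>k\<in>{m..<n}. Exp_comp m k (Log_comp k n t))"
    unfolding Exp_comp Log_comp by (simp add: tens_exp_comp_rec proj_log_comp)
  have Log_Exp: "ck_Exp (ck_Log h) = h" "ck_Log (ck_Exp t) = t" for h :: "'u ck" and t
    by (simp_all add: ck_Log ck_Exp bij_is_inj[OF bij_log] bij_is_surj[OF bij_log] surj_f_inv_f)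
  have Log_hom: "graded_hopf_hom ck_hopf sh_hopf (ck_Log :: 'u ck \<Rightarrow> 'u prim tens)"
    using hopf_iso_log by (auto simp: graded_hopf_hom_def ck_Log hopf_iso_def log_deg)
  have Exp_hom: "graded_hopf_hom sh_hopf ck_hopf (ck_Exp :: 'u prim tens \<Rightarrow> 'u ck)"
    unfolding graded_hopf_hom_def ck_Exp using hopf_iso_inv[OF hopf_iso_log]
    by (auto simp: log_image_deg[symmetric] bij_is_inj[OF bij_log])
  have nat_Log: "ck_Log (ck_map \<theta> h) = sh_map \<theta> (ck_Log h)" if "linear \<theta>"
    for \<theta> :: "'u \<Rightarrow> 'v" and h
    by (simp add: ck_Log log_natural[OF that])
  have LE_v: "ck_Exp (ck_Log k) = k" for k :: "'v ck"
    by (simp add: ck_Log ck_Exp bij_is_inj[OF bij_log])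
  have nat_Exp: "ck_Exp (sh_map \<theta> t) = ck_map \<theta> (ck_Exp t)" if "linear \<theta>"
    for \<theta> :: "'u \<Rightarrow> 'v" and t
    using nat_Log[OF that, of "ck_Exp t"] LE_v by (metis Log_Exp(2))
  have functors: "ck_map \<theta> ` ck_prim \<subseteq> ck_prim \<and> graded_hopf_hom ck_hopf ck_hopf (ck_map \<theta>) \<and>
      graded_hopf_hom sh_hopf sh_hopf (sh_map \<theta>)" if \<theta>: "linear \<theta>" for \<theta> :: "'u \<Rightarrow> 'v"
  proof -
    \<comment> \<open>conjugation with the logarithm transfers functoriality from forests to words\<close>
    have e: "sh_map \<theta> = (\<lambda>t. ck_Log (ck_map \<theta> (ck_Exp t)))"
      by (simp add: nat_Log[OF \<theta>] Log_Exp)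
    have "hopf_hom sh_hopf sh_hopf (sh_map \<theta>)"
      unfolding e
      by (rule hopf_hom_comp[OF hopf_hom_comp[of _ ck_hopf _ ck_hopf]])
        (use Exp_hom graded_hom_map[OF \<theta>] hopf_iso_log in \<open>auto simp: graded_hopf_hom_def ck_Log hopf_iso_def\<close>)
    moreover have "sh_map \<theta> t \<in> tens_deg prim_deg n" if "t \<in> tens_deg prim_deg n" for t n
      unfolding sh_map_def
      by (rule tens_map_deg[OF linear_prim_map[OF \<theta>] _ that]) (simp add: prim_deg_def Rep_prim_map[OF \<theta>] map_deg[OF \<theta>])
    ultimately show ?thesis
      using map_prim[OF \<theta>] graded_hom_map[OF \<theta>] by (auto simp: graded_hopf_hom_def)
  qed
  have map_id: "ck_map (id :: 'u \<Rightarrow> 'u) = id"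
  proof
    fix h :: "'u ck"
    have "map_dec id f = f" for f :: "'u forest" by (rule forest_eqI) auto
    then show "ck_map id h = id h"
      using ck_eqI[OF linear_ck_map[OF linear_id] linear_ident, of h] by (simp add: ck_map_ck linear_id)
  qed
  have prim_id: "prim_map (id :: 'u \<Rightarrow> 'u) = (\<lambda>p. p)"
    by (simp add: fun_eq_iff prim_map_def map_id Rep_prim_inverse)
  have sh_id: "sh_map (id :: 'u \<Rightarrow> 'u) = id"
    by (simp add: fun_eq_iff sh_map_def prim_id tens_map_ident)
  have comp: "ck_map (\<eta> \<circ> \<theta>) = ck_map \<eta> \<circ> ck_map \<theta> \<and> sh_map (\<eta> \<circ> \<theta>) = sh_map \<eta> \<circ> sh_map \<theta>"
    if l: "linear \<theta>" "linear \<eta>" for \<theta> :: "'u \<Rightarrow> 'v" and \<eta> :: "'v \<Rightarrow> 'w"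
  proof -
    have lc: "linear (\<eta> \<circ> \<theta>)" by (rule linear_compose[OF l])
    have c: "ck_map (\<eta> \<circ> \<theta>) h = ck_map \<eta> (ck_map \<theta> h)" for h
    proof (rule ck_eqI[OF linear_ck_map[OF lc] lin_comp[OF linear_ck_map[OF l(2)] linear_ck_map[OF l(1)]]])
      fix f
      have "map_dec (\<eta> \<circ> \<theta>) f = map_dec \<eta> (map_dec \<theta> f)" by (rule forest_eqI) auto
      then show "ck_map (\<eta> \<circ> \<theta>) (ck f) = ck_map \<eta> (ck_map \<theta> (ck f))"
        by (simp add: ck_map_ck lc l)
    qed
    have "prim_map (\<eta> \<circ> \<theta>) p = prim_map \<eta> (prim_map \<theta> p)" for p
      by (rule Rep_prim_inject[THEN iffD1]) (simp add: Rep_prim_map lc l c)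
    then have "prim_map (\<eta> \<circ> \<theta>) = (\<lambda>p. prim_map \<eta> (prim_map \<theta> p))" by auto
    then have "sh_map (\<eta> \<circ> \<theta>) t = sh_map \<eta> (sh_map \<theta> t)" for t
      unfolding sh_map_def by (simp add: tens_map_comp[OF linear_prim_map[OF l(1)] linear_prim_map[OF l(2)]])
    then show ?thesis using c by auto
  qed
  have prims: "ck_Log (Rep_prim p) = letter p" "ck_Exp (letter p) = Rep_prim p" for p :: "'u prim"
  proof -
    have b: "bilinear (\<lambda>a b :: 'u ck. snoc (log_map a) (log_letter b))" by (intro bilinearI lin linear_log)
    have "log_map (Rep_prim p) = letter p"
      by (subst log_rec) (simp add: cosum_prim[OF Rep_prim_in b] log_one prim_iff[THEN iffD1, OF Rep_prim_in])
    then show L: "ck_Log (Rep_prim p) = letter p" by (simp add: ck_Log)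
    show "ck_Exp (letter p) = Rep_prim p" using Log_Exp(1)[of "Rep_prim p"] by (simp add: L)
  qed
  have functors': "\<forall>\<theta> :: 'u \<Rightarrow> 'v. linear \<theta> \<longrightarrow> ck_map \<theta> ` ck_prim \<subseteq> ck_prim \<and>
      graded_hopf_hom ck_hopf ck_hopf (ck_map \<theta>) \<and> graded_hopf_hom sh_hopf sh_hopf (sh_map \<theta>)"
    by (intro allI impI functors)
  have comp': "\<forall>(\<theta> :: 'u \<Rightarrow> 'v) (\<eta> :: 'v \<Rightarrow> 'w). linear \<theta> \<and> linear \<eta> \<longrightarrow>
      ck_map (\<eta> \<circ> \<theta>) = ck_map \<eta> \<circ> ck_map \<theta> \<and> sh_map (\<eta> \<circ> \<theta>) = sh_map \<eta> \<circ> sh_map \<theta>"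
    by (intro allI impI, elim conjE) (rule comp)
  have natural: "\<forall>\<theta> :: 'u \<Rightarrow> 'v. linear \<theta> \<longrightarrow>
      ck_Log \<circ> ck_map \<theta> = sh_map \<theta> \<circ> ck_Log \<and> ck_Exp \<circ> sh_map \<theta> = ck_map \<theta> \<circ> ck_Exp"
    by (simp add: fun_eq_iff nat_Log nat_Exp)
  have inverse: "\<forall>h :: 'u ck. ck_Exp (ck_Log h) = h" "\<forall>t :: 'u prim tens. ck_Log (ck_Exp t) = t"
    by (simp_all only: Log_Exp simp_thms)
  have prims': "\<forall>p :: 'u prim. ck_Log (Rep_prim p) = letter p \<and> ck_Exp (letter p) = Rep_prim p"
    by (simp only: prims simp_thms)
  show ?thesis
    by (intro conjI; rule uniq formula exp_formula rec1 rec2 Binf_ck Binf_sh functors' map_id sh_id comp'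
        Log_hom Exp_hom inverse natural prims')
qed

end
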